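(* (1) All toric del Pezzo surfaces, with their anticanonical polarization, are uniformly relatively K-polystable. (2) In dimension $3$, at least $13$ of the $18$ toric Fano manifolds (up to isomorphism), with their anticanonical polarization, are uniformly relatively K-polystable.
   Context: Toric del Pezzo surfaces are the smooth toric Fano surfaces. A toric Fano manifold $X$ of dimension $n$ with polarization $L=-K_X$ corresponds to the integral Delzant polytope $P=\{x\in\mathbf{R}^n\mid\langle\lambda_j,x\rangle+1\ge0\ (j=1,\dots,r)\}$, where $\lambda_1,\dots,\lambda_r\in\mathbf{Z}^n$ are the primitive generators of the rays of the fan of $X$; its facets are $F_j=\{x\in P\mid\langle\lambda_j,x\rangle+1=0\}$. $\sigma$ is the Borel measure on $\partial P$ equal on $F_j$ to $|\lambda_j|^{-1}$ times $(n-1)$-dimensional Lebesgue measure; $\overline{s}=\sigma(\partial P)/\mathrm{vol}(P)$ ($=n$ here); $V$ is the unique affine function on $P$ such that $\int_{\partial P}\ell\,d\sigma=\int_P(\overline{s}+V)\ell\,dx$ for every affine $\ell$. $L_V(f)=\int_{\partial P}f\,d\sigma-\int_P(\overline{s}+V)f\,dx$. $\mathcal{C}_{PL}^{\mathbf{Q}}$ is the set of rational piecewise affine convex functions on $P$ (maxima of finitely many affine functions with rational coefficients). $\|f\|_J=\inf_{\xi\ \mathrm{affine}}\big(\frac1{\mathrm{vol}(P)}\int_P(f+\xi)\,dx-\inf_P(f+\xi)\big)$. $(X,-K_X)$ is uniformly relatively K-polystable if there exists $\delta>0$ such that $L_V(f)\ge\delta\|f\|_J$ for all $f\in\mathcal{C}_{PL}^{\mathbf{Q}}$.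 *)

theory Defs
  imports "HOL-Analysis.Analysis"
begin

section \<open>Toric Fano manifolds, encoded by the ray generators of their fans\<close>

definition vec_of_int :: "int ^ 'n \<Rightarrow> real ^ 'n" where
  "vec_of_int a = (\<chi> i. of_int (a $ i))"

definition primitive_vec :: "int ^ 'n \<Rightarrow> bool" where
  "primitive_vec a \<longleftrightarrow> (\<forall>k b. a = k *s b \<longrightarrow> \<bar>k\<bar> = 1)"

definition lattice_basis :: "(int ^ 'n) set \<Rightarrow> bool" where
  "lattice_basis B \<longleftrightarrow> finite B \<and>
     (\<forall>c. (\<Sum>b\<in>B. c b *s b) = 0 \<longrightarrow> (\<forall>b\<in>B. c b = 0)) \<and>
     (\<forall>z. \<exists>c. z = (\<Sum>b\<in>B. c b *s b))"

definition anticanonical_polytope :: "(int ^ 'n) set \<Rightarrow> (real ^ 'n) set" where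
  "anticanonical_polytope \<Lambda> = {x. \<forall>a\<in>\<Lambda>. vec_of_int a \<bullet> x + 1 \<ge> 0}"

definition facet_hyperplane :: "int ^ 'n \<Rightarrow> (real ^ 'n) set" where
  "facet_hyperplane a = {x. vec_of_int a \<bullet> x + 1 = 0}"

definition facet :: "(int ^ 'n) set \<Rightarrow> int ^ 'n \<Rightarrow> (real ^ 'n) set" where
  "facet \<Lambda> a = anticanonical_polytope \<Lambda> \<inter> facet_hyperplane a"

text \<open>
  A toric Fano manifold is given by the set \<open>\<Lambda>\<close> of primitive ray generators of its fan;
  the conditions say that the anticanonical polytope is an integral Delzant polytope
  whose facets are exactly the \<open>facet \<Lambda> a\<close>, \<open>a \<in> \<Lambda>\<close>. It contains the origin in its
  interior, so full dimension need not be required. The fan is recovered as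
  the inner normal fan of this polytope.
\<close>

definition toric_Fano :: "(int ^ 'n) set \<Rightarrow> bool" where
  "toric_Fano \<Lambda> \<longleftrightarrow> finite \<Lambda> \<and> (\<forall>a\<in>\<Lambda>. primitive_vec a) \<and>
     bounded (anticanonical_polytope \<Lambda>) \<and>
     (\<forall>a\<in>\<Lambda>. facet \<Lambda> a facet_of anticanonical_polytope \<Lambda>) \<and>
     (\<forall>v. v extreme_point_of anticanonical_polytope \<Lambda> \<longrightarrow>
        v \<in> range vec_of_int \<and> lattice_basis {a \<in> \<Lambda>. v \<in> facet \<Lambda> a})"

text \<open>
  Two toric Fano manifolds are isomorphic as varieties if and only if an element of
  \<open>GL\<^sub>n(\<int>)\<close> carries one fan to the other, i.e. one set of ray generators to the other.
  Over \<^typ>\<open>int\<close>, \<^const>\<open>invertible\<close> means having an inverse with integer entries.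
\<close>

definition toric_Fano_iso :: "((int ^ 'n) set \<times> (int ^ 'n) set) set" where
  "toric_Fano_iso = {(\<Lambda>, \<Lambda>'). toric_Fano \<Lambda> \<and> toric_Fano \<Lambda>' \<and>
     (\<exists>A :: int ^ 'n ^ 'n. invertible A \<and> (\<lambda>a. A *v a) ` \<Lambda> = \<Lambda>')}"

lemma equiv_toric_Fano_iso: "equiv {\<Lambda>. toric_Fano \<Lambda>} toric_Fano_iso"
proof (rule equivI)
  show "toric_Fano_iso \<subseteq> {\<Lambda>. toric_Fano \<Lambda>} \<times> {\<Lambda>. toric_Fano \<Lambda>}"
    by (auto simp: toric_Fano_iso_def)
  show "refl_on {\<Lambda>. toric_Fano \<Lambda>} toric_Fano_iso"
    unfolding refl_on_def toric_Fano_iso_def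
    by (auto intro!: exI[of _ "mat 1"] simp: invertible_def)
  show "sym toric_Fano_iso"
  proof (rule symI)
    fix L M :: "(int ^ 'n) set"
    assume "(L, M) \<in> toric_Fano_iso"
    then obtain A B :: "int ^ 'n ^ 'n" where *: "toric_Fano L" "toric_Fano M"
      "A ** B = mat 1" "B ** A = mat 1" "M = (\<lambda>a. A *v a) ` L"
      by (auto simp: toric_Fano_iso_def invertible_def)
    have "(\<lambda>a. B *v a) ` M = L"
      unfolding *(5) image_image by (simp add: matrix_vector_mul_assoc *(4))
    with * show "(M, L) \<in> toric_Fano_iso"
      unfolding toric_Fano_iso_def invertible_def by blast
  qed
  show "trans toric_Fano_iso"
  proof (rule transI)
    fix L M N :: "(int ^ 'n) set"
    assume "(L, M) \<in> toric_Fano_iso" "(M, N) \<in> toric_Fano_iso"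
    then obtain A B :: "int ^ 'n ^ 'n" where *: "toric_Fano L" "toric_Fano N"
      "invertible A" "invertible B" "M = (\<lambda>a. A *v a) ` L" "N = (\<lambda>a. B *v a) ` M"
      by (auto simp: toric_Fano_iso_def)
    have "(\<lambda>a. (B ** A) *v a) ` L = N"
      unfolding * image_image by (simp add: matrix_vector_mul_assoc)
    with * show "(L, N) \<in> toric_Fano_iso"
      unfolding toric_Fano_iso_def using invertible_mult by blast
  qed
qed


section \<open>The boundary measure\<close>

text \<open>
  Lebesgue measure of the appropriate dimension on an affine subspace, transported from
  orthonormal coordinates in the same way as \<^const>\<open>lborel\<close> is built from
  \<^const>\<open>Basis\<close>. It depends neither on the base point nor on the orthonormal basis.
\<close>

definition affine_lborel :: "'a::euclidean_space set \<Rightarrow> 'a measure" where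
  "affine_lborel S = (SOME M. \<exists>p B. p \<in> S \<and>
     pairwise orthogonal B \<and> (\<forall>b\<in>B. norm b = 1) \<and> span B = (\<lambda>x. x - p) ` S \<and>
     M = distr (\<Pi>\<^sub>M b\<in>B. lborel) borel (\<lambda>c. p + (\<Sum>b\<in>B. c b *\<^sub>R b)))"

definition boundary_measure :: "(int ^ 'n) set \<Rightarrow> (real ^ 'n) measure" where
  "boundary_measure \<Lambda> = measure_of UNIV (sets borel)
     (\<lambda>A. \<Sum>a\<in>\<Lambda>. ennreal (1 / norm (vec_of_int a)) *
        emeasure (affine_lborel (facet_hyperplane a)) (A \<inter> facet \<Lambda> a))"


section \<open>Uniform relative K-polystability\<close>

definition affine_function :: "('a::euclidean_space \<Rightarrow> real) \<Rightarrow> bool" where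
  "affine_function l \<longleftrightarrow> (\<exists>a c. l = (\<lambda>x. a \<bullet> x + c))"

definition rational_affine_function :: "(real ^ 'n \<Rightarrow> real) \<Rightarrow> bool" where
  "rational_affine_function l \<longleftrightarrow>
     (\<exists>a c. (\<forall>i. a $ i \<in> \<rat>) \<and> c \<in> \<rat> \<and> l = (\<lambda>x. a \<bullet> x + c))"

definition rational_PL_convex :: "(real ^ 'n \<Rightarrow> real) set" where
  "rational_PL_convex = {f. \<exists>S. finite S \<and> S \<noteq> {} \<and> (\<forall>l\<in>S. rational_affine_function l) \<and>
     f = (\<lambda>x. Max ((\<lambda>l. l x) ` S))}"

definition boundary_integral :: "(int ^ 'n) set \<Rightarrow> (real ^ 'n \<Rightarrow> real) \<Rightarrow> real" where
  "boundary_integral \<Lambda> f =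
     (LINT x:frontier (anticanonical_polytope \<Lambda>)|boundary_measure \<Lambda>. f x)"

definition interior_integral :: "(int ^ 'n) set \<Rightarrow> (real ^ 'n \<Rightarrow> real) \<Rightarrow> real" where
  "interior_integral \<Lambda> f = (LINT x:anticanonical_polytope \<Lambda>|lborel. f x)"

definition volume :: "(int ^ 'n) set \<Rightarrow> real" where
  "volume \<Lambda> = measure lborel (anticanonical_polytope \<Lambda>)"

definition mean_scalar :: "(int ^ 'n) set \<Rightarrow> real" where
  "mean_scalar \<Lambda> =
     measure (boundary_measure \<Lambda>) (frontier (anticanonical_polytope \<Lambda>)) / volume \<Lambda>"

definition extremal_function :: "(int ^ 'n) set \<Rightarrow> real ^ 'n \<Rightarrow> real" where
  "extremal_function \<Lambda> = (THE V. affine_function V \<and>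
     (\<forall>l. affine_function l \<longrightarrow>
        boundary_integral \<Lambda> l = interior_integral \<Lambda> (\<lambda>x. (mean_scalar \<Lambda> + V x) * l x)))"

definition rel_functional :: "(int ^ 'n) set \<Rightarrow> (real ^ 'n \<Rightarrow> real) \<Rightarrow> real" where
  "rel_functional \<Lambda> f = boundary_integral \<Lambda> f -
     interior_integral \<Lambda> (\<lambda>x. (mean_scalar \<Lambda> + extremal_function \<Lambda> x) * f x)"

definition J_norm :: "(int ^ 'n) set \<Rightarrow> (real ^ 'n \<Rightarrow> real) \<Rightarrow> real" where
  "J_norm \<Lambda> f = (INF \<xi>\<in>Collect affine_function.
     1 / volume \<Lambda> * interior_integral \<Lambda> (\<lambda>x. f x + \<xi> x)
       - (INF x\<in>anticanonical_polytope \<Lambda>. f x + \<xi> x))"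

definition uniformly_rel_K_polystable :: "(int ^ 'n) set \<Rightarrow> bool" where
  "uniformly_rel_K_polystable \<Lambda> \<longleftrightarrow>
     (\<exists>\<delta>>0. \<forall>f\<in>rational_PL_convex. rel_functional \<Lambda> f \<ge> \<delta> * J_norm \<Lambda> f)"

end

theory Submission
  imports Defs
begin

text \<open>
  Criterion: decomposing \<open>P\<close> into cones over its facets gives
  \<open>\<integral>\<^sub>P g dx = \<integral>\<^sub>\<partial>\<^sub>P (\<integral>\<^sub>0\<^sup>1 t\<^sup>n\<^sup>-\<^sup>1 g(t x) dt) d\<sigma>\<close>. Hence the mean of the scalar curvature is \<open>n\<close>, and
  \<open>V\<close> is determined by \<open>\<integral>\<^sub>P V l = \<integral>\<^sub>P (l - l(0))\<close> for affine \<open>l\<close>. As \<open>L_V\<close> vanishes on affine functions, a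
  convex \<open>f\<close> may be assumed to satisfy \<open>f \<ge> f(0) = 0\<close>, so that \<open>f(t x) \<le> t f(x)\<close>. If \<open>U = n + V\<close> is
  nonnegative on \<open>P\<close>, the cone formula yields
  \<open>\<integral>\<^sub>P U f dx \<le> \<integral>\<^sub>\<partial>\<^sub>P f(x) (U(0) + (n + 1) U(x)) / ((n + 1) (n + 2)) d\<sigma>\<close>, and uniform stability follows as
  soon as \<open>U(0) + (n + 1) U < (n + 1) (n + 2)\<close> on \<open>P\<close>. All five surfaces and thirteen of the threefolds satisfy
  these two inequalities.

  Classification: the sum of the ray generators lies in the cone of some vertex of \<open>P\<close>. In coordinates in
  which the generators of this cone are the unit vectors, the remaining generators lie on finitely many
  levels and are bounded, because neighbouring vertices of \<open>P\<close> are lattice points too. The finitely many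
  candidates are sieved by computing vertices close to the special one and matched to eighteen models,
  which are told apart by linear invariants of their sets of generators.
\<close>

section \<open>The boundary measure in polar coordinates\<close>

text \<open>The anticanonical polarization puts every facet at lattice distance one from the origin:
  the hyperplane of a generator \<lambda> has Euclidean distance 1/|\<lambda>|, which is exactly the
  density of \<sigma> on that facet. For this reason polar coordinates need no facet-dependent
  factor, and the criterion involves only moments of P of order at most two. The constant (n + 1)(n
  + 2) is the common denominator of \<integral> t^n (U(0) + t (U(x) - U(0))) dt over [0, 1]; the
  Jacobian contributes t^(n-1) and convexity one more t. The second inequality keeps this weight
  below the weight 1 of \<integral> f d\<sigma>, and the slack controls \<integral> f dx, hence the
  J-norm. Smoothness enters through the classification alone: moving along an edge of P exchanges
  one element of a lattice basis, so the new generator pairs to -1 with the edge direction, and all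
  vertices stay integral. The finite searches and the exact integrals are evaluated by rewriting,
  which is why lattice vectors become integer tuples and polynomials integer coefficient lists
  there.\<close>

lemma distr_lborel_linear:
  fixes f :: "real^'n::{finite,wellorder} \<Rightarrow> real^'n::_"
  assumes f: "linear f" and det: "\<bar>det (matrix f)\<bar> = 1"
  shows "distr lborel borel f = lborel"
proof (rule lborel_eqI[symmetric])
  have "det (matrix f) \<noteq> 0" using det by auto
  then have "inj f" using f det_nz_iff_inj by blast
  then obtain g where g: "linear g" "\<And>x. g (f x) = x" "\<And>x. f (g x) = x"
    using linear_injective_isomorphism[OF f] by blast
  have "matrix f ** matrix g = mat 1"
    using matrix_compose[OF g(1) f] g(3) by (simp add: o_def matrix_id_mat_1[symmetric] id_def)
  then have "\<bar>det (matrix g)\<bar> = 1"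
    using det det_mul[of "matrix f" "matrix g"] by (metis abs_1 abs_mult det_I mult_1)
  have fm [measurable]: "f \<in> borel_measurable borel"
    using f by (intro borel_measurable_continuous_onI linear_continuous_on linear_conv_bounded_linear[THEN iffD1])
  show "sets (distr lborel borel f) = sets borel" by simp
  fix l u :: "real^'n::_" assume le: "\<And>b. b \<in> Basis \<Longrightarrow> l \<bullet> b \<le> u \<bullet> b"
  have eq: "f -` box l u = g ` box l u"
  proof (intro set_eqI iffI)
    fix x assume "x \<in> f -` box l u"
    then show "x \<in> g ` box l u" using g(2)[of x] by (metis imageI vimageD)
  next
    fix x assume "x \<in> g ` box l u"
    then show "x \<in> f -` box l u" using g(3) by auto
  qed
  have lm: "box l u \<in> lmeasurable" by simp
  have gm: "g ` box l u \<in> lmeasurable" using measurable_linear_image[OF g(1) lm] .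
  have "emeasure (distr lborel borel f) (box l u) = emeasure lborel (g ` box l u)"
    by (simp add: emeasure_distr eq)
  also have "\<dots> = emeasure lebesgue (g ` box l u)"
    using measurable_sets_borel[OF fm, of "box l u"] eq by (simp add: emeasure_completion)
  also have "\<dots> = ennreal (measure lebesgue (g ` box l u))"
    using gm by (simp add: emeasure_eq_measure2 fmeasurableD2)
  also have "measure lebesgue (g ` box l u) = measure lebesgue (box l u)"
    using measure_linear_image[OF g(1) lm] \<open>\<bar>det (matrix g)\<bar> = 1\<close> by simp
  also have "ennreal \<dots> = (\<Prod>b\<in>Basis. (u - l) \<bullet> b)"
    using le by (simp add: measure_completion measure_lborel_box_eq)
  finally show "emeasure (distr lborel borel f) (box l u) = (\<Prod>b\<in>Basis. (u - l) \<bullet> b)" .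
qed

text \<open>Frames are indexed by their own vectors, so passing from \<open>Basis\<close> to another
  orthonormal frame changes the index set of the product measure.\<close>

lemma PiM_lborel_reindex:
  assumes f: "bij_betw \<pi> J I" and [simp]: "finite I"
  shows "distr (Pi\<^sub>M I (\<lambda>_. lborel :: real measure)) (Pi\<^sub>M J (\<lambda>_. lborel)) (\<lambda>\<omega>. \<lambda>j\<in>J. \<omega> (\<pi> j)) = Pi\<^sub>M J (\<lambda>_. lborel)"
proof -
  interpret product_sigma_finite "\<lambda>_. lborel :: real measure" by standard
  have [simp]: "finite J" using f bij_betw_finite by fastforce
  have pJ: "\<pi> j \<in> I" if "j \<in> J" for j using that f bij_betwE by blast
  let ?t = "\<lambda>\<omega> :: _ \<Rightarrow> real. \<lambda>j\<in>J. \<omega> (\<pi> j)"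
  have m [measurable]: "?t \<in> measurable (Pi\<^sub>M I (\<lambda>_. lborel)) (Pi\<^sub>M J (\<lambda>_. lborel))"
    using pJ by (intro measurable_restrict) simp
  show ?thesis
  proof (rule PiM_eqI)
    fix A :: "_ \<Rightarrow> real set" assume A: "\<And>i. i \<in> J \<Longrightarrow> A i \<in> sets lborel"
    let ?q = "the_inv_into J \<pi>"
    have q: "?q i \<in> J" "\<pi> (?q i) = i" if "i \<in> I" for i
      using f that by (auto simp: bij_betw_def the_inv_into_into f_the_inv_into_f)
    have q2: "?q (\<pi> j) = j" if "j \<in> J" for j
      using f that by (auto simp: bij_betw_def the_inv_into_f_f)
    have eq: "?t -` Pi\<^sub>E J A \<inter> space (Pi\<^sub>M I (\<lambda>_. lborel)) = Pi\<^sub>E I (\<lambda>i. A (?q i))"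
      (is "?L = ?R")
    proof (intro set_eqI iffI)
      fix x assume "x \<in> ?L"
      then show "x \<in> ?R" using q by (force simp: space_PiM PiE_iff)
    next
      fix x assume x: "x \<in> ?R"
      then have "x (\<pi> j) \<in> A j" if "j \<in> J" for j using q2[OF that] pJ[OF that] by (force simp: PiE_iff)
      with x show "x \<in> ?L" by (auto simp: space_PiM PiE_iff)
    qed
    have "emeasure (distr (Pi\<^sub>M I (\<lambda>_. lborel)) (Pi\<^sub>M J (\<lambda>_. lborel)) ?t) (Pi\<^sub>E J A) = emeasure (Pi\<^sub>M I (\<lambda>_. lborel)) (Pi\<^sub>E I (\<lambda>i. A (?q i)))"
      using A by (subst emeasure_distr) (auto simp: eq intro!: sets_PiM_I_finite)
    also have "\<dots> = (\<Prod>i\<in>I. emeasure lborel (A (?q i)))"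
      using A q by (subst emeasure_PiM) auto
    also have "\<dots> = (\<Prod>j\<in>J. emeasure lborel (A j))"
      using f q q2 pJ by (intro prod.reindex_bij_witness[of _ \<pi> ?q]) auto
    finally show "emeasure (distr (Pi\<^sub>M I (\<lambda>_. lborel)) (Pi\<^sub>M J (\<lambda>_. lborel)) ?t) (Pi\<^sub>E J A) = (\<Prod>j\<in>J. emeasure lborel (A j))" .
  qed simp_all
qed

text \<open>The linear map taking the standard frame to \<open>B\<close> is orthogonal, so its
  determinant is 1 or -1 and it preserves Lebesgue measure. This permits coordinates adapted to a
  facet hyperplane.\<close>

lemma lborel_orthonormal:
  fixes B :: "(real^'n::{finite,wellorder}) set"
  assumes B: "pairwise orthogonal B" "\<And>b. b \<in> B \<Longrightarrow> norm b = 1" "span B = UNIV"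
  shows "lborel = distr (\<Pi>\<^sub>M b\<in>B. lborel) borel (\<lambda>c. \<Sum>b\<in>B. c b *\<^sub>R b)"
proof -
  have ind: "independent B" using B(1) B(2)[of 0] by (intro pairwise_orthogonal_independent) auto
  then have fin [simp]: "finite B" by (rule independent_bound_general[THEN conjunct1])
  have "card B = card (Basis :: (real^'n::_) set)"
    using ind B(3) by (metis dim_eq_card_independent dim_span_eq_card_independent dim_UNIV DIM_cart)
  then obtain \<pi> where p: "bij_betw \<pi> (Basis :: (real^'n::_) set) B"
    using finite_same_card_bij[OF finite_Basis fin] by metis
  have pB: "\<pi> b \<in> B" if "b \<in> Basis" for b using p that bij_betwE by blast
  obtain T where T: "linear T" "\<And>b. b \<in> Basis \<Longrightarrow> T b = \<pi> b"
    using linear_independent_extend[OF independent_Basis, of \<pi>] by metis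
  have Teq: "T x = (\<Sum>b\<in>Basis. (x \<bullet> b) *\<^sub>R \<pi> b)" for x
  proof -
    have "T x = T (\<Sum>b\<in>Basis. (x \<bullet> b) *\<^sub>R b)" by (simp add: euclidean_representation)
    also have "\<dots> = (\<Sum>b\<in>Basis. (x \<bullet> b) *\<^sub>R T b)"
      using T(1) by (simp add: linear_sum linear_cmul)
    finally show ?thesis by (simp add: T)
  qed
  have orth: "\<pi> a \<bullet> \<pi> b = (if a = b then 1 else 0)" if "a \<in> Basis" "b \<in> Basis" for a b
  proof (cases "a = b")
    case False
    then have "\<pi> a \<noteq> \<pi> b" using that p by (auto simp: bij_betw_def inj_on_def)
    then show ?thesis using False B(1) pB that by (auto simp: pairwise_def orthogonal_def)
  qed (use that pB B(2) in \<open>auto simp: dot_square_norm\<close>)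
  have "T x \<bullet> T y = x \<bullet> y" for x y
  proof -
    have "T x \<bullet> T y = (\<Sum>a\<in>Basis. (x \<bullet> a) * (\<Sum>b\<in>Basis. (y \<bullet> b) * (\<pi> a \<bullet> \<pi> b)))"
      unfolding Teq[of x] inner_sum_left inner_scaleR_left unfolding Teq inner_sum_right inner_scaleR_right by (rule refl)
    also have "\<dots> = (\<Sum>a\<in>Basis. (x \<bullet> a) * (\<Sum>b\<in>Basis. if a = b then y \<bullet> b else 0))"
      by (intro sum.cong arg_cong2[of _ _ _ _ "(*)"] refl) (auto simp: orth)
    also have "\<dots> = x \<bullet> y"
      by (simp add: euclidean_inner[of x y])
    finally show ?thesis .
  qed
  then have "orthogonal_transformation T"
    by (simp add: orthogonal_transformation_def T(1))
  then have "\<bar>det (matrix T)\<bar> = 1" by simp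
  then have "lborel = distr lborel borel T"
    using distr_lborel_linear[OF T(1)] by simp
  also have "\<dots> = distr (distr (\<Pi>\<^sub>M b\<in>Basis. lborel) borel (\<lambda>f. \<Sum>b\<in>Basis. f b *\<^sub>R b)) borel T"
    by (subst lborel_eq) (rule refl)
  also have "\<dots> = distr (\<Pi>\<^sub>M b\<in>(Basis::(real^'n::_) set). lborel) borel (T \<circ> (\<lambda>f. \<Sum>b\<in>Basis. f b *\<^sub>R b))"
    using T(1) by (intro distr_distr borel_measurable_continuous_onI linear_continuous_on linear_conv_bounded_linear[THEN iffD1]) measurable
  also have "\<dots> = distr (\<Pi>\<^sub>M b\<in>(Basis::(real^'n::_) set). lborel) borel (\<lambda>f. \<Sum>b\<in>Basis. f b *\<^sub>R \<pi> b)"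
    using T by (simp add: o_def linear_sum linear_cmul)
  also have "(\<Pi>\<^sub>M b\<in>(Basis::(real^'n::_) set). lborel) = distr (\<Pi>\<^sub>M b\<in>B. lborel :: real measure) (\<Pi>\<^sub>M b\<in>(Basis::(real^'n::_) set). lborel) (\<lambda>\<omega>. \<lambda>j\<in>Basis. \<omega> (\<pi> j))"
    using PiM_lborel_reindex[OF p fin] by simp
  also have "distr \<dots> borel (\<lambda>f. \<Sum>b\<in>Basis. f b *\<^sub>R \<pi> b) = distr (\<Pi>\<^sub>M b\<in>B. lborel :: real measure) borel ((\<lambda>f. \<Sum>b\<in>Basis. f b *\<^sub>R \<pi> b) \<circ> (\<lambda>\<omega>. \<lambda>j\<in>Basis. \<omega> (\<pi> j)))"
    using pB by (intro distr_distr measurable_restrict) measurable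
  also have "(\<lambda>f. \<Sum>b\<in>Basis. f b *\<^sub>R \<pi> b) \<circ> (\<lambda>\<omega> :: (real^'n::_) \<Rightarrow> real. \<lambda>j\<in>Basis. \<omega> (\<pi> j)) = (\<lambda>c. \<Sum>b\<in>B. c b *\<^sub>R b)"
    by (rule ext) (simp add: o_def sum.reindex_bij_betw[OF p, symmetric])
  finally show ?thesis .
qed

text \<open>Each coordinate is substituted separately and contributes one factor |u|. With
  \<open>u\<close> the radial variable this produces the Jacobian of polar coordinates.\<close>

lemma nn_integral_PiM_lborel_affine:
  fixes t :: "'i \<Rightarrow> real" and u :: real
  assumes "finite B" "u \<noteq> 0" "f \<in> borel_measurable (\<Pi>\<^sub>M b\<in>B. lborel)"
  shows "(\<integral>\<^sup>+c. f c \<partial>(\<Pi>\<^sub>M b\<in>B. lborel)) = ennreal (\<bar>u\<bar> ^ card B) * (\<integral>\<^sup>+c. f (\<lambda>b\<in>B. t b + u * c b) \<partial>(\<Pi>\<^sub>M b\<in>B. lborel))"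
  using assms(1,3)
proof (induction B arbitrary: f rule: finite_induct)
  case empty
  interpret product_sigma_finite "\<lambda>_. lborel :: real measure" by standard
  show ?case by (simp add: PiM_empty nn_integral_count_space_finite)
next
  case (insert i B)
  interpret product_sigma_finite "\<lambda>_. lborel :: real measure" by standard
  note [simp] = insert.hyps
  note [measurable] = insert.prems
  have "(\<lambda>p. \<lambda>b\<in>insert i B. if b = i then fst p else t b + u * snd p b)
      \<in> measurable (lborel \<Otimes>\<^sub>M (\<Pi>\<^sub>M b\<in>B. lborel)) (\<Pi>\<^sub>M b\<in>insert i B. lborel)"
    by (intro measurable_restrict) (auto intro: measurable_compose[OF measurable_snd] measurable_component_singleton)
  also have "(\<lambda>p. \<lambda>b\<in>insert i B. if b = i then fst p else t b + u * snd p b) = (\<lambda>(y :: real, c). (\<lambda>b\<in>B. t b + u * c b)(i := y))"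
    by (auto simp: fun_eq_iff)
  finally have "(\<lambda>(y, c). f ((\<lambda>b\<in>B. t b + u * c b)(i := y))) \<in> borel_measurable (lborel \<Otimes>\<^sub>M (\<Pi>\<^sub>M b\<in>B. lborel))"
    by (auto simp: case_prod_unfold intro: measurable_compose[OF _ insert.prems])
  then have [measurable]: "(\<lambda>y. \<integral>\<^sup>+c. f ((\<lambda>b\<in>B. t b + u * c b)(i := y)) \<partial>(\<Pi>\<^sub>M b\<in>B. lborel)) \<in> borel_measurable lborel"
    by (intro sigma_finite_measure.borel_measurable_nn_integral sigma_finite) auto
  have "(\<integral>\<^sup>+c. f c \<partial>(\<Pi>\<^sub>M b\<in>insert i B. lborel)) = (\<integral>\<^sup>+y. (\<integral>\<^sup>+c. f (c(i := y)) \<partial>(\<Pi>\<^sub>M b\<in>B. lborel)) \<partial>lborel)"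
    by (rule product_nn_integral_insert_rev) simp_all
  also have "\<dots> = (\<integral>\<^sup>+y. ennreal (\<bar>u\<bar> ^ card B) * (\<integral>\<^sup>+c. f ((\<lambda>b\<in>B. t b + u * c b)(i := y)) \<partial>(\<Pi>\<^sub>M b\<in>B. lborel)) \<partial>lborel)"
    by (intro nn_integral_cong insert.IH) measurable
  also have "\<dots> = ennreal (\<bar>u\<bar> ^ card B) * (\<integral>\<^sup>+y. (\<integral>\<^sup>+c. f ((\<lambda>b\<in>B. t b + u * c b)(i := y)) \<partial>(\<Pi>\<^sub>M b\<in>B. lborel)) \<partial>lborel)"
    by (intro nn_integral_cmult) measurable
  also have "(\<integral>\<^sup>+y. (\<integral>\<^sup>+c. f ((\<lambda>b\<in>B. t b + u * c b)(i := y)) \<partial>(\<Pi>\<^sub>M b\<in>B. lborel)) \<partial>lborel)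
     = \<bar>u\<bar> * (\<integral>\<^sup>+y. (\<integral>\<^sup>+c. f ((\<lambda>b\<in>B. t b + u * c b)(i := t i + u * y)) \<partial>(\<Pi>\<^sub>M b\<in>B. lborel)) \<partial>lborel)"
    using assms(2) by (intro nn_integral_real_affine) measurable
  also have "(\<lambda>y. (\<integral>\<^sup>+c. f ((\<lambda>b\<in>B. t b + u * c b)(i := t i + u * y)) \<partial>(\<Pi>\<^sub>M b\<in>B. lborel)))
     = (\<lambda>y. (\<integral>\<^sup>+c. f (\<lambda>b\<in>insert i B. t b + u * (c(i := y)) b) \<partial>(\<Pi>\<^sub>M b\<in>B. lborel)))"
    by (intro ext nn_integral_cong arg_cong[of _ _ f]) (auto simp: fun_eq_iff)
  also have "(\<integral>\<^sup>+y. \<dots> y \<partial>lborel) = (\<integral>\<^sup>+c. f (\<lambda>b\<in>insert i B. t b + u * c b) \<partial>(\<Pi>\<^sub>M b\<in>insert i B. lborel))"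
    by (intro product_nn_integral_insert_rev[symmetric]) measurable
  finally show ?case
    unfolding card_insert_disjoint[OF insert.hyps] power_Suc
    by (simp only: ennreal_mult abs_ge_zero zero_le_power mult_ac)
qed

text \<open>A point of the half-space is u z with u > 0 and z on the hyperplane. In the frame
  \<open>B\<close> completed by the unit normal, the normal coordinate is u / |a|, which yields the
  factor 1 / |a|, and the n - 1 tangential coordinates scale with u. Base point and frame are
  arbitrary because the choice made inside \<open>affine_lborel\<close> is unknown.\<close>

lemma nn_integral_halfspace_cone:
  fixes a p :: "real^'n::{finite,wellorder}" and g :: "real^'n::_ \<Rightarrow> ennreal"
  assumes "a \<noteq> 0" and p: "a \<bullet> p = -1"
    and B: "pairwise orthogonal B" "\<And>b. b \<in> B \<Longrightarrow> norm b = 1" "span B = (\<lambda>x. x - p) ` {z. a \<bullet> z + 1 = 0}"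
    and g [measurable]: "g \<in> borel_measurable borel"
  shows "(\<integral>\<^sup>+x. g x * indicator {x. a \<bullet> x < 0} x \<partial>lborel) = ennreal (1 / norm a) *
    (\<integral>\<^sup>+z. (\<integral>\<^sup>+u. ennreal (u ^ (CARD('n) - 1)) * g (u *\<^sub>R z) * indicator {0<..} u \<partial>lborel)
      \<partial>distr (\<Pi>\<^sub>M b\<in>B. lborel) borel (\<lambda>c. p + (\<Sum>b\<in>B. c b *\<^sub>R b)))"
proof -
  interpret product_sigma_finite "\<lambda>_. lborel :: real measure" by standard
  \<comment> \<open>The unit normal pointing from the origin towards the hyperplane.\<close>
  define e where "e = - a /\<^sub>R norm a"
  have spB: "span B = {y. a \<bullet> y = 0}"
  proof -
    have "y \<in> (\<lambda>x. x - p) ` {z. a \<bullet> z + 1 = 0}" if "a \<bullet> y = 0" for y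
      using that p by (intro image_eqI[of _ _ "y + p"]) (auto simp: inner_add_right)
    then show ?thesis using B(3) p by (auto simp: inner_diff_right)
  qed
  have na: "norm a > 0" using \<open>a \<noteq> 0\<close> by simp
  have ae: "a \<bullet> e = - norm a" using na by (simp add: e_def dot_square_norm power2_eq_square)
  have ne: "norm e = 1" using na by (simp add: e_def)
  have ea: "e \<bullet> x = - (a \<bullet> x) / norm a" for x by (simp add: e_def divide_inverse mult.commute)
  have Ba: "a \<bullet> b = 0" if "b \<in> B" for b using spB span_base[OF that] by auto
  have eB: "e \<notin> B" using Ba ae na by force
  have o: "pairwise orthogonal (insert e B)"
    using B(1) Ba by (auto simp: pairwise_insert orthogonal_def ea inner_commute[of _ e])
  have sp: "span (insert e B) = UNIV"
  proof -
    have "x \<in> span (insert e B)" for x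
    proof -
      have "a \<bullet> (x - (x \<bullet> e) *\<^sub>R e) = 0"
        using na by (simp add: inner_diff_right inner_add_right ae ea inner_commute[of x e])
      then have "x - (x \<bullet> e) *\<^sub>R e \<in> span B" using spB by auto
      then show ?thesis unfolding span_insert by blast
    qed
    then show ?thesis by auto
  qed
  have n1: "norm b = 1" if "b \<in> insert e B" for b using that B(2) ne by auto
  have ind: "independent (insert e B)" using o n1 n1[of 0] by (intro pairwise_orthogonal_independent) auto
  then have "finite (insert e B)" by (rule independent_bound_general[THEN conjunct1])
  then have fin [simp]: "finite B" by simp
  have "card (insert e B) = CARD('n)"
    using ind sp by (metis dim_eq_card_independent dim_span_eq_card_independent dim_UNIV DIM_cart DIM_real mult_1_right)
  then have cB: "card B = CARD('n) - 1" using eB by simp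
  define Y where "Y c = (\<Sum>b\<in>B. c b *\<^sub>R b)" for c :: "real^'n::_ \<Rightarrow> real"
  have Ym [measurable]: "Y \<in> borel_measurable (\<Pi>\<^sub>M b\<in>B. lborel)" unfolding Y_def by measurable
  define c0 where "c0 b = p \<bullet> b" for b
  \<comment> \<open>The hyperplane has height 1 / |a| over the origin; \<open>c0\<close> holds the
    tangential coordinates of \<open>p\<close>.\<close>
  have pe: "p = (1 / norm a) *\<^sub>R e + Y c0"
  proof -
    have "p \<bullet> e = 1 / norm a" using p by (simp add: ea inner_commute[of p e])
    moreover have "p = (\<Sum>b\<in>insert e B. (p \<bullet> b) *\<^sub>R b)"
    proof -
      have "p \<in> span (insert e B)" using sp by simp
      then obtain k where k: "p = (\<Sum>b\<in>insert e B. k b *\<^sub>R b)" using span_finite[OF \<open>finite (insert e B)\<close>] by auto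
      have "p \<bullet> b = k b" if "b \<in> insert e B" for b
      proof -
        have "p \<bullet> b = (\<Sum>b'\<in>insert e B. k b' * (b' \<bullet> b))" by (subst k) (simp only: inner_sum_left inner_scaleR_left)
        also have "\<dots> = (\<Sum>b'\<in>insert e B. if b = b' then k b else 0)"
          using o n1 that by (intro sum.cong) (auto simp: pairwise_def orthogonal_def dot_square_norm)
        also have "\<dots> = k b" using that \<open>finite (insert e B)\<close> by (simp only: sum.delta' if_True)
        finally show ?thesis .
      qed
      then show ?thesis by (subst k) (intro sum.cong, simp_all)
    qed
    ultimately show ?thesis using eB by (simp add: Y_def c0_def)
  qed
  define G where "G x = g x * indicator {x. a \<bullet> x < 0} x" for x
  have [measurable]: "G \<in> borel_measurable borel" unfolding G_def by measurable
  have aY: "a \<bullet> Y c = 0" for c unfolding Y_def by (simp add: inner_sum_right Ba)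
  have Gu: "G (u *\<^sub>R (p + Y c)) = g (u *\<^sub>R (p + Y c)) * indicator {0<..} u" for u c
    by (simp add: G_def inner_add_right aY p indicator_def)
  have Yi: "(\<Sum>b\<in>insert e B. (c(e := y)) b *\<^sub>R b) = y *\<^sub>R e + Y c" for c y
    using eB by (auto simp: Y_def intro!: sum.cong)
  have "(\<integral>\<^sup>+x. G x \<partial>lborel) = (\<integral>\<^sup>+c. G (\<Sum>b\<in>insert e B. c b *\<^sub>R b) \<partial>(\<Pi>\<^sub>M b\<in>insert e B. lborel))"
    by (subst lborel_orthonormal[OF o n1 sp]) (simp_all add: nn_integral_distr del: sum.insert)
  also have "\<dots> = (\<integral>\<^sup>+y. (\<integral>\<^sup>+c. G (y *\<^sub>R e + Y c) \<partial>(\<Pi>\<^sub>M b\<in>B. lborel)) \<partial>lborel)"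
    unfolding Yi[symmetric] using eB by (intro product_nn_integral_insert_rev) (simp_all del: sum.insert)
  \<comment> \<open>The normal coordinate is replaced by u / |a|.\<close>
  also have "\<dots> = \<bar>1 / norm a\<bar> * (\<integral>\<^sup>+u. (\<integral>\<^sup>+c. G ((0 + 1 / norm a * u) *\<^sub>R e + Y c) \<partial>(\<Pi>\<^sub>M b\<in>B. lborel)) \<partial>lborel)"
    using na by (intro nn_integral_real_affine) (auto intro!: sigma_finite_measure.borel_measurable_nn_integral sigma_finite)
  also have "(\<integral>\<^sup>+u. (\<integral>\<^sup>+c. G ((0 + 1 / norm a * u) *\<^sub>R e + Y c) \<partial>(\<Pi>\<^sub>M b\<in>B. lborel)) \<partial>lborel)
     = (\<integral>\<^sup>+u. (\<integral>\<^sup>+c. ennreal (u ^ (CARD('n) - 1)) * G (u *\<^sub>R (p + Y c)) \<partial>(\<Pi>\<^sub>M b\<in>B. lborel)) \<partial>lborel)"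
  proof (rule nn_integral_cong)
    fix u :: real
    show "(\<integral>\<^sup>+c. G ((0 + 1 / norm a * u) *\<^sub>R e + Y c) \<partial>(\<Pi>\<^sub>M b\<in>B. lborel))
       = (\<integral>\<^sup>+c. ennreal (u ^ (CARD('n) - 1)) * G (u *\<^sub>R (p + Y c)) \<partial>(\<Pi>\<^sub>M b\<in>B. lborel))"
    proof (cases "u > 0")
      case True
      \<comment> \<open>For fixed u the tangential coordinates are replaced by u (c0 + c), so that
        the point becomes u times a point of the hyperplane.\<close>
      have *: "(0 + 1 / norm a * u) *\<^sub>R e + Y (\<lambda>b\<in>B. u * c0 b + u * c b) = u *\<^sub>R (p + Y c)" for c
        by (simp add: pe Y_def scaleR_add_right scaleR_add_left scaleR_sum_right sum.distrib mult.commute)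
      have "(\<integral>\<^sup>+c. G ((0 + 1 / norm a * u) *\<^sub>R e + Y c) \<partial>(\<Pi>\<^sub>M b\<in>B. lborel)) = ennreal (\<bar>u\<bar> ^ card B) *
        (\<integral>\<^sup>+c. G ((0 + 1 / norm a * u) *\<^sub>R e + Y (\<lambda>b\<in>B. u * c0 b + u * c b)) \<partial>(\<Pi>\<^sub>M b\<in>B. lborel))"
        using True by (intro nn_integral_PiM_lborel_affine) auto
      also have "\<dots> = (\<integral>\<^sup>+c. ennreal (u ^ (CARD('n) - 1)) * G (u *\<^sub>R (p + Y c)) \<partial>(\<Pi>\<^sub>M b\<in>B. lborel))"
        unfolding * using True by (subst nn_integral_cmult) (auto simp: cB)
      finally show ?thesis .
    next
      case False
      then have "G ((0 + 1 / norm a * u) *\<^sub>R e + Y c) = 0" for c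
        using na by (simp add: G_def inner_add_right aY ae)
      with False show ?thesis unfolding Gu by simp
    qed
  qed
  also have "\<dots> = (\<integral>\<^sup>+c. (\<integral>\<^sup>+u. ennreal (u ^ (CARD('n) - 1)) * G (u *\<^sub>R (p + Y c)) \<partial>lborel) \<partial>(\<Pi>\<^sub>M b\<in>B. lborel))"
    by (rule pair_sigma_finite.Fubini'[symmetric]) (auto intro!: pair_sigma_finite.intro sigma_finite lborel.sigma_finite_measure_axioms)
  also have "\<dots> = (\<integral>\<^sup>+c. (\<integral>\<^sup>+u. ennreal (u ^ (CARD('n) - 1)) * g (u *\<^sub>R (p + Y c)) * indicator {0<..} u \<partial>lborel) \<partial>(\<Pi>\<^sub>M b\<in>B. lborel))"
    unfolding Gu mult.assoc by (rule refl)
  also have "\<dots> = (\<integral>\<^sup>+z. (\<integral>\<^sup>+u. ennreal (u ^ (CARD('n) - 1)) * g (u *\<^sub>R z) * indicator {0<..} u \<partial>lborel)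
      \<partial>distr (\<Pi>\<^sub>M b\<in>B. lborel) borel (\<lambda>c. p + Y c))"
    by (subst nn_integral_distr) auto
  finally show ?thesis
    unfolding G_def Y_def[abs_def] by simp
qed

section \<open>The boundary measure as a finite sum of weighted facet measures\<close>

lemma nn_integral_sum_measures:
  assumes I: "finite I" and s: "\<And>i. i \<in> I \<Longrightarrow> sets (N i) = sets M"
    and eq: "\<And>A. A \<in> sets M \<Longrightarrow> emeasure M A = (\<Sum>i\<in>I. emeasure (N i) A)"
    and f: "f \<in> borel_measurable M"
  shows "(\<integral>\<^sup>+x. f x \<partial>M) = (\<Sum>i\<in>I. \<integral>\<^sup>+x. f x \<partial>N i)"
  using f
proof (induction rule: borel_measurable_induct)
  case (cong f g)
  have "(\<integral>\<^sup>+x. f x \<partial>M) = (\<integral>\<^sup>+x. g x \<partial>M)" by (intro nn_integral_cong cong)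
  moreover have "(\<integral>\<^sup>+x. f x \<partial>N i) = (\<integral>\<^sup>+x. g x \<partial>N i)" if "i \<in> I" for i
    by (intro nn_integral_cong cong) (simp add: sets_eq_imp_space_eq[OF s[OF that, symmetric]])
  ultimately show ?case using cong by simp
next
  case (set A)
  then show ?case using s eq by (simp add: nn_integral_indicator)
next
  case (mult u c)
  have m: "u \<in> borel_measurable (N i)" if "i \<in> I" for i
    unfolding measurable_cong_sets[OF s[OF that] refl] by (fact mult(2))
  have "(\<integral>\<^sup>+x. c * u x \<partial>M) = c * (\<integral>\<^sup>+x. u x \<partial>M)" using mult(2) by (rule nn_integral_cmult)
  also have "\<dots> = (\<Sum>i\<in>I. c * (\<integral>\<^sup>+x. u x \<partial>N i))" unfolding mult.IH sum_distrib_left by (rule refl)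
  also have "\<dots> = (\<Sum>i\<in>I. \<integral>\<^sup>+x. c * u x \<partial>N i)" by (intro sum.cong refl nn_integral_cmult[symmetric] m)
  finally show ?case .
next
  case (add u v)
  have m: "u \<in> borel_measurable (N i)" "v \<in> borel_measurable (N i)" if "i \<in> I" for i
    unfolding measurable_cong_sets[OF s[OF that] refl] by (simp_all add: add(1,3))
  have "(\<integral>\<^sup>+x. v x + u x \<partial>M) = (\<integral>\<^sup>+x. v x \<partial>M) + (\<integral>\<^sup>+x. u x \<partial>M)" using add(3,1) by (rule nn_integral_add)
  also have "\<dots> = (\<Sum>i\<in>I. (\<integral>\<^sup>+x. v x \<partial>N i) + (\<integral>\<^sup>+x. u x \<partial>N i))" unfolding add.IH sum.distrib by (rule refl)
  also have "\<dots> = (\<Sum>i\<in>I. \<integral>\<^sup>+x. v x + u x \<partial>N i)" by (intro sum.cong refl nn_integral_add[symmetric] m)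
  finally show ?case .
next
  case (seq U)
  have m: "U k \<in> borel_measurable (N i)" if "i \<in> I" for i k
    unfolding measurable_cong_sets[OF s[OF that] refl] by (rule seq(1))
  have "(\<integral>\<^sup>+x. (SUP i. U i) x \<partial>M) = (SUP k. \<integral>\<^sup>+x. U k x \<partial>M)"
    unfolding SUP_apply by (rule nn_integral_monotone_convergence_SUP[OF seq(3,1)])
  also have "\<dots> = (SUP k. \<Sum>i\<in>I. \<integral>\<^sup>+x. U k x \<partial>N i)" unfolding seq.IH by (rule refl)
  also have "\<dots> = (\<Sum>i\<in>I. SUP k. \<integral>\<^sup>+x. U k x \<partial>N i)"
    using seq(3) by (intro ennreal_SUP_sum) (auto simp: incseq_def le_fun_def intro!: nn_integral_mono)
  also have "\<dots> = (\<Sum>i\<in>I. \<integral>\<^sup>+x. (SUP i. U i) x \<partial>N i)"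
    unfolding SUP_apply by (intro sum.cong refl nn_integral_monotone_convergence_SUP[symmetric] seq(3) m)
  finally show ?case .
qed

lemma vec_of_int_eq_iff [simp]: "vec_of_int a = vec_of_int b \<longleftrightarrow> a = b"
  by (simp add: vec_of_int_def vec_eq_iff)

lemma vec_of_int_0 [simp]: "vec_of_int 0 = 0"
  by (simp add: vec_of_int_def vec_eq_iff)

lemma vec_of_int_eq_0_iff [simp]: "vec_of_int a = 0 \<longleftrightarrow> a = 0"
  using vec_of_int_eq_iff[of a 0] by simp

text \<open>Only the existence of some frame is extracted from the choice operator; since the cone
  formula holds for every frame, the chosen one may stay unknown.\<close>

lemma affine_lborel_hyperplane:
  fixes a :: "'a::euclidean_space"
  assumes "a \<noteq> 0"
  obtains p B where "a \<bullet> p = -1" "pairwise orthogonal B" "\<And>b. b \<in> B \<Longrightarrow> norm b = 1"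
    "span B = (\<lambda>x. x - p) ` {z. a \<bullet> z + 1 = 0}"
    "affine_lborel {z. a \<bullet> z + 1 = 0} = distr (\<Pi>\<^sub>M b\<in>B. lborel) borel (\<lambda>c. p + (\<Sum>b\<in>B. c b *\<^sub>R b))"
proof -
  let ?S = "{z. a \<bullet> z + 1 = 0}"
  define p where "p = - a /\<^sub>R (a \<bullet> a)"
  have p: "a \<bullet> p = -1" using assms by (simp add: p_def)
  obtain B where B: "pairwise orthogonal B" "\<And>b. b \<in> B \<Longrightarrow> norm b = 1" "span B = {y. a \<bullet> y = 0}"
    using orthonormal_basis_subspace[OF subspace_hyperplane[of a]] by metis
  have "y \<in> (\<lambda>x. x - p) ` ?S" if "a \<bullet> y = 0" for y
    using that p by (intro image_eqI[of _ _ "y + p"]) (auto simp: inner_add_right)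
  then have "span B = (\<lambda>x. x - p) ` ?S"
    using p by (auto simp: inner_diff_right B(3))
  then have "\<exists>M p B. p \<in> ?S \<and> pairwise orthogonal B \<and> (\<forall>b\<in>B. norm b = 1) \<and> span B = (\<lambda>x. x - p) ` ?S \<and>
     M = distr (\<Pi>\<^sub>M b\<in>B. lborel) borel (\<lambda>c. p + (\<Sum>b\<in>B. c b *\<^sub>R b))"
    using B p by (intro exI[of _ "distr (\<Pi>\<^sub>M b\<in>B. lborel) borel (\<lambda>c. p + (\<Sum>b\<in>B. c b *\<^sub>R b))"] exI[of _ p] exI[of _ B]) auto
  from someI_ex[OF this, folded affine_lborel_def]
  obtain p B where "p \<in> ?S" "pairwise orthogonal B" "\<forall>b\<in>B. norm b = 1" "span B = (\<lambda>x. x - p) ` ?S"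
     "affine_lborel ?S = distr (\<Pi>\<^sub>M b\<in>B. lborel) borel (\<lambda>c. p + (\<Sum>b\<in>B. c b *\<^sub>R b))"
    by (elim exE conjE)
  then show ?thesis by (intro that[of p B]) auto
qed

lemma sets_boundary_measure [simp, measurable_cong]: "sets (boundary_measure \<Lambda>) = sets borel"
  by (simp add: boundary_measure_def sigma_algebra.sets_measure_of_eq[OF sets.sigma_algebra_axioms, of borel, simplified])

lemma facet_hyperplane_alt: "facet_hyperplane a = {z. vec_of_int a \<bullet> z + 1 = 0}"
  by (simp add: facet_hyperplane_def)

lemma sets_affine_lborel [simp, measurable_cong]:
  "a \<noteq> 0 \<Longrightarrow> sets (affine_lborel {z. a \<bullet> z + 1 = 0}) = sets borel"
  by (rule affine_lborel_hyperplane[of a]) simp_all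

lemma closed_anticanonical_polytope [simp, intro]: "closed (anticanonical_polytope \<Lambda>)"
proof -
  have eq: "t + 1 \<ge> 0 \<longleftrightarrow> t \<ge> -1" for t :: real by auto
  have "anticanonical_polytope \<Lambda> = (\<Inter>a\<in>\<Lambda>. {x. vec_of_int a \<bullet> x \<ge> -1})"
    unfolding anticanonical_polytope_def
    by (intro set_eqI) (simp add: eq)
  then show ?thesis by (auto intro!: closed_INT closed_halfspace_ge)
qed

lemma closed_facet [simp, intro]: "closed (facet \<Lambda> a)"
proof -
  have "facet_hyperplane a = {x. vec_of_int a \<bullet> x = -1}"
    by (auto simp: facet_hyperplane_def)
  then show ?thesis unfolding facet_def by (auto intro!: closed_Int closed_hyperplane)
qed

text \<open>\<open>measure_of\<close> takes the prescribed values only once the set function is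
  known to be countably additive. Writing each summand as a density reduces this to the additivity
  of genuine measures.\<close>

lemma emeasure_boundary_measure:
  fixes \<Lambda> :: "(int^'n) set"
  assumes 0: "0 \<notin> \<Lambda>" and A: "A \<in> sets borel"
  shows "emeasure (boundary_measure \<Lambda>) A =
    (\<Sum>a\<in>\<Lambda>. emeasure (density (affine_lborel (facet_hyperplane a)) (\<lambda>x. ennreal (1 / norm (vec_of_int a)) * indicator (facet \<Lambda> a) x)) A)"
proof -
  let ?N = "\<lambda>a. density (affine_lborel (facet_hyperplane a)) (\<lambda>x. ennreal (1 / norm (vec_of_int a)) * indicator (facet \<Lambda> a) x)"
  have sN: "sets (affine_lborel (facet_hyperplane a)) = sets borel" if "a \<in> \<Lambda>" for a
    unfolding facet_hyperplane_alt using that 0 by (intro sets_affine_lborel) auto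
  have *: "ennreal (1 / norm (vec_of_int a)) * emeasure (affine_lborel (facet_hyperplane a)) (A \<inter> facet \<Lambda> a) = emeasure (?N a) A"
    if "a \<in> \<Lambda>" "A \<in> sets borel" for a A
  proof -
    have [measurable]: "A \<in> sets (affine_lborel (facet_hyperplane a))" "facet \<Lambda> a \<in> sets (affine_lborel (facet_hyperplane a))"
      using that sN by (auto simp: sN[OF that(1)])
    show ?thesis
      by (subst emeasure_density) (auto simp: nn_integral_cmult mult.assoc indicator_inter_arith[symmetric] Int_commute)
  qed
  let ?\<mu> = "\<lambda>A. \<Sum>a\<in>\<Lambda>. ennreal (1 / norm (vec_of_int a)) * emeasure (affine_lborel (facet_hyperplane a)) (A \<inter> facet \<Lambda> a)"
  have eq: "?\<mu> A = (\<Sum>a\<in>\<Lambda>. emeasure (?N a) A)" if "A \<in> sets borel" for A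
    using * that by simp
  have "countably_additive (sets borel) ?\<mu>"
  proof (rule countably_additiveI)
    fix A :: "nat \<Rightarrow> (real^'n) set" assume A: "range A \<subseteq> sets borel" "disjoint_family A" "(\<Union>i. A i) \<in> sets borel"
    have "(\<Sum>i. ?\<mu> (A i)) = (\<Sum>i. \<Sum>a\<in>\<Lambda>. emeasure (?N a) (A i))"
      using A by (intro suminf_cong eq) auto
    also have "\<dots> = (\<Sum>a\<in>\<Lambda>. \<Sum>i. emeasure (?N a) (A i))"
      by (intro suminf_sum) auto
    also have "\<dots> = (\<Sum>a\<in>\<Lambda>. emeasure (?N a) (\<Union>i. A i))"
      using A sN by (intro sum.cong refl suminf_emeasure) auto
    also have "\<dots> = ?\<mu> (\<Union>i. A i)" using A by (intro eq[symmetric]) auto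
    finally show "(\<Sum>i. ?\<mu> (A i)) = ?\<mu> (\<Union>i. A i)" .
  qed
  then have "emeasure (boundary_measure \<Lambda>) A = ?\<mu> A"
    unfolding boundary_measure_def using A sets.sigma_algebra_axioms[of borel]
    by (intro emeasure_measure_of_sigma) (auto simp: positive_def)
  then show ?thesis using eq[OF A] by simp
qed

lemma nn_integral_boundary_measure:
  assumes "finite \<Lambda>" "0 \<notin> \<Lambda>" and f [measurable]: "f \<in> borel_measurable borel"
  shows "(\<integral>\<^sup>+z. f z \<partial>boundary_measure \<Lambda>) =
    (\<Sum>a\<in>\<Lambda>. ennreal (1 / norm (vec_of_int a)) * (\<integral>\<^sup>+z. f z * indicator (facet \<Lambda> a) z \<partial>affine_lborel (facet_hyperplane a)))"
proof -
  have sN: "sets (affine_lborel (facet_hyperplane a)) = sets borel" if "a \<in> \<Lambda>" for a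
    unfolding facet_hyperplane_alt using that assms by (intro sets_affine_lborel) auto
  have "(\<integral>\<^sup>+z. f z \<partial>boundary_measure \<Lambda>) = (\<Sum>a\<in>\<Lambda>. (\<integral>\<^sup>+z. f z \<partial>density (affine_lborel (facet_hyperplane a)) (\<lambda>x. ennreal (1 / norm (vec_of_int a)) * indicator (facet \<Lambda> a) x)))"
    using assms sN by (intro nn_integral_sum_measures emeasure_boundary_measure) auto
  also have "\<dots> = (\<Sum>a\<in>\<Lambda>. ennreal (1 / norm (vec_of_int a)) * (\<integral>\<^sup>+z. f z * indicator (facet \<Lambda> a) z \<partial>affine_lborel (facet_hyperplane a)))"
  proof (intro sum.cong refl)
    fix a assume a: "a \<in> \<Lambda>"
    note sN[OF a, measurable_cong]
    have [measurable]: "facet \<Lambda> a \<in> sets borel" by auto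
    show "(\<integral>\<^sup>+z. f z \<partial>density (affine_lborel (facet_hyperplane a)) (\<lambda>x. ennreal (1 / norm (vec_of_int a)) * indicator (facet \<Lambda> a) x))
     = ennreal (1 / norm (vec_of_int a)) * (\<integral>\<^sup>+z. f z * indicator (facet \<Lambda> a) z \<partial>affine_lborel (facet_hyperplane a))"
      by (subst nn_integral_density) (auto simp: nn_integral_cmult[symmetric] ac_simps)
  qed
  finally show ?thesis .
qed

lemma facet_subset_frontier:
  assumes "a \<in> \<Lambda>" "a \<noteq> 0"
  shows "facet \<Lambda> a \<subseteq> frontier (anticanonical_polytope \<Lambda>)"
proof -
  have "anticanonical_polytope \<Lambda> \<subseteq> {x. vec_of_int a \<bullet> x \<ge> -1}"
    using assms by (auto simp: anticanonical_polytope_def)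
  then have "interior (anticanonical_polytope \<Lambda>) \<subseteq> {x. vec_of_int a \<bullet> x > -1}"
    using assms interior_mono[of "anticanonical_polytope \<Lambda>" "{x. vec_of_int a \<bullet> x \<ge> -1}"] interior_halfspace_ge[of "vec_of_int a" "-1"] by simp
  then show ?thesis
    by (auto simp: frontier_def facet_def facet_hyperplane_def)
qed

text \<open>Otherwise the whole ray through \<open>x\<close> would stay inside the polytope.\<close>

lemma bounded_polytope_neg:
  fixes x :: "real^'n"
  assumes "bounded (anticanonical_polytope \<Lambda>)" "x \<noteq> 0"
  shows "\<exists>a\<in>\<Lambda>. vec_of_int a \<bullet> x < 0"
proof (rule ccontr)
  assume *: "\<not> ?thesis"
  have "t *\<^sub>R x \<in> anticanonical_polytope \<Lambda>" if "t \<ge> 0" for t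
    using * that by (auto simp: anticanonical_polytope_def not_less)
  moreover obtain C where "\<And>y. y \<in> anticanonical_polytope \<Lambda> \<Longrightarrow> norm y \<le> C"
    using assms(1) by (auto simp: bounded_iff)
  moreover have "(\<bar>C\<bar> + 1) / norm x \<ge> 0" by simp
  ultimately have "norm (((\<bar>C\<bar> + 1) / norm x) *\<^sub>R x) \<le> C" by blast
  then show False using assms(2) by simp
qed

text \<open>The ray through x leaves P through the facet whose generator has the smallest,
  necessarily negative, pairing with x; \<open>C a\<close> collects the points that belong to
  \<open>a\<close> in this sense. Ties occur on finitely many hyperplanes only, hence on a null
  set.\<close>

theorem nn_integral_polar:
  fixes \<Lambda> :: "(int^'n::{finite,wellorder}) set" and g :: "real^'n::_ \<Rightarrow> ennreal"
  assumes fin: "finite \<Lambda>" and nz: "0 \<notin> \<Lambda>" and bd: "bounded (anticanonical_polytope \<Lambda>)"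
    and g [measurable]: "g \<in> borel_measurable borel"
  shows "(\<integral>\<^sup>+x. g x * indicator (anticanonical_polytope \<Lambda>) x \<partial>lborel) =
    (\<integral>\<^sup>+z. (\<integral>\<^sup>+u. ennreal (u ^ (CARD('n) - 1)) * g (u *\<^sub>R z) * indicator {0<..1} u \<partial>lborel)
       * indicator (frontier (anticanonical_polytope \<Lambda>)) z \<partial>boundary_measure \<Lambda>)"
proof -
  let ?P = "anticanonical_polytope \<Lambda>"
  define C where "C a = {x \<in> ?P. vec_of_int a \<bullet> x < 0 \<and> (\<forall>b\<in>\<Lambda>. vec_of_int a \<bullet> x \<le> vec_of_int b \<bullet> x)}" for a
  have Pm [measurable]: "?P \<in> sets borel" by auto
  have Cm [measurable]: "C a \<in> sets borel" for a
  proof -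
    have "C a = ?P \<inter> {x. vec_of_int a \<bullet> x < 0} \<inter> (\<Inter>b\<in>\<Lambda>. {x. (vec_of_int a - vec_of_int b) \<bullet> x \<le> 0})"
      by (auto simp: C_def inner_diff_left)
    moreover have "closed (\<Inter>b\<in>\<Lambda>. {x. (vec_of_int a - vec_of_int b) \<bullet> x \<le> 0})"
      by (intro closed_INT ballI closed_halfspace_le)
    ultimately show ?thesis by (auto intro!: borel_open open_halfspace_lt)
  qed
  have "AE x in lborel. indicator ?P x = (\<Sum>a\<in>\<Lambda>. indicator (C a) x :: ennreal)"
  proof -
    have "AE x in lborel. vec_of_int (a - b) \<bullet> x \<noteq> 0" if "a \<noteq> b" for a b :: "int^'n::_"
    proof -
      have "vec_of_int (a - b) \<noteq> 0" using that by simp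
      then have "negligible {x. vec_of_int (a - b) \<bullet> x = 0}"
        by (intro negligible_hyperplane) auto
      then have "AE x in lebesgue. x \<notin> {x. vec_of_int (a - b) \<bullet> x = 0}"
        unfolding negligible_iff_null_sets by (rule AE_not_in)
      then show ?thesis by (simp add: AE_completion_iff)
    qed
    then have "AE x in lborel. \<forall>a\<in>\<Lambda>. \<forall>b\<in>\<Lambda>. a \<noteq> b \<longrightarrow> vec_of_int (a - b) \<bullet> x \<noteq> 0"
      using fin by (simp add: AE_ball_countable countable_finite)
    moreover have "AE x in lborel. x \<noteq> (0 :: real^'n::_)"
      by (rule AE_lborel_singleton)
    ultimately show ?thesis
    proof eventually_elim
      case (elim x)
      have dif: "vec_of_int (a - b) = vec_of_int a - vec_of_int b" for a b :: "int^'n::_"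
        by (simp add: vec_of_int_def vec_eq_iff)
      show ?case
      proof (cases "x \<in> ?P")
        case True
        obtain a0 where a0: "a0 \<in> \<Lambda>" "vec_of_int a0 \<bullet> x < 0" using bounded_polytope_neg[OF bd elim(2)] by blast
        obtain a where a: "a \<in> \<Lambda>" "\<And>b. b \<in> \<Lambda> \<Longrightarrow> vec_of_int a \<bullet> x \<le> vec_of_int b \<bullet> x"
          using fin a0(1) ex_is_arg_min_if_finite[of \<Lambda> "\<lambda>a. vec_of_int a \<bullet> x"]
          unfolding is_arg_min_linorder by (metis empty_iff)
        have "x \<in> C a" using True a a0 by (force simp: C_def)
        moreover have "x \<notin> C b" if "b \<in> \<Lambda>" "b \<noteq> a" for b
          using elim(1) a that by (auto simp: C_def dif inner_diff_left) (metis order_antisym)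
        ultimately have "indicator (C b) x = (if b = a then 1 else 0 :: ennreal)" if "b \<in> \<Lambda>" for b
          using that by (auto simp: indicator_def)
        then have "(\<Sum>b\<in>\<Lambda>. indicator (C b) x :: ennreal) = 1" using a(1) fin by simp
        then show ?thesis using True by simp
      qed (auto simp: C_def indicator_def)
    qed
  qed
  then have "(\<integral>\<^sup>+x. g x * indicator ?P x \<partial>lborel) = (\<integral>\<^sup>+x. (\<Sum>a\<in>\<Lambda>. g x * indicator (C a) x) \<partial>lborel)"
    by (intro nn_integral_cong_AE) (auto simp: sum_distrib_left elim!: eventually_mono)
  also have "\<dots> = (\<Sum>a\<in>\<Lambda>. \<integral>\<^sup>+x. g x * indicator (C a) x \<partial>lborel)"
    by (intro nn_integral_sum) auto
  also have "\<dots> = (\<Sum>a\<in>\<Lambda>. ennreal (1 / norm (vec_of_int a)) * (\<integral>\<^sup>+z. ((\<integral>\<^sup>+u. ennreal (u ^ (CARD('n) - 1)) * g (u *\<^sub>R z) * indicator {0<..1} u \<partial>lborel)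
       * indicator (frontier ?P) z) * indicator (facet \<Lambda> a) z \<partial>affine_lborel (facet_hyperplane a)))"
  proof (intro sum.cong refl)
    fix a assume a: "a \<in> \<Lambda>"
    then have a0: "vec_of_int a \<noteq> 0" using nz by auto
    obtain p B where pB: "vec_of_int a \<bullet> p = -1" "pairwise orthogonal B" "\<And>b. b \<in> B \<Longrightarrow> norm b = 1"
    "span B = (\<lambda>x. x - p) ` {z. vec_of_int a \<bullet> z + 1 = 0}"
    "affine_lborel {z. vec_of_int a \<bullet> z + 1 = 0} = distr (\<Pi>\<^sub>M b\<in>B. lborel) borel (\<lambda>c. p + (\<Sum>b\<in>B. c b *\<^sub>R b))"
      by (rule affine_lborel_hyperplane[OF a0]; rule that)
    define M where "M = affine_lborel (facet_hyperplane a)"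
    have Mdef: "M = distr (\<Pi>\<^sub>M b\<in>B. lborel) borel (\<lambda>c. p + (\<Sum>b\<in>B. c b *\<^sub>R b))"
      by (simp add: M_def facet_hyperplane_alt pB(5))
    have AE: "AE z in M. vec_of_int a \<bullet> z = -1"
    proof -
      have "vec_of_int a \<bullet> b = 0" if "b \<in> B" for b using span_base[OF that] pB(1) unfolding pB(4) by (auto simp: inner_diff_right)
      then have "vec_of_int a \<bullet> (p + (\<Sum>b\<in>B. c b *\<^sub>R b)) = -1" for c by (simp add: inner_add_right inner_sum_right pB(1))
      then show ?thesis unfolding Mdef by (subst AE_distr_iff) auto
    qed
    have "(\<integral>\<^sup>+x. g x * indicator (C a) x \<partial>lborel) = (\<integral>\<^sup>+x. (g x * indicator (C a) x) * indicator {x. vec_of_int a \<bullet> x < 0} x \<partial>lborel)"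
      by (intro nn_integral_cong) (auto simp: C_def indicator_def)
    also have "\<dots> = ennreal (1 / norm (vec_of_int a)) *
      (\<integral>\<^sup>+z. (\<integral>\<^sup>+u. ennreal (u ^ (CARD('n) - 1)) * (g (u *\<^sub>R z) * indicator (C a) (u *\<^sub>R z)) * indicator {0<..} u \<partial>lborel) \<partial>M)"
      unfolding Mdef using a0 pB by (intro nn_integral_halfspace_cone) auto
    also have "(\<integral>\<^sup>+z. (\<integral>\<^sup>+u. ennreal (u ^ (CARD('n) - 1)) * (g (u *\<^sub>R z) * indicator (C a) (u *\<^sub>R z)) * indicator {0<..} u \<partial>lborel) \<partial>M)
      = (\<integral>\<^sup>+z. ((\<integral>\<^sup>+u. ennreal (u ^ (CARD('n) - 1)) * g (u *\<^sub>R z) * indicator {0<..1} u \<partial>lborel)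
       * indicator (frontier ?P) z) * indicator (facet \<Lambda> a) z \<partial>M)"
    proof (rule nn_integral_cong_AE, use AE in eventually_elim)
      case (elim z)
      \<comment> \<open>On the hyperplane of \<open>a\<close> the pairing of \<open>a\<close> with u
        z is -u. Its minimality among all generators says that z satisfies every inequality of P,
        and u z \<in> P then means u \<le> 1.\<close>
      have *: "indicator (C a) (u *\<^sub>R z) * indicator {0<..} u = indicator {0<..1} u * (indicator (facet \<Lambda> a) z :: ennreal)" for u :: real
      proof (cases "u > 0")
        case True
        have "u *\<^sub>R z \<in> C a \<longleftrightarrow> u \<le> 1 \<and> z \<in> facet \<Lambda> a"
        proof
          assume z: "u *\<^sub>R z \<in> C a"
          then have "\<forall>b\<in>\<Lambda>. u * -1 \<le> u * (vec_of_int b \<bullet> z)" "u \<le> 1"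
            using elim a by (auto simp: C_def anticanonical_polytope_def dest: bspec[of _ _ a])
          then have "\<forall>b\<in>\<Lambda>. -1 \<le> vec_of_int b \<bullet> z" using True mult_le_cancel_left_pos by blast
          then show "u \<le> 1 \<and> z \<in> facet \<Lambda> a" using elim \<open>u \<le> 1\<close>
            by (auto simp: facet_def facet_hyperplane_def anticanonical_polytope_def)
        next
          assume z: "u \<le> 1 \<and> z \<in> facet \<Lambda> a"
          then have 1: "-1 \<le> vec_of_int b \<bullet> z" if "b \<in> \<Lambda>" for b
            using that by (force simp: facet_def anticanonical_polytope_def)
          then have "u * -1 \<le> u * (vec_of_int b \<bullet> z)" if "b \<in> \<Lambda>" for b
            using True that mult_left_mono[of "-1" "vec_of_int b \<bullet> z" u] by simp
          moreover have "-1 \<le> u * -1" using z by simp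
          ultimately show "u *\<^sub>R z \<in> C a"
            using elim a True by (force simp: C_def anticanonical_polytope_def)
        qed
        then show ?thesis using True by (auto simp: indicator_def)
      qed auto
      have "indicator (frontier ?P) z * indicator (facet \<Lambda> a) z = (indicator (facet \<Lambda> a) z :: ennreal)"
        using facet_subset_frontier[OF a] a0 by (auto simp: indicator_def)
      then have "(\<integral>\<^sup>+u. ennreal (u ^ (CARD('n) - 1)) * g (u *\<^sub>R z) * indicator {0<..1} u \<partial>lborel)
          * indicator (frontier ?P) z * indicator (facet \<Lambda> a) z
        = (\<integral>\<^sup>+u. ennreal (u ^ (CARD('n) - 1)) * g (u *\<^sub>R z) * indicator {0<..1} u * indicator (facet \<Lambda> a) z \<partial>lborel)"
        by (subst nn_integral_multc) (auto simp: mult.assoc)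
      then show ?case using * by (simp add: mult.assoc)
    qed
    finally show "(\<integral>\<^sup>+x. g x * indicator (C a) x \<partial>lborel) = ennreal (1 / norm (vec_of_int a)) * (\<integral>\<^sup>+z. ((\<integral>\<^sup>+u. ennreal (u ^ (CARD('n) - 1)) * g (u *\<^sub>R z) * indicator {0<..1} u \<partial>lborel)
       * indicator (frontier ?P) z) * indicator (facet \<Lambda> a) z \<partial>affine_lborel (facet_hyperplane a))"
      by (simp add: M_def)
  qed
  also have "\<dots> = (\<integral>\<^sup>+z. (\<integral>\<^sup>+u. ennreal (u ^ (CARD('n) - 1)) * g (u *\<^sub>R z) * indicator {0<..1} u \<partial>lborel)
       * indicator (frontier ?P) z \<partial>boundary_measure \<Lambda>)"
    using fin nz by (intro nn_integral_boundary_measure[symmetric]) auto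
  finally show ?thesis .
qed

section \<open>A criterion for uniform relative K-polystability\<close>

lemma nn_integral_power_affine:
  assumes "\<And>u. 0 \<le> u \<Longrightarrow> u \<le> 1 \<Longrightarrow> 0 \<le> A + u * B"
  shows "(\<integral>\<^sup>+u. ennreal (u ^ k * (A + u * B)) * indicator {0<..1} u \<partial>lborel) = ennreal (A / (real k + 1) + B / (real k + 2))"
proof -
  have "(\<integral>\<^sup>+u. ennreal (u ^ k * (A + u * B)) * indicator {0<..1} u \<partial>lborel)
      = (\<integral>\<^sup>+u. ennreal (u ^ k * (A + u * B)) * indicator {0..1} u \<partial>lborel)"
    using AE_lborel_singleton[of "0 :: real"]
    by (intro nn_integral_cong_AE) (auto elim!: eventually_mono simp: indicator_def)
  also have "\<dots> = ennreal ((A / (real k + 1) * 1 ^ (k + 1) + B / (real k + 2) * 1 ^ (k + 2)) - (A / (real k + 1) * 0 ^ (k + 1) + B / (real k + 2) * 0 ^ (k + 2)))"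
  proof (rule nn_integral_FTC_Icc)
    fix x :: real assume x: "x \<in> {0..1}"
    have "((\<lambda>x. A / (real k + 1) * x ^ (k + 1) + B / (real k + 2) * x ^ (k + 2)) has_real_derivative
        (A / (real k + 1) * ((real k + 1) * x ^ k) + B / (real k + 2) * ((real k + 2) * x ^ (k + 1)))) (at x)"
      by (rule derivative_eq_intros refl | simp add: algebra_simps)+
    moreover have "A / (real k + 1) * ((real k + 1) * x ^ k) = A * x ^ k" by simp
    moreover have "B / (real k + 2) * ((real k + 2) * x ^ (k + 1)) = B * x ^ (k + 1)" by simp
    ultimately show "((\<lambda>x. A / (real k + 1) * x ^ (k + 1) + B / (real k + 2) * x ^ (k + 2)) has_real_derivative x ^ k * (A + x * B)) (at x)"
      by (simp add: algebra_simps)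
    show "0 \<le> x ^ k * (A + x * B)" using x assms by simp
  qed auto
  finally show ?thesis by simp
qed

section \<open>Integrals over the polytope and over its boundary\<close>

locale lattice_polytope =
  fixes \<Lambda> :: "(int^'n::{finite,wellorder}) set"
  assumes fin: "finite \<Lambda>" and nz: "0 \<notin> \<Lambda>" and bd: "bounded (anticanonical_polytope \<Lambda>)"
begin

abbreviation "P \<equiv> anticanonical_polytope \<Lambda>"
abbreviation "F \<equiv> frontier P"

lemma compact_P: "compact P"
  using bd by (simp add: compact_eq_bounded_closed)

lemma compact_F: "compact F"
  using compact_P by (simp add: compact_frontier)

lemma F_subset_P: "F \<subseteq> P"
  by (simp add: frontier_subset_closed)

lemma scaleR_P: "z \<in> P \<Longrightarrow> 0 \<le> u \<Longrightarrow> u \<le> 1 \<Longrightarrow> u *\<^sub>R z \<in> P"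
proof -
  assume z: "z \<in> P" and u: "0 \<le> u" "u \<le> 1"
  have "u * (vec_of_int a \<bullet> z) + 1 \<ge> 0" if "a \<in> \<Lambda>" for a
  proof -
    have "vec_of_int a \<bullet> z \<ge> -1" using z that by (force simp: anticanonical_polytope_def)
    then have "u * (vec_of_int a \<bullet> z) \<ge> u * -1" using u by (intro mult_left_mono)
    then show ?thesis using u by simp
  qed
  then show ?thesis by (simp add: anticanonical_polytope_def)
qed

lemma zero_interior: "0 \<in> interior P"
proof -
  have "open (\<Inter>a\<in>\<Lambda>. {x. vec_of_int a \<bullet> x > -1})"
    using fin by (intro open_INT ballI open_halfspace_gt)
  moreover have "(\<Inter>a\<in>\<Lambda>. {x. vec_of_int a \<bullet> x > -1}) \<subseteq> P"
    by (auto simp: anticanonical_polytope_def)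
      (smt (verit, best))
  moreover have "0 \<in> (\<Inter>a\<in>\<Lambda>. {x. vec_of_int a \<bullet> x > -1})" by simp
  ultimately show ?thesis by (metis interiorI)
qed

lemma zero_P: "0 \<in> P"
  using zero_interior interior_subset by blast

lemma volume_pos: "volume \<Lambda> > 0"
proof -
  obtain r where r: "r > 0" "ball 0 r \<subseteq> interior P"
    using zero_interior by (meson open_contains_ball open_interior)
  have "0 < measure lborel (ball (0 :: real^'n::_) r)" using r by (simp add: content_ball_pos)
  also have "\<dots> \<le> measure lborel P"
    using r interior_subset[of P] emeasure_bounded_finite[OF bd]
    by (intro measure_mono_fmeasurable) (auto simp: fmeasurable_def)
  finally show ?thesis by (simp add: volume_def)
qed

lemma emeasure_P: "emeasure lborel P = ennreal (volume \<Lambda>)"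
  using emeasure_bounded_finite[OF bd] by (simp add: volume_def emeasure_eq_ennreal_measure)

text \<open>This is the polar formula for the constant function 1, whose inner integral, that of
  u^(n-1) over (0, 1], equals 1/n.\<close>

lemma emeasure_F: "emeasure (boundary_measure \<Lambda>) F = ennreal (real CARD('n) * volume \<Lambda>)"
proof -
  have "ennreal (volume \<Lambda>) = (\<integral>\<^sup>+x. 1 * indicator P x \<partial>lborel)"
    by (simp add: emeasure_P)
  also have "\<dots> = (\<integral>\<^sup>+z. (\<integral>\<^sup>+u. ennreal (u ^ (CARD('n) - 1)) * 1 * indicator {0<..1} u \<partial>lborel) * indicator F z \<partial>boundary_measure \<Lambda>)"
    by (rule nn_integral_polar[OF fin nz bd]) simp
  also have "(\<integral>\<^sup>+u. ennreal (u ^ (CARD('n) - 1)) * 1 * indicator {0<..1} u \<partial>lborel) = ennreal (1 / real CARD('n))"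
    using nn_integral_power_affine[of 1 0 "CARD('n) - 1"] by simp
  also have "(\<integral>\<^sup>+z. ennreal (1 / real CARD('n)) * indicator F z \<partial>boundary_measure \<Lambda>) = ennreal (1 / real CARD('n)) * emeasure (boundary_measure \<Lambda>) F"
    by (subst nn_integral_cmult_indicator) auto
  finally have "ennreal (real CARD('n)) * ennreal (volume \<Lambda>) = ennreal (real CARD('n)) * (ennreal (1 / real CARD('n)) * emeasure (boundary_measure \<Lambda>) F)" by simp
  also have "\<dots> = emeasure (boundary_measure \<Lambda>) F"
    by (simp add: mult.assoc[symmetric] ennreal_mult[symmetric])
  finally show ?thesis using volume_pos by (simp add: ennreal_mult)
qed

lemma mean_scalar_eq: "mean_scalar \<Lambda> = real CARD('n)"
  using volume_pos by (simp add: mean_scalar_def measure_def[of _ F] emeasure_F)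

lemma cont_borel: "continuous_on UNIV f \<Longrightarrow> f \<in> borel_measurable borel" for f :: "real^'n::_ \<Rightarrow> real"
  by (rule borel_measurable_continuous_onI)

lemma interior_integrable:
  fixes f :: "real^'n::_ \<Rightarrow> real"
  assumes "continuous_on UNIV f"
  shows "set_integrable lborel P f"
  unfolding set_integrable_def using assms by (intro borel_integrable_compact compact_P) (auto intro: continuous_on_subset)

lemma boundary_integrable:
  fixes f :: "real^'n::_ \<Rightarrow> real"
  assumes f: "continuous_on UNIV f"
  shows "set_integrable (boundary_measure \<Lambda>) F f"
proof -
  have "compact (f ` F)" using compact_F f by (intro compact_continuous_image) (auto intro: continuous_on_subset)
  then obtain B where "\<forall>y\<in>f ` F. norm y \<le> B" using compact_imp_bounded bounded_iff by metis
  then have B: "\<And>x. x \<in> F \<Longrightarrow> norm (f x) \<le> B" by auto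
  show ?thesis unfolding set_integrable_def
    using cont_borel[OF f] B
    by (intro integrableI_bounded_set_indicator[where B = B]) (auto simp: emeasure_F measurable_cong_sets[OF sets_boundary_measure refl])
qed

lemma boundary_integral_add:
  assumes "continuous_on UNIV f" "continuous_on UNIV g"
  shows "boundary_integral \<Lambda> (\<lambda>x. f x + g x) = boundary_integral \<Lambda> f + boundary_integral \<Lambda> g"
  unfolding boundary_integral_def using assms by (intro set_integral_add boundary_integrable)

lemma boundary_integral_cmult: "boundary_integral \<Lambda> (\<lambda>x. c * f x) = c * boundary_integral \<Lambda> f"
  unfolding boundary_integral_def by simp

lemma boundary_integral_mono:
  assumes "continuous_on UNIV f" "continuous_on UNIV g" "\<And>x. x \<in> P \<Longrightarrow> f x \<le> g x"
  shows "boundary_integral \<Lambda> f \<le> boundary_integral \<Lambda> g"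
  unfolding boundary_integral_def using assms F_subset_P by (intro set_integral_mono boundary_integrable) auto

lemma interior_integral_add:
  assumes "continuous_on UNIV f" "continuous_on UNIV g"
  shows "interior_integral \<Lambda> (\<lambda>x. f x + g x) = interior_integral \<Lambda> f + interior_integral \<Lambda> g"
  unfolding interior_integral_def using assms by (intro set_integral_add interior_integrable)

lemma interior_integral_cmult: "interior_integral \<Lambda> (\<lambda>x. c * f x) = c * interior_integral \<Lambda> f"
  unfolding interior_integral_def by simp

lemma interior_integral_mono:
  assumes "continuous_on UNIV f" "continuous_on UNIV g" "\<And>x. x \<in> P \<Longrightarrow> f x \<le> g x"
  shows "interior_integral \<Lambda> f \<le> interior_integral \<Lambda> g"
  unfolding interior_integral_def using assms by (intro set_integral_mono interior_integrable) auto

lemma interior_integral_const: "interior_integral \<Lambda> (\<lambda>x. c) = c * volume \<Lambda>"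
  unfolding interior_integral_def volume_def set_lebesgue_integral_def by simp

lemma boundary_integral_const: "boundary_integral \<Lambda> (\<lambda>x. c) = c * (real CARD('n) * volume \<Lambda>)"
  using volume_pos unfolding boundary_integral_def set_lebesgue_integral_def by (simp add: measure_def emeasure_F)

lemma interior_integral_nonneg: "(\<And>x. x \<in> P \<Longrightarrow> 0 \<le> f x) \<Longrightarrow> 0 \<le> interior_integral \<Lambda> f"
  unfolding interior_integral_def set_lebesgue_integral_def by (intro integral_nonneg_AE) (auto simp: indicator_def)

lemma boundary_integral_nonneg: "(\<And>x. x \<in> P \<Longrightarrow> 0 \<le> f x) \<Longrightarrow> 0 \<le> boundary_integral \<Lambda> f"
  unfolding boundary_integral_def set_lebesgue_integral_def using F_subset_P
  by (intro integral_nonneg_AE) (auto simp: indicator_def)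

lemma ennreal_interior_integral:
  assumes "continuous_on UNIV f" "\<And>x. x \<in> P \<Longrightarrow> 0 \<le> f x"
  shows "ennreal (interior_integral \<Lambda> f) = (\<integral>\<^sup>+x. ennreal (f x) * indicator P x \<partial>lborel)"
proof -
  have "(\<integral>\<^sup>+x. ennreal (f x) * indicator P x \<partial>lborel) = (\<integral>\<^sup>+x. ennreal (indicator P x *\<^sub>R f x) \<partial>lborel)"
    by (intro nn_integral_cong) (auto simp: indicator_def)
  also have "\<dots> = ennreal (interior_integral \<Lambda> f)"
    unfolding interior_integral_def set_lebesgue_integral_def using interior_integrable[OF assms(1)] assms(2)
    by (intro nn_integral_eq_integral) (auto simp: indicator_def set_integrable_def)
  finally show ?thesis by simp
qed

lemma ennreal_boundary_integral:
  assumes "continuous_on UNIV f" "\<And>x. x \<in> P \<Longrightarrow> 0 \<le> f x"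
  shows "ennreal (boundary_integral \<Lambda> f) = (\<integral>\<^sup>+x. ennreal (f x) * indicator F x \<partial>boundary_measure \<Lambda>)"
proof -
  have "(\<integral>\<^sup>+x. ennreal (f x) * indicator F x \<partial>boundary_measure \<Lambda>) = (\<integral>\<^sup>+x. ennreal (indicator F x *\<^sub>R f x) \<partial>boundary_measure \<Lambda>)"
    by (intro nn_integral_cong) (auto simp: indicator_def)
  also have "\<dots> = ennreal (boundary_integral \<Lambda> f)"
    unfolding boundary_integral_def set_lebesgue_integral_def using boundary_integrable[OF assms(1)] assms(2) F_subset_P
    by (intro nn_integral_eq_integral) (auto simp: indicator_def set_integrable_def)
  finally show ?thesis by simp
qed

lemma polar_le:
  assumes g: "continuous_on UNIV g" "\<And>x. x \<in> P \<Longrightarrow> 0 \<le> g x"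
    and k: "continuous_on UNIV k" "\<And>x. x \<in> P \<Longrightarrow> 0 \<le> k x"
    and le: "\<And>z. z \<in> P \<Longrightarrow> (\<integral>\<^sup>+u. ennreal (u ^ (CARD('n) - 1) * g (u *\<^sub>R z)) * indicator {0<..1} u \<partial>lborel) \<le> ennreal (k z)"
  shows "interior_integral \<Lambda> g \<le> boundary_integral \<Lambda> k"
proof -
  have [measurable]: "g \<in> borel_measurable borel" using g(1) by (rule cont_borel)
  have "ennreal (interior_integral \<Lambda> g) = (\<integral>\<^sup>+x. ennreal (g x) * indicator P x \<partial>lborel)"
    by (rule ennreal_interior_integral[OF g])
  also have "\<dots> = (\<integral>\<^sup>+z. (\<integral>\<^sup>+u. ennreal (u ^ (CARD('n) - 1)) * ennreal (g (u *\<^sub>R z)) * indicator {0<..1} u \<partial>lborel) * indicator F z \<partial>boundary_measure \<Lambda>)"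
    by (rule nn_integral_polar[OF fin nz bd]) simp
  also have "\<dots> \<le> (\<integral>\<^sup>+z. ennreal (k z) * indicator F z \<partial>boundary_measure \<Lambda>)"
  proof (rule nn_integral_mono)
    fix z
    show "(\<integral>\<^sup>+u. ennreal (u ^ (CARD('n) - 1)) * ennreal (g (u *\<^sub>R z)) * indicator {0<..1} u \<partial>lborel) * indicator F z \<le> ennreal (k z) * indicator F z"
    proof (cases "z \<in> F")
      case True
      then have z: "z \<in> P" using F_subset_P by auto
      have "(\<integral>\<^sup>+u. ennreal (u ^ (CARD('n) - 1)) * ennreal (g (u *\<^sub>R z)) * indicator {0<..1} u \<partial>lborel)
        = (\<integral>\<^sup>+u. ennreal (u ^ (CARD('n) - 1) * g (u *\<^sub>R z)) * indicator {0<..1} u \<partial>lborel)"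
        using g(2)[OF scaleR_P[OF z]] by (intro nn_integral_cong) (auto simp: indicator_def ennreal_mult)
      then show ?thesis using le[OF z] by (auto simp: indicator_def)
    qed simp
  qed
  also have "\<dots> = ennreal (boundary_integral \<Lambda> k)" by (rule ennreal_boundary_integral[OF k, symmetric])
  finally show ?thesis using boundary_integral_nonneg[OF k(2)] by (simp add: ennreal_le_iff)
qed

lemma polar_eq:
  assumes g: "continuous_on UNIV g" "\<And>x. x \<in> P \<Longrightarrow> 0 \<le> g x"
    and k: "continuous_on UNIV k" "\<And>x. x \<in> P \<Longrightarrow> 0 \<le> k x"
    and eq: "\<And>z. z \<in> P \<Longrightarrow> (\<integral>\<^sup>+u. ennreal (u ^ (CARD('n) - 1) * g (u *\<^sub>R z)) * indicator {0<..1} u \<partial>lborel) = ennreal (k z)"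
  shows "interior_integral \<Lambda> g = boundary_integral \<Lambda> k"
proof -
  have [measurable]: "g \<in> borel_measurable borel" using g(1) by (rule cont_borel)
  have "ennreal (interior_integral \<Lambda> g) = (\<integral>\<^sup>+x. ennreal (g x) * indicator P x \<partial>lborel)"
    by (rule ennreal_interior_integral[OF g])
  also have "\<dots> = (\<integral>\<^sup>+z. (\<integral>\<^sup>+u. ennreal (u ^ (CARD('n) - 1)) * ennreal (g (u *\<^sub>R z)) * indicator {0<..1} u \<partial>lborel) * indicator F z \<partial>boundary_measure \<Lambda>)"
    by (rule nn_integral_polar[OF fin nz bd]) simp
  also have "\<dots> = (\<integral>\<^sup>+z. ennreal (k z) * indicator F z \<partial>boundary_measure \<Lambda>)"
  proof (rule nn_integral_cong)
    fix z
    show "(\<integral>\<^sup>+u. ennreal (u ^ (CARD('n) - 1)) * ennreal (g (u *\<^sub>R z)) * indicator {0<..1} u \<partial>lborel) * indicator F z = ennreal (k z) * indicator F z"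
    proof (cases "z \<in> F")
      case True
      then have z: "z \<in> P" using F_subset_P by auto
      have "(\<integral>\<^sup>+u. ennreal (u ^ (CARD('n) - 1)) * ennreal (g (u *\<^sub>R z)) * indicator {0<..1} u \<partial>lborel)
        = (\<integral>\<^sup>+u. ennreal (u ^ (CARD('n) - 1) * g (u *\<^sub>R z)) * indicator {0<..1} u \<partial>lborel)"
        using g(2)[OF scaleR_P[OF z]] by (intro nn_integral_cong) (auto simp: indicator_def ennreal_mult)
      then show ?thesis using eq[OF z] by (auto simp: indicator_def)
    qed simp
  qed
  also have "\<dots> = ennreal (boundary_integral \<Lambda> k)" by (rule ennreal_boundary_integral[OF k, symmetric])
  finally show ?thesis
    using boundary_integral_nonneg[OF k(2)] interior_integral_nonneg[OF g(2)] by simp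
qed

lemma affine_function_cont: "affine_function l \<Longrightarrow> continuous_on UNIV l"
  by (auto simp: affine_function_def intro!: continuous_intros)

lemma affine_function_scale:
  fixes l :: "real^'n::_ \<Rightarrow> real"
  assumes "affine_function l" shows "l (u *\<^sub>R z) = l 0 + u * (l z - l 0)"
  using assms by (auto simp: affine_function_def algebra_simps)

text \<open>On a ray l(u z) = l(0) + u (l(z) - l(0)), so the polar formula gives \<integral> l dx =
  \<integral> (l(0)/n + (l - l(0))/(n + 1)) d\<sigma>; this is solved for the boundary
  integral.\<close>

lemma boundary_integral_affine:
  assumes l: "affine_function l"
  shows "boundary_integral \<Lambda> l = real CARD('n) * interior_integral \<Lambda> l + interior_integral \<Lambda> (\<lambda>x. l x - l 0)"
proof -
  note cl [continuous_intros] = affine_function_cont[OF l]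
  \<comment> \<open>A constant \<open>C\<close> is added to make the integrand nonnegative on P,
    because the polar formula is about nonnegative functions; it cancels at the end.\<close>
  have "compact (l ` P)" using compact_P cl by (intro compact_continuous_image) (auto intro: continuous_on_subset)
  then obtain C where "\<forall>y\<in>l ` P. norm y \<le> C" using compact_imp_bounded bounded_iff by metis
  then have C: "\<And>x. x \<in> P \<Longrightarrow> norm (l x) \<le> C" by auto
  have C0: "l x + C \<ge> 0" if "x \<in> P" for x using C[OF that] by auto
  let ?k = "\<lambda>z. (l 0 + C) / real CARD('n) + (l z - l 0) / (real CARD('n) + 1)"
  have n1: "real (CARD('n) - 1) = real CARD('n) - 1" by (simp add: of_nat_diff)
  have k: "(\<integral>\<^sup>+u. ennreal (u ^ (CARD('n) - 1) * (l (u *\<^sub>R z) + C)) * indicator {0<..1} u \<partial>lborel) = ennreal (?k z)" if z: "z \<in> P" for z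
  proof -
    have "(\<integral>\<^sup>+u. ennreal (u ^ (CARD('n) - 1) * (l (u *\<^sub>R z) + C)) * indicator {0<..1} u \<partial>lborel)
      = (\<integral>\<^sup>+u. ennreal (u ^ (CARD('n) - 1) * ((l 0 + C) + u * (l z - l 0))) * indicator {0<..1} u \<partial>lborel)"
      by (subst affine_function_scale[OF l]) (simp add: algebra_simps)
    also have "\<dots> = ennreal ((l 0 + C) / (real (CARD('n) - 1) + 1) + (l z - l 0) / (real (CARD('n) - 1) + 2))"
      using C0[OF scaleR_P[OF z]] unfolding affine_function_scale[OF l]
      by (intro nn_integral_power_affine) (simp add: algebra_simps)
    finally show ?thesis unfolding n1 by (simp add: algebra_simps)
  qed
  have k0: "0 \<le> ?k z" if "z \<in> P" for z
  proof -
    have "?k z = (l 0 + C) * (1 / real CARD('n) - 1 / (real CARD('n) + 1)) + (l z + C) / (real CARD('n) + 1)"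
      by (simp add: right_diff_distrib add_divide_distrib diff_divide_distrib)
    moreover have "1 / real CARD('n) - 1 / (real CARD('n) + 1) \<ge> 0" by (simp add: frac_le)
    ultimately show ?thesis using C0[OF zero_P] C0[OF that] by simp
  qed
  have "interior_integral \<Lambda> (\<lambda>x. l x + C) = boundary_integral \<Lambda> ?k"
    using C0 k k0 by (intro polar_eq continuous_intros) auto
  also have "?k = (\<lambda>z. 1 / (real CARD('n) + 1) * l z + ((l 0 + C) / real CARD('n) - l 0 / (real CARD('n) + 1)))"
    by (auto simp: add_divide_distrib diff_divide_distrib)
  also have "boundary_integral \<Lambda> \<dots> = 1 / (real CARD('n) + 1) * boundary_integral \<Lambda> l + ((l 0 + C) / real CARD('n) - l 0 / (real CARD('n) + 1)) * (real CARD('n) * volume \<Lambda>)"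
    by (subst boundary_integral_add) (auto intro!: continuous_intros simp only: boundary_integral_cmult boundary_integral_const)
  also have "interior_integral \<Lambda> (\<lambda>x. l x + C) = interior_integral \<Lambda> l + C * volume \<Lambda>"
    by (subst interior_integral_add) (auto intro!: continuous_intros simp: interior_integral_const)
  finally have *: "interior_integral \<Lambda> l + C * volume \<Lambda> = 1 / (real CARD('n) + 1) * boundary_integral \<Lambda> l + ((l 0 + C) / real CARD('n) - l 0 / (real CARD('n) + 1)) * (real CARD('n) * volume \<Lambda>)" .
  define n where "n = real CARD('n)"
  have n: "n > 0" by (simp add: n_def)
  have "((l 0 + C) / n - l 0 / (n + 1)) * (n * volume \<Lambda>) = (l 0 + C) * volume \<Lambda> - 1 / (n + 1) * (n * l 0 * volume \<Lambda>)"
    using n by (simp add: left_diff_distrib)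
  with * have "(n + 1) * (interior_integral \<Lambda> l + C * volume \<Lambda>) = (n + 1) * (1 / (n + 1) * boundary_integral \<Lambda> l + ((l 0 + C) * volume \<Lambda> - 1 / (n + 1) * (n * l 0 * volume \<Lambda>)))"
    by (simp add: n_def)
  also have "\<dots> = (n + 1) * (1 / (n + 1)) * boundary_integral \<Lambda> l + (n + 1) * ((l 0 + C) * volume \<Lambda>) - (n + 1) * (1 / (n + 1)) * (n * l 0 * volume \<Lambda>)"
    by (simp only: ring_distribs mult.assoc right_diff_distrib)
  also have "(n + 1) * (1 / (n + 1)) = 1" using n by simp
  finally have "(real CARD('n) + 1) * interior_integral \<Lambda> l = boundary_integral \<Lambda> l + l 0 * volume \<Lambda>"
    by (simp add: algebra_simps n_def)
  moreover have "interior_integral \<Lambda> (\<lambda>x. l x - l 0) = interior_integral \<Lambda> l - l 0 * volume \<Lambda>"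
    using interior_integral_add[of l "\<lambda>x. - l 0"] cl by (simp add: interior_integral_const continuous_intros)
  ultimately show ?thesis by (simp add: algebra_simps)
qed

text \<open>A continuous function that is nonzero at an interior point is nonzero on a nonempty open
  set, which is not negligible. Applied to a square, this gives the uniqueness of the extremal
  function.\<close>

lemma interior_integral_zero_imp:
  assumes f: "continuous_on UNIV f" "\<And>x. x \<in> P \<Longrightarrow> 0 \<le> f x" and 0: "interior_integral \<Lambda> f = 0" and x: "x \<in> interior P"
  shows "f x = 0"
proof (rule ccontr)
  assume nz: "f x \<noteq> 0"
  have [measurable]: "f \<in> borel_measurable borel" using f(1) by (rule cont_borel)
  have "(\<integral>\<^sup>+x. ennreal (f x) * indicator P x \<partial>lborel) = 0"
    using ennreal_interior_integral[OF f] 0 by simp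
  then have "AE x in lborel. ennreal (f x) * indicator P x = 0"
    by (subst (asm) nn_integral_0_iff_AE) auto
  then have ae: "AE x in lborel. \<not> (x \<in> interior P \<and> f x \<noteq> 0)"
  proof eventually_elim
    case (elim x)
    then show ?case using f(2)[of x] interior_subset[of P] by (auto simp: indicator_def split: if_splits)
  qed
  let ?W = "{y \<in> interior P. f y \<noteq> 0}"
  have "open ?W"
  proof -
    have "?W = interior P \<inter> f -` (-{0})" by auto
    moreover have "open (f -` (-{0}))" using f(1) by (intro open_vimage) auto
    ultimately show ?thesis by auto
  qed
  moreover have "?W \<noteq> {}" using x nz by auto
  ultimately have "\<not> negligible ?W" by (rule open_not_negligible)
  moreover have "?W \<in> null_sets lborel"
    using ae \<open>open ?W\<close> by (subst (asm) AE_iff_null) (auto simp: conj_commute)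
  then have "negligible ?W" using null_sets_completionI by (auto simp: negligible_iff_null_sets)
  ultimately show False by simp
qed

text \<open>The formula for boundary integrals of affine functions turns the defining equation into
  \<open>VE\<close>, in which only volume integrals occur. For uniqueness, the difference of two
  solutions is itself an admissible test function and therefore has square integral 0; it vanishes
  on a ball around the origin.\<close>

lemma extremal_function_eq:
  assumes V: "affine_function V"
    and VE: "\<And>l. affine_function l \<Longrightarrow> interior_integral \<Lambda> (\<lambda>x. V x * l x) = interior_integral \<Lambda> (\<lambda>x. l x - l 0)"
  shows "extremal_function \<Lambda> = V"
  unfolding extremal_function_def mean_scalar_eq
proof (rule the_equality)
  have *: "interior_integral \<Lambda> (\<lambda>x. (real CARD('n) + W x) * l x) = real CARD('n) * interior_integral \<Lambda> l + interior_integral \<Lambda> (\<lambda>x. W x * l x)"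
    if "affine_function W" "affine_function l" for W l
  proof -
    note [continuous_intros] = affine_function_cont[OF that(1)] affine_function_cont[OF that(2)]
    show ?thesis unfolding distrib_right
      by (subst interior_integral_add) (auto intro!: continuous_intros simp: interior_integral_cmult)
  qed
  show "affine_function V \<and> (\<forall>l. affine_function l \<longrightarrow> boundary_integral \<Lambda> l = interior_integral \<Lambda> (\<lambda>x. (real CARD('n) + V x) * l x))"
    using V VE by (auto simp: * boundary_integral_affine)
  fix W assume W: "affine_function W \<and> (\<forall>l. affine_function l \<longrightarrow> boundary_integral \<Lambda> l = interior_integral \<Lambda> (\<lambda>x. (real CARD('n) + W x) * l x))"
  obtain a c where ac: "V = (\<lambda>x. a \<bullet> x + c)" using V by (auto simp: affine_function_def)
  obtain b d where bd: "W = (\<lambda>x. b \<bullet> x + d)" using W by (auto simp: affine_function_def)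
  define D where "D x = W x - V x" for x
  have D: "D = (\<lambda>x. (b - a) \<bullet> x + (d - c))" by (auto simp: D_def ac bd inner_diff_left)
  then have Daff: "affine_function D" by (auto simp: affine_function_def)
  note cont [continuous_intros] = affine_function_cont[OF V] affine_function_cont[OF conjunct1[OF W]] affine_function_cont[OF Daff]
  have "interior_integral \<Lambda> (\<lambda>x. W x * D x) = interior_integral \<Lambda> (\<lambda>x. V x * D x)"
    using W Daff * V VE boundary_integral_affine by fastforce
  moreover have "interior_integral \<Lambda> (\<lambda>x. W x * D x) = interior_integral \<Lambda> (\<lambda>x. V x * D x) + interior_integral \<Lambda> (\<lambda>x. D x * D x)"
    by (subst interior_integral_add[symmetric]) (auto intro!: continuous_intros arg_cong[of _ _ "interior_integral \<Lambda>"] simp: D_def algebra_simps)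
  ultimately have "interior_integral \<Lambda> (\<lambda>x. D x * D x) = 0" by simp
  then have "D x * D x = 0" if "x \<in> interior P" for x
    by (rule interior_integral_zero_imp[rotated 2]) (use that in \<open>auto intro!: continuous_intros\<close>)
  then have D0: "D x = 0" if "x \<in> interior P" for x using that by simp
  obtain r where r: "r > 0" "ball 0 r \<subseteq> interior P"
    using zero_interior by (meson open_contains_ball open_interior)
  have dc: "d - c = 0" using D0[OF zero_interior] by (simp add: D)
  have "b - a = 0"
  proof (rule ccontr)
    assume ne: "b - a \<noteq> 0"
    let ?x = "(r / 2 / norm (b - a)) *\<^sub>R (b - a)"
    have "?x \<in> ball 0 r" using r ne by simp
    then have "D ?x = 0" using D0 r by blast
    then show False using ne r dc by (simp add: D)
  qed
  with dc show "W = V" by (simp add: ac bd)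
qed

lemma J_norm_le:
  assumes f: "continuous_on UNIV f" and l: "affine_function l" and fl: "\<And>x. l x \<le> f x"
  shows "J_norm \<Lambda> f \<le> 1 / volume \<Lambda> * interior_integral \<Lambda> (\<lambda>x. f x + (- 1) * l x)"
proof -
  define J where "J \<xi> = 1 / volume \<Lambda> * interior_integral \<Lambda> (\<lambda>x. f x + \<xi> x) - (INF x\<in>P. f x + \<xi> x)" for \<xi>
  have "J \<xi> \<ge> 0" if "affine_function \<xi>" for \<xi>
  proof -
    have cont: "continuous_on UNIV (\<lambda>x. f x + \<xi> x)" by (intro continuous_intros f affine_function_cont that)
    define m where "m = (INF x\<in>P. f x + \<xi> x)"
    have "compact ((\<lambda>x. f x + \<xi> x) ` P)"
      by (intro compact_continuous_image compact_P continuous_on_subset[OF cont]) auto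
    then have bdd: "bdd_below ((\<lambda>x. f x + \<xi> x) ` P)" by (intro bounded_imp_bdd_below compact_imp_bounded)
    have "m \<le> f x + \<xi> x" if "x \<in> P" for x unfolding m_def using bdd that by (rule cINF_lower)
    then have "interior_integral \<Lambda> (\<lambda>x. m) \<le> interior_integral \<Lambda> (\<lambda>x. f x + \<xi> x)"
      using cont by (intro interior_integral_mono) auto
    then have "m * volume \<Lambda> \<le> interior_integral \<Lambda> (\<lambda>x. f x + \<xi> x)" by (simp only: interior_integral_const)
    then show ?thesis unfolding J_def m_def[symmetric] using volume_pos by (simp add: field_simps)
  qed
  then have bdd: "bdd_below (J ` Collect affine_function)" by (intro bdd_belowI2[of _ 0]) auto
  have "affine_function (\<lambda>x. (- 1) * l x)"
  proof -
    obtain a c where "l = (\<lambda>x. a \<bullet> x + c)" using l by (auto simp: affine_function_def)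
    then have "(\<lambda>x. (- 1) * l x) = (\<lambda>x. (- a) \<bullet> x + (- c))" by auto
    then show ?thesis unfolding affine_function_def by blast
  qed
  then have "(INF \<xi>\<in>Collect affine_function. J \<xi>) \<le> J (\<lambda>x. (- 1) * l x)"
    by (intro cINF_lower[OF bdd]) simp
  moreover have "(INF x\<in>P. f x + (- 1) * l x) \<ge> 0"
    using zero_P fl by (intro cINF_greatest) auto
  ultimately show ?thesis unfolding J_norm_def J_def by linarith
qed

text \<open>After normalization the convex function is nonnegative, so n + V may be replaced by an
  affine majorant \<open>U\<close>; nonnegativity of \<open>U\<close> then allows the convexity
  estimate along rays to be multiplied by it.\<close>

theorem uniformly_rel_K_polystableI:
  assumes V: "affine_function V"
    and VE: "\<And>l. affine_function l \<Longrightarrow> interior_integral \<Lambda> (\<lambda>x. V x * l x) = interior_integral \<Lambda> (\<lambda>x. l x - l 0)"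
    and U: "affine_function U" "\<And>x. x \<in> P \<Longrightarrow> 0 \<le> U x" "\<And>x. x \<in> P \<Longrightarrow> real CARD('n) + V x \<le> U x"
    and \<epsilon>: "\<epsilon> > 0" "\<And>x. x \<in> P \<Longrightarrow> U 0 + (real CARD('n) + 1) * U x \<le> (real CARD('n) + 1) * (real CARD('n) + 2) - \<epsilon>"
  shows "uniformly_rel_K_polystable \<Lambda>"
  unfolding uniformly_rel_K_polystable_def
proof (intro exI conjI ballI)
  \<comment> \<open>For the normalized function h: L_V(f) is at least \<epsilon> / ((n + 1)(n + 2))
    times the boundary integral of h, which is at least n + 1 times the volume integral of h, which
    in turn is at least the volume times the J-norm.\<close>
  let ?\<delta> = "\<epsilon> / (real CARD('n) + 2) * volume \<Lambda>"
  show "?\<delta> > 0" using \<epsilon>(1) volume_pos by simp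
  fix f :: "real^'n::_ \<Rightarrow> real" assume "f \<in> rational_PL_convex"
  then obtain S where S: "finite S" "S \<noteq> {}" "\<forall>l\<in>S. rational_affine_function l" and f: "f = (\<lambda>x. Max ((\<lambda>l. l x) ` S))"
    by (auto simp: rational_PL_convex_def)
  have "affine_function l" if "l \<in> S" for l
    using S(3) that unfolding rational_affine_function_def affine_function_def by blast
  note S = S(1,2) this
  have fge: "l x \<le> f x" if "l \<in> S" for l x using S that by (simp add: f)
  have fattain: "\<exists>l\<in>S. f x = l x" for x
  proof -
    have "f x \<in> (\<lambda>l. l x) ` S" unfolding f using S by (intro Max_in) auto
    then show ?thesis by auto
  qed
  have fcont: "continuous_on UNIV f"
  proof -
    have "continuous_on UNIV (\<lambda>x. Max ((\<lambda>l. l x) ` S))" using S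
    proof (induction S rule: finite_ne_induct)
      case (singleton l)
      then show ?case using affine_function_cont[of l] by simp
    next
      case (insert l S)
      then have "(\<lambda>x. Max ((\<lambda>l. l x) ` insert l S)) = (\<lambda>x. max (l x) (Max ((\<lambda>l. l x) ` S)))" by auto
      then show ?case using insert affine_function_cont[of l] by (auto intro!: continuous_on_max)
    qed
    then show ?thesis by (simp add: f)
  qed
  have fconv: "f (u *\<^sub>R z) \<le> u * f z + (1 - u) * f 0" if "0 \<le> u" "u \<le> 1" for u z
  proof -
    obtain l where l: "l \<in> S" "f (u *\<^sub>R z) = l (u *\<^sub>R z)" using fattain by blast
    have "l (u *\<^sub>R z) = u * l z + (1 - u) * l 0"
      by (subst affine_function_scale[OF S(3)[OF l(1)]]) (simp add: algebra_simps)
    also have "\<dots> \<le> u * f z + (1 - u) * f 0"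
      using that fge[OF l(1)] by (intro add_mono mult_left_mono) auto
    finally show ?thesis using l by simp
  qed
  \<comment> \<open>An affine piece active at the origin; subtracting it gives a function with
    minimum 0 at 0.\<close>
  obtain l where l: "l \<in> S" "f 0 = l 0" using fattain by blast
  note laff = S(3)[OF l(1)]
  define h where "h x = f x + (- 1) * l x" for x
  note [continuous_intros] = fcont affine_function_cont[OF laff] affine_function_cont[OF V] affine_function_cont[OF U(1)]
  have hcont [continuous_intros]: "continuous_on UNIV h" unfolding h_def by (intro continuous_intros)
  have h0: "h x \<ge> 0" for x using fge[OF l(1)] by (simp add: h_def)
  have hz: "h 0 = 0" by (simp add: h_def l)
  have hconv: "h (u *\<^sub>R z) \<le> u * h z" if "0 \<le> u" "u \<le> 1" for u z
    using fconv[OF that, of z] by (simp add: h_def affine_function_scale[OF laff, of u z] l algebra_simps)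
  have n1: "real (CARD('n) - 1) = real CARD('n) - 1" by (simp add: of_nat_diff)
  have n2: "u ^ (CARD('n) - 1) * u = u ^ CARD('n)" for u :: real
    by (metis One_nat_def Suc_pred power_Suc2 zero_less_card_finite)
  \<comment> \<open>The integral of u^n (U(0) + u (U(z) - U(0))) over the unit interval, as the next
    equation shows: Jacobian u^(n-1) times the factor u gained from convexity.\<close>
  define k where "k z = (U 0 + (real CARD('n) + 1) * U z) / ((real CARD('n) + 1) * (real CARD('n) + 2))" for z
  have k: "k z = U 0 / (real CARD('n) + 1) + (U z - U 0) / (real CARD('n) + 2)" for z
    by (simp add: k_def divide_simps add_pos_pos) (simp add: algebra_simps)
  have k0: "k z \<ge> 0" if "z \<in> P" for z
    unfolding k_def using U(2)[OF that] U(2)[OF zero_P] by (intro divide_nonneg_nonneg add_nonneg_nonneg mult_nonneg_nonneg) auto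
  have kc [continuous_intros]: "continuous_on UNIV k" unfolding k_def by (intro continuous_intros) (simp add: add_nonneg_eq_0_iff)
  have Uh: "interior_integral \<Lambda> (\<lambda>x. U x * h x) \<le> boundary_integral \<Lambda> (\<lambda>z. k z * h z)"
  proof (rule polar_le)
    fix z assume z: "z \<in> P"
    have U0: "0 \<le> U 0 + u * (U z - U 0)" if "0 \<le> u" "u \<le> 1" for u
      using U(2)[OF scaleR_P[OF z that]] affine_function_scale[OF U(1), of u z] by simp
    have "(\<integral>\<^sup>+u. ennreal (u ^ (CARD('n) - 1) * (U (u *\<^sub>R z) * h (u *\<^sub>R z))) * indicator {0<..1} u \<partial>lborel)
      \<le> (\<integral>\<^sup>+u. ennreal (u ^ CARD('n) * (U 0 * h z + u * ((U z - U 0) * h z))) * indicator {0<..1} u \<partial>lborel)"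
    proof (intro nn_integral_mono)
      fix u :: real
      have "u ^ (CARD('n) - 1) * (U (u *\<^sub>R z) * h (u *\<^sub>R z)) \<le> u ^ CARD('n) * (U 0 * h z + u * ((U z - U 0) * h z))" if "0 < u" "u \<le> 1"
      proof -
        have "u ^ (CARD('n) - 1) * (U (u *\<^sub>R z) * h (u *\<^sub>R z)) \<le> u ^ (CARD('n) - 1) * (U (u *\<^sub>R z) * (u * h z))"
          using that hconv[of u z] U0[of u] by (intro mult_left_mono) (auto simp: affine_function_scale[OF U(1), of u z])
        also have "\<dots> = u ^ CARD('n) * (U 0 * h z + u * ((U z - U 0) * h z))"
          unfolding n2[of u, symmetric] affine_function_scale[OF U(1), of u z] by (simp add: algebra_simps)
        finally show ?thesis .
      qed
      then show "ennreal (u ^ (CARD('n) - 1) * (U (u *\<^sub>R z) * h (u *\<^sub>R z))) * indicator {0<..1} u \<le> ennreal (u ^ CARD('n) * (U 0 * h z + u * ((U z - U 0) * h z))) * indicator {0<..1} u"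
        by (auto simp: indicator_def intro!: ennreal_leI)
    qed
    also have "\<dots> = ennreal (U 0 * h z / (real CARD('n) + 1) + (U z - U 0) * h z / (real CARD('n) + 2))"
    proof (rule nn_integral_power_affine)
      fix u :: real assume "0 \<le> u" "u \<le> 1"
      then have "0 \<le> (U 0 + u * (U z - U 0)) * h z" using U0 h0 by simp
      then show "0 \<le> U 0 * h z + u * ((U z - U 0) * h z)" by (simp add: algebra_simps)
    qed
    also have "U 0 * h z / (real CARD('n) + 1) + (U z - U 0) * h z / (real CARD('n) + 2) = k z * h z" by (simp add: k algebra_simps)
    finally show "(\<integral>\<^sup>+u. ennreal (u ^ (CARD('n) - 1) * (U (u *\<^sub>R z) * h (u *\<^sub>R z))) * indicator {0<..1} u \<partial>lborel) \<le> ennreal (k z * h z)" .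
  qed (use U(2) h0 k0 in \<open>auto intro!: continuous_intros\<close>)
  have hh: "interior_integral \<Lambda> h \<le> boundary_integral \<Lambda> (\<lambda>z. 1 / (real CARD('n) + 1) * h z)"
  proof (rule polar_le)
    fix z assume z: "z \<in> P"
    have "(\<integral>\<^sup>+u. ennreal (u ^ (CARD('n) - 1) * h (u *\<^sub>R z)) * indicator {0<..1} u \<partial>lborel)
      \<le> (\<integral>\<^sup>+u. ennreal (u ^ CARD('n) * (h z + u * 0)) * indicator {0<..1} u \<partial>lborel)"
    proof (intro nn_integral_mono)
      fix u :: real
      have "u ^ (CARD('n) - 1) * h (u *\<^sub>R z) \<le> u ^ CARD('n) * (h z + u * 0)" if "0 < u" "u \<le> 1"
        unfolding n2[of u, symmetric] using that hconv[of u z] by (simp add: mult.assoc mult_left_mono)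
      then show "ennreal (u ^ (CARD('n) - 1) * h (u *\<^sub>R z)) * indicator {0<..1} u \<le> ennreal (u ^ CARD('n) * (h z + u * 0)) * indicator {0<..1} u"
        by (auto simp: indicator_def intro!: ennreal_leI)
    qed
    also have "\<dots> = ennreal (h z / (real CARD('n) + 1) + 0 / (real CARD('n) + 2))"
      by (rule nn_integral_power_affine) (simp add: h0)
    finally show "(\<integral>\<^sup>+u. ennreal (u ^ (CARD('n) - 1) * h (u *\<^sub>R z)) * indicator {0<..1} u \<partial>lborel) \<le> ennreal (1 / (real CARD('n) + 1) * h z)" by simp
  qed (use h0 in \<open>auto intro!: continuous_intros\<close>)
  have "rel_functional \<Lambda> f = boundary_integral \<Lambda> h - interior_integral \<Lambda> (\<lambda>x. (real CARD('n) + V x) * h x)"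
  proof -
    have "boundary_integral \<Lambda> f = boundary_integral \<Lambda> h + boundary_integral \<Lambda> l"
      by (subst boundary_integral_add[symmetric]) (auto intro!: continuous_intros simp: h_def)
    moreover have "interior_integral \<Lambda> (\<lambda>x. (real CARD('n) + V x) * f x) = interior_integral \<Lambda> (\<lambda>x. (real CARD('n) + V x) * h x) + interior_integral \<Lambda> (\<lambda>x. (real CARD('n) + V x) * l x)"
      by (subst interior_integral_add[symmetric]) (auto intro!: continuous_intros simp: h_def algebra_simps)
    moreover have "interior_integral \<Lambda> (\<lambda>x. (real CARD('n) + V x) * l x) = real CARD('n) * interior_integral \<Lambda> l + interior_integral \<Lambda> (\<lambda>x. V x * l x)"
      unfolding distrib_right by (subst interior_integral_add) (auto intro!: continuous_intros simp: interior_integral_cmult)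
    moreover have "extremal_function \<Lambda> = V" by (intro extremal_function_eq V VE)
    ultimately show ?thesis
      unfolding rel_functional_def mean_scalar_eq
      by (simp add: boundary_integral_affine[OF laff] VE[OF laff])
  qed
  moreover have "interior_integral \<Lambda> (\<lambda>x. (real CARD('n) + V x) * h x) \<le> interior_integral \<Lambda> (\<lambda>x. U x * h x)"
    using U(3) h0 by (intro interior_integral_mono continuous_intros mult_right_mono) auto
  moreover have "boundary_integral \<Lambda> (\<lambda>z. k z * h z) \<le> boundary_integral \<Lambda> (\<lambda>z. (1 - \<epsilon> / ((real CARD('n) + 1) * (real CARD('n) + 2))) * h z)"
  proof (rule boundary_integral_mono)
    fix z assume "z \<in> P"
    then have "k z \<le> ((real CARD('n) + 1) * (real CARD('n) + 2) - \<epsilon>) / ((real CARD('n) + 1) * (real CARD('n) + 2))"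
      unfolding k_def using \<epsilon>(2) by (intro divide_right_mono) auto
    also have "\<dots> = 1 - \<epsilon> / ((real CARD('n) + 1) * (real CARD('n) + 2))" by (simp add: diff_divide_distrib add_nonneg_eq_0_iff)
    finally show "k z * h z \<le> (1 - \<epsilon> / ((real CARD('n) + 1) * (real CARD('n) + 2))) * h z" using h0 by (rule mult_right_mono)
  qed (auto intro!: continuous_intros)
  ultimately have "rel_functional \<Lambda> f \<ge> \<epsilon> / ((real CARD('n) + 1) * (real CARD('n) + 2)) * boundary_integral \<Lambda> h"
    using Uh by (simp only: boundary_integral_cmult) (simp add: algebra_simps)
  also have "\<epsilon> / ((real CARD('n) + 1) * (real CARD('n) + 2)) * boundary_integral \<Lambda> h = \<epsilon> / (real CARD('n) + 2) * (1 / (real CARD('n) + 1) * boundary_integral \<Lambda> h)" by simp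
  finally have 1: "\<epsilon> / (real CARD('n) + 2) * (1 / (real CARD('n) + 1) * boundary_integral \<Lambda> h) \<le> rel_functional \<Lambda> f" .
  have 0: "\<epsilon> / (real CARD('n) + 2) * interior_integral \<Lambda> h \<le> \<epsilon> / (real CARD('n) + 2) * (1 / (real CARD('n) + 1) * boundary_integral \<Lambda> h)"
    using hh \<epsilon>(1) unfolding boundary_integral_cmult by (intro mult_left_mono) auto
  from 0 1 have 2: "\<epsilon> / (real CARD('n) + 2) * interior_integral \<Lambda> h \<le> rel_functional \<Lambda> f" by (rule order_trans)
  have "J_norm \<Lambda> f \<le> 1 / volume \<Lambda> * interior_integral \<Lambda> h"
    unfolding h_def using fge[OF l(1)] by (intro J_norm_le fcont laff)
  then have "\<epsilon> / (real CARD('n) + 2) * volume \<Lambda> * J_norm \<Lambda> f \<le> \<epsilon> / (real CARD('n) + 2) * volume \<Lambda> * (1 / volume \<Lambda> * interior_integral \<Lambda> h)"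
    using \<epsilon>(1) volume_pos by (intro mult_left_mono) auto
  also have "\<dots> = \<epsilon> / (real CARD('n) + 2) * interior_integral \<Lambda> h" using volume_pos by simp
  finally show "?\<delta> * J_norm \<Lambda> f \<le> rel_functional \<Lambda> f" using 2 by simp
qed

end

section \<open>Certificates and their transport by lattice automorphisms\<close>

definition polystability_certificate :: "(int^'n) set \<Rightarrow> bool" where
  "polystability_certificate \<Lambda> \<longleftrightarrow> (\<exists>V U \<epsilon>. affine_function V \<and> affine_function U \<and> \<epsilon> > 0 \<and>
     (\<forall>l. affine_function l \<longrightarrow> interior_integral \<Lambda> (\<lambda>x. V x * l x) = interior_integral \<Lambda> (\<lambda>x. l x - l 0)) \<and>
     (\<forall>x\<in>anticanonical_polytope \<Lambda>. 0 \<le> U x \<and> real CARD('n) + V x \<le> U x \<and>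
        U 0 + (real CARD('n) + 1) * U x \<le> (real CARD('n) + 1) * (real CARD('n) + 2) - \<epsilon>))"

lemma toric_Fano_nonzero:
  assumes "toric_Fano \<Lambda>" shows "0 \<notin> \<Lambda>"
proof
  assume "0 \<in> \<Lambda>"
  then have "primitive_vec (0 :: int^'a)" using assms by (auto simp: toric_Fano_def)
  then have "\<bar>0 :: int\<bar> = 1" unfolding primitive_vec_def by (metis vector_smult_lzero)
  then show False by simp
qed

lemma certificate_imp_polystable:
  fixes \<Lambda> :: "(int^'n::{finite,wellorder}) set"
  assumes "toric_Fano \<Lambda>" "polystability_certificate \<Lambda>"
  shows "uniformly_rel_K_polystable \<Lambda>"
proof -
  interpret lattice_polytope \<Lambda>
    using assms(1) toric_Fano_nonzero by unfold_locales (auto simp: toric_Fano_def)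
  obtain V U \<epsilon> where *: "affine_function V" "affine_function U" "\<epsilon> > 0"
     "\<forall>l. affine_function l \<longrightarrow> interior_integral \<Lambda> (\<lambda>x. V x * l x) = interior_integral \<Lambda> (\<lambda>x. l x - l 0)"
     "\<forall>x\<in>anticanonical_polytope \<Lambda>. 0 \<le> U x \<and> real CARD('n) + V x \<le> U x \<and>
        U 0 + (real CARD('n) + 1) * U x \<le> (real CARD('n) + 1) * (real CARD('n) + 2) - \<epsilon>"
    using assms(2) unfolding polystability_certificate_def by blast
  show ?thesis
    by (rule uniformly_rel_K_polystableI[OF *(1) _ *(2) _ _ *(3)]) (use *(4,5) in auto)
qed

definition real_matrix :: "int^'n^'m \<Rightarrow> real^'n^'m" where
  "real_matrix A = (\<chi> i j. of_int (A $ i $ j))"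

lemma det_real_matrix: "det (real_matrix A) = of_int (det A)"
  by (simp add: det_def real_matrix_def)

lemma abs_det_invertible_int:
  fixes A :: "int^'n^'n"
  assumes "invertible A" shows "\<bar>det A\<bar> = 1"
proof -
  obtain B where "A ** B = mat 1" using assms by (auto simp: invertible_def)
  then have "det A * det B = 1" by (metis det_mul det_I)
  then show ?thesis using zmult_eq_1_iff by force
qed

lemma vec_of_int_matrix_mult: "vec_of_int (A *v a) = real_matrix A *v vec_of_int a"
  by (simp add: vec_of_int_def real_matrix_def matrix_vector_mult_def vec_eq_iff)

lemma affine_function_compose_linear:
  fixes f :: "'a::euclidean_space \<Rightarrow> 'b::euclidean_space"
  assumes l: "affine_function l" and f: "linear f"
  shows "affine_function (\<lambda>x. l (f x))"
proof -
  obtain a c where "l = (\<lambda>x. a \<bullet> x + c)" using l by (auto simp: affine_function_def)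
  then have "(\<lambda>x. l (f x)) = (\<lambda>x. adjoint f a \<bullet> x + c)"
    using adjoint_works[OF f] by (simp add: inner_commute)
  then show ?thesis unfolding affine_function_def by blast
qed

text \<open>The transpose of \<open>A\<close> carries the polytope of the image fan onto that of
  \<Lambda> and, its determinant being 1 or -1, preserves Lebesgue measure. A certificate is phrased
  with volume integrals only, so the boundary measure never has to be transported.\<close>

lemma certificate_image:
  fixes A :: "int^'n::{finite,wellorder}^'n::_"
  assumes A: "invertible A" and cert: "polystability_certificate \<Lambda>"
  shows "polystability_certificate ((\<lambda>a. A *v a) ` \<Lambda>)"
proof -
  let ?\<Lambda>' = "(\<lambda>a. A *v a) ` \<Lambda>"
  define f where "f x = transpose (real_matrix A) *v x" for x :: "real^'n::_"
  have lf: "linear f" unfolding f_def by (rule matrix_vector_mul_linear)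
  have mf: "matrix f = transpose (real_matrix A)" unfolding f_def[abs_def] by (rule matrix_of_matrix_vector_mul)
  have det: "\<bar>det (matrix f)\<bar> = 1"
    unfolding mf det_transpose det_real_matrix using abs_det_invertible_int[OF A]
    by (metis of_int_1 of_int_abs)
  have f_borel [measurable]: "f \<in> borel_measurable borel"
    using lf by (intro borel_measurable_continuous_onI linear_continuous_on linear_conv_bounded_linear[THEN iffD1])
  have "det (matrix f) \<noteq> 0" using det by auto
  then have "inj f" using lf det_nz_iff_inj by blast
  then obtain g where g: "linear g" "\<And>x. g (f x) = x" "\<And>x. f (g x) = x"
    using linear_injective_isomorphism[OF lf] by blast
  have P: "x \<in> anticanonical_polytope ?\<Lambda>' \<longleftrightarrow> f x \<in> anticanonical_polytope \<Lambda>" for x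
  proof -
    have "vec_of_int (A *v a) \<bullet> x = vec_of_int a \<bullet> f x" for a
      unfolding vec_of_int_matrix_mult f_def
      by (metis dot_lmul_matrix inner_commute transpose_matrix_vector)
    then show ?thesis by (simp add: anticanonical_polytope_def)
  qed
  have int: "interior_integral ?\<Lambda>' (\<lambda>x. h (f x)) = interior_integral \<Lambda> h" if [measurable]: "h \<in> borel_measurable borel" for h
  proof -
    have [measurable]: "anticanonical_polytope \<Lambda> \<in> sets borel" by auto
    have "interior_integral \<Lambda> h = (\<integral>x. indicator (anticanonical_polytope \<Lambda>) x *\<^sub>R h x \<partial>distr lborel borel f)"
      by (simp add: interior_integral_def set_lebesgue_integral_def distr_lborel_linear[OF lf det])
    also have "\<dots> = (\<integral>x. indicator (anticanonical_polytope \<Lambda>) (f x) *\<^sub>R h (f x) \<partial>lborel)"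
      by (rule integral_distr) auto
    also have "\<dots> = interior_integral ?\<Lambda>' (\<lambda>x. h (f x))"
      unfolding interior_integral_def set_lebesgue_integral_def by (intro Bochner_Integration.integral_cong) (auto simp: P indicator_def)
    finally show ?thesis by simp
  qed
  obtain V U \<epsilon> where *: "affine_function V" "affine_function U" "\<epsilon> > 0"
     "\<forall>l. affine_function l \<longrightarrow> interior_integral \<Lambda> (\<lambda>x. V x * l x) = interior_integral \<Lambda> (\<lambda>x. l x - l 0)"
     "\<forall>x\<in>anticanonical_polytope \<Lambda>. 0 \<le> U x \<and> real CARD('n) + V x \<le> U x \<and>
        U 0 + (real CARD('n) + 1) * U x \<le> (real CARD('n) + 1) * (real CARD('n) + 2) - \<epsilon>"
    using cert unfolding polystability_certificate_def by blast
  have f0: "f 0 = 0" using lf by (rule linear_0)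
  have abor: "l \<in> borel_measurable borel" if "affine_function l" for l :: "real^'n::_ \<Rightarrow> real"
    using that by (auto simp: affine_function_def)
  show ?thesis unfolding polystability_certificate_def
  proof (intro exI conjI allI impI ballI)
    show "affine_function (\<lambda>x. V (f x))" "affine_function (\<lambda>x. U (f x))"
      using * lf by (auto intro: affine_function_compose_linear)
    fix l :: "real^'n::_ \<Rightarrow> real" assume l: "affine_function l"
    define k where "k x = l (g x)" for x
    have k: "affine_function k" unfolding k_def using l g(1) by (rule affine_function_compose_linear)
    have lk: "l = (\<lambda>x. k (f x))" by (simp add: k_def g)
    note [measurable] = abor[OF k] abor[OF *(1)]
    have "interior_integral ?\<Lambda>' (\<lambda>x. V (f x) * k (f x)) = interior_integral \<Lambda> (\<lambda>x. V x * k x)"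
      by (rule int[of "\<lambda>x. V x * k x"]) measurable
    also have "\<dots> = interior_integral \<Lambda> (\<lambda>x. k x - k 0)" using *(4) k by blast
    also have "\<dots> = interior_integral ?\<Lambda>' (\<lambda>x. k (f x) - k (f 0))"
      unfolding f0 by (rule int[of "\<lambda>x. k x - k 0", symmetric]) measurable
    finally show "interior_integral ?\<Lambda>' (\<lambda>x. V (f x) * l x) = interior_integral ?\<Lambda>' (\<lambda>x. l x - l 0)"
      unfolding lk .
  qed (use * P f0 in auto)
qed

text \<open>Both sides of the defining equation are linear in the test function, so 1 and the
  coordinate functions suffice. With U = n + V the upper bound of the criterion turns into the
  second of \<open>bounds\<close> after subtracting n (n + 2).\<close>

lemma (in lattice_polytope) affine_certificate:
  assumes V: "affine_function V" and V0: "interior_integral \<Lambda> V = 0"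
    and Vi: "\<And>i. interior_integral \<Lambda> (\<lambda>x. V x * x $ i - x $ i) = 0"
    and \<epsilon>: "\<epsilon> > 0"
    and bounds: "\<And>x. x \<in> P \<Longrightarrow> 0 \<le> real CARD('n) + V x"
      "\<And>x. x \<in> P \<Longrightarrow> V 0 + (real CARD('n) + 1) * V x \<le> real CARD('n) + 2 - \<epsilon>"
  shows "polystability_certificate \<Lambda>"
  unfolding polystability_certificate_def
proof (rule exI[of _ V], rule exI[of _ "\<lambda>x. real CARD('n) + V x"], rule exI[of _ \<epsilon>], intro conjI allI impI ballI)
  show "affine_function (\<lambda>x. real CARD('n) + V x)"
  proof -
    obtain a k where "V = (\<lambda>x. a \<bullet> x + k)" using V by (auto simp: affine_function_def)
    then have "(\<lambda>x. real CARD('n) + V x) = (\<lambda>x. a \<bullet> x + (real CARD('n) + k))" by auto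
    then show ?thesis unfolding affine_function_def by blast
  qed
  fix l :: "real^'n::_ \<Rightarrow> real" assume l: "affine_function l"
  then obtain b k where b: "l = (\<lambda>x. b \<bullet> x + k)" by (auto simp: affine_function_def)
  have C: "continuous_on UNIV (\<lambda>x. l x - l 0)" "continuous_on UNIV (\<lambda>x. k * V x)"
    by (intro continuous_on_diff continuous_on_mult continuous_on_const affine_function_cont V l)+
  have Ci: "continuous_on UNIV (\<lambda>x. b $ i * (V x * x $ i - x $ i))" for i
    by (intro continuous_on_diff continuous_on_mult continuous_on_const continuous_on_component continuous_on_id
        affine_function_cont[OF V])
  have eq: "V x * l x = (l x - l 0) + ((\<Sum>i\<in>UNIV. b $ i * (V x * x $ i - x $ i)) + k * V x)" for x
  proof -
    have "(\<Sum>i\<in>UNIV. b $ i * (V x * x $ i - x $ i)) = V x * (b \<bullet> x) - b \<bullet> x"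
      by (simp add: inner_vec_def right_diff_distrib sum_subtractf sum_distrib_left mult.left_commute)
    then show ?thesis by (simp add: b algebra_simps)
  qed
  have "interior_integral \<Lambda> (\<lambda>x. \<Sum>i\<in>UNIV. b $ i * (V x * x $ i - x $ i)) =
      (\<Sum>i\<in>UNIV. interior_integral \<Lambda> (\<lambda>x. b $ i * (V x * x $ i - x $ i)))"
    unfolding interior_integral_def set_lebesgue_integral_def scaleR_sum_right
    by (rule Bochner_Integration.integral_sum) (intro interior_integrable[unfolded set_integrable_def] Ci)
  also have "\<dots> = 0" by (simp only: interior_integral_cmult Vi) simp
  finally have S: "interior_integral \<Lambda> (\<lambda>x. \<Sum>i\<in>UNIV. b $ i * (V x * x $ i - x $ i)) = 0" .
  have Cs: "continuous_on UNIV (\<lambda>x. \<Sum>i\<in>UNIV. b $ i * (V x * x $ i - x $ i))" by (intro continuous_on_sum Ci)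
  show "interior_integral \<Lambda> (\<lambda>x. V x * l x) = interior_integral \<Lambda> (\<lambda>x. l x - l 0)"
    unfolding eq interior_integral_add[OF C(1) continuous_on_add[OF Cs C(2)]] interior_integral_add[OF Cs C(2)]
    by (simp add: S interior_integral_cmult V0)
qed (use V \<epsilon> bounds in \<open>auto simp: algebra_simps\<close>)

section \<open>Iterated integrals in two and three coordinates\<close>

lemma vector3_eq: "(vector [x, y, z] :: real^3) = x *\<^sub>R axis 1 1 + y *\<^sub>R axis 2 1 + z *\<^sub>R axis 3 1"
  by (simp add: vec_eq_iff forall_3 axis_def)

lemma vector2_eq: "(vector [x, y] :: real^2) = x *\<^sub>R axis 1 1 + y *\<^sub>R axis 2 1"
  by (simp add: vec_eq_iff forall_2 axis_def)

lemma continuous_on_vector3 [continuous_intros]: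
  assumes "continuous_on S f" "continuous_on S g" "continuous_on S h"
  shows "continuous_on S (\<lambda>p. vector [f p, g p, h p] :: real^3)"
  unfolding vector3_eq by (intro continuous_intros assms)

lemma continuous_on_vector2 [continuous_intros]:
  assumes "continuous_on S f" "continuous_on S g"
  shows "continuous_on S (\<lambda>p. vector [f p, g p] :: real^2)"
  unfolding vector2_eq by (intro continuous_intros assms)

lemma emeasure_lborel_Times:
  fixes A :: "'a::euclidean_space set" and B :: "'b::euclidean_space set"
  assumes "A \<in> sets borel" "B \<in> sets borel"
  shows "emeasure lborel (A \<times> B) = emeasure lborel A * emeasure lborel B"
  unfolding lborel_prod[symmetric] using assms by (simp add: lborel.emeasure_pair_measure_Times)

lemma prod_Basis_cart:
  fixes f :: "real^'n \<Rightarrow> 'b::comm_monoid_mult"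
  shows "(\<Prod>b\<in>Basis. f b) = (\<Prod>i\<in>UNIV. f (axis i 1))"
proof -
  have "(Basis :: (real^'n) set) = range (\<lambda>i. axis i 1)" by (auto simp: Basis_vec_def)
  moreover have "inj (\<lambda>i :: 'n. axis i (1::real))" by (simp add: inj_on_def axis_eq_axis)
  ultimately show ?thesis by (metis (no_types, lifting) prod.reindex_cong)
qed

lemma distr_vector3: "distr (lborel :: (real \<times> real \<times> real) measure) borel (\<lambda>p. vector [fst p, fst (snd p), snd (snd p)] :: real^3) = lborel"
proof (rule lborel_eqI[symmetric])
  let ?\<phi> = "\<lambda>p :: real \<times> real \<times> real. vector [fst p, fst (snd p), snd (snd p)] :: real^3"
  have m: "?\<phi> \<in> borel_measurable borel"
    by (intro borel_measurable_continuous_onI continuous_intros)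
  show "sets (distr lborel borel ?\<phi>) = sets borel" by simp
  fix l u :: "real^3" assume le: "\<And>b. b \<in> Basis \<Longrightarrow> l \<bullet> b \<le> u \<bullet> b"
  have ax: "l $ i \<le> u $ i" for i using le[of "axis i 1"] by (simp add: axis_in_Basis_iff inner_axis)
  have "?\<phi> -` box l u = {l$1<..<u$1} \<times> {l$2<..<u$2} \<times> {l$3<..<u$3}"
    by (auto simp: mem_box_cart forall_3)
  then have "emeasure (distr lborel borel ?\<phi>) (box l u) = emeasure lborel ({l$1<..<u$1} \<times> {l$2<..<u$2} \<times> {l$3<..<u$3})"
    using m by (simp add: emeasure_distr)
  also have "\<dots> = emeasure lborel {l$1<..<u$1} * (emeasure lborel {l$2<..<u$2} * emeasure lborel {l$3<..<u$3})"
    by (simp add: emeasure_lborel_Times borel_Times)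
  also have "\<dots> = ennreal ((u$1 - l$1) * ((u$2 - l$2) * (u$3 - l$3)))"
    using ax by (simp add: ennreal_mult)
  also have "(u$1 - l$1) * ((u$2 - l$2) * (u$3 - l$3)) = (\<Prod>b\<in>Basis. (u - l) \<bullet> b)"
    unfolding prod_Basis_cart inner_axis UNIV_3 by simp
  finally show "emeasure (distr lborel borel ?\<phi>) (box l u) = (\<Prod>b\<in>Basis. (u - l) \<bullet> b)" .
qed

lemma distr_vector2: "distr (lborel :: (real \<times> real) measure) borel (\<lambda>p. vector [fst p, snd p] :: real^2) = lborel"
proof (rule lborel_eqI[symmetric])
  let ?\<phi> = "\<lambda>p :: real \<times> real. vector [fst p, snd p] :: real^2"
  have m: "?\<phi> \<in> borel_measurable borel"
    by (intro borel_measurable_continuous_onI continuous_intros)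
  show "sets (distr lborel borel ?\<phi>) = sets borel" by simp
  fix l u :: "real^2" assume le: "\<And>b. b \<in> Basis \<Longrightarrow> l \<bullet> b \<le> u \<bullet> b"
  have ax: "l $ i \<le> u $ i" for i using le[of "axis i 1"] by (simp add: axis_in_Basis_iff inner_axis)
  have "?\<phi> -` box l u = {l$1<..<u$1} \<times> {l$2<..<u$2}"
    by (auto simp: mem_box_cart forall_2)
  then have "emeasure (distr lborel borel ?\<phi>) (box l u) = emeasure lborel ({l$1<..<u$1} \<times> {l$2<..<u$2})"
    using m by (simp add: emeasure_distr)
  also have "\<dots> = emeasure lborel {l$1<..<u$1} * emeasure lborel {l$2<..<u$2}"
    by (simp add: emeasure_lborel_Times)
  also have "\<dots> = ennreal ((u$1 - l$1) * (u$2 - l$2))"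
    using ax by (simp add: ennreal_mult)
  also have "(u$1 - l$1) * (u$2 - l$2) = (\<Prod>b\<in>Basis. (u - l) \<bullet> b)"
    unfolding prod_Basis_cart inner_axis UNIV_2 by simp
  finally show "emeasure (distr lborel borel ?\<phi>) (box l u) = (\<Prod>b\<in>Basis. (u - l) \<bullet> b)" .
qed

lemma integral_indicator_FTC:
  fixes f :: "real \<Rightarrow> real"
  assumes "a \<le> b" "continuous_on UNIV f" "\<And>x. (F has_real_derivative f x) (at x)"
  shows "(\<integral>x. indicator {a..b} x * f x \<partial>lborel) = F b - F a"
proof -
  have "(\<integral>x. indicator {a..b} x *\<^sub>R f x \<partial>lborel) = F b - F a"
    by (rule integral_FTC_Icc)
      (use assms in \<open>auto intro: continuous_on_subset simp: has_real_derivative_iff_has_vector_derivative[symmetric] intro: DERIV_subset\<close>)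
  then show ?thesis by simp
qed

text \<open>Fubini, then the fundamental theorem of calculus in each variable. The antiderivatives
  are supplied and merely differentiated; their derivatives are prescribed on the whole line,
  outside the cell as well, which suits polynomials.\<close>

lemma integral_cell3:
  fixes g :: "real^3 \<Rightarrow> real"
  assumes K: "compact K" and K_iff: "\<And>x y z. vector [x, y, z] \<in> K \<longleftrightarrow>
      a \<le> x \<and> x \<le> b \<and> l1 x \<le> y \<and> y \<le> h1 x \<and> l2 x y \<le> z \<and> z \<le> h2 x y"
    and g: "continuous_on UNIV g"
    and Fz: "\<And>x y z. ((\<lambda>z. Fz x y z) has_real_derivative g (vector [x, y, z])) (at z)"
    and le2: "\<And>x y. a \<le> x \<Longrightarrow> x \<le> b \<Longrightarrow> l1 x \<le> y \<Longrightarrow> y \<le> h1 x \<Longrightarrow> l2 x y \<le> h2 x y"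
    and G: "\<And>x. continuous_on UNIV (\<lambda>y. Fz x y (h2 x y) - Fz x y (l2 x y))"
    and Fy: "\<And>x y. ((\<lambda>y. Fy x y) has_real_derivative Fz x y (h2 x y) - Fz x y (l2 x y)) (at y)"
    and le1: "\<And>x. a \<le> x \<Longrightarrow> x \<le> b \<Longrightarrow> l1 x \<le> h1 x"
    and H: "continuous_on UNIV (\<lambda>x. Fy x (h1 x) - Fy x (l1 x))"
    and Fx: "\<And>x. (Fx has_real_derivative Fy x (h1 x) - Fy x (l1 x)) (at x)"
    and le: "a \<le> b"
  shows "(LINT v:K|lborel. g v) = Fx b - Fx a"
proof -
  let ?k = "\<lambda>v. indicator K v *\<^sub>R g v"
  have [measurable]: "K \<in> sets borel" using K by (auto intro: borel_closed compact_imp_closed)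
  have [measurable]: "g \<in> borel_measurable borel" using g by (rule borel_measurable_continuous_onI)
  have m [measurable]: "(\<lambda>p :: real \<times> real \<times> real. vector [fst p, fst (snd p), snd (snd p)] :: real^3) \<in> borel_measurable borel"
    by (intro borel_measurable_continuous_onI continuous_intros)
  let ?h = "\<lambda>p :: real \<times> real \<times> real. ?k (vector [fst p, fst (snd p), snd (snd p)])"
  have "integrable (lborel :: (real^3) measure) ?k"
    using K g by (intro borel_integrable_compact) (auto intro: continuous_on_subset)
  then have "integrable (distr (lborel :: (real \<times> real \<times> real) measure) borel (\<lambda>p. vector [fst p, fst (snd p), snd (snd p)] :: real^3)) ?k"
    by (simp only: distr_vector3)
  then have int: "integrable (lborel \<Otimes>\<^sub>M lborel) ?h"
    by (subst (asm) integrable_distr_eq) (auto simp: lborel_prod)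
  have "(LINT v:K|lborel. g v) = (\<integral>v. ?k v \<partial>distr (lborel :: (real \<times> real \<times> real) measure) borel (\<lambda>p. vector [fst p, fst (snd p), snd (snd p)]))"
    by (simp add: distr_vector3 set_lebesgue_integral_def)
  also have "\<dots> = (\<integral>p. ?h p \<partial>(lborel \<Otimes>\<^sub>M lborel))"
    unfolding lborel_prod by (rule integral_distr) auto
  also have "\<dots> = (\<integral>x. \<integral>q. ?h (x, q) \<partial>lborel \<partial>lborel)"
    by (rule lborel_pair.integral_fst'[OF int, symmetric])
  also have "\<dots> = (\<integral>x. indicator {a..b} x * (Fy x (h1 x) - Fy x (l1 x)) \<partial>lborel)"
  \<comment> \<open>The sections over x are known to be integrable for almost every x only.\<close>
  proof (rule integral_cong_AE)
    show "AE x in lborel. (\<integral>q. ?h (x, q) \<partial>lborel) = indicator {a..b} x * (Fy x (h1 x) - Fy x (l1 x))"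
      using lborel_pair.AE_integrable_fst'[OF int]
    proof eventually_elim
      case (elim x)
      have "(\<integral>q. ?h (x, q) \<partial>lborel) = (\<integral>q. ?h (x, q) \<partial>(lborel \<Otimes>\<^sub>M lborel))" by (simp add: lborel_prod)
      also have "\<dots> = (\<integral>y. \<integral>z. ?h (x, (y, z)) \<partial>lborel \<partial>lborel)"
        using elim by (intro lborel_pair.integral_fst'[symmetric]) (simp add: lborel_prod)
      also have "\<dots> = (\<integral>y. indicator {a..b} x * (indicator {l1 x..h1 x} y * (Fz x y (h2 x y) - Fz x y (l2 x y))) \<partial>lborel)"
      proof (rule Bochner_Integration.integral_cong[OF refl])
        fix y
        have "(\<integral>z. ?h (x, (y, z)) \<partial>lborel) = (\<integral>z. (indicator {a..b} x * indicator {l1 x..h1 x} y) * (indicator {l2 x y..h2 x y} z * g (vector [x, y, z])) \<partial>lborel)"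
          by (rule Bochner_Integration.integral_cong[OF refl]) (auto simp: indicator_def K_iff)
        also have "\<dots> = (indicator {a..b} x * indicator {l1 x..h1 x} y) * (\<integral>z. indicator {l2 x y..h2 x y} z * g (vector [x, y, z]) \<partial>lborel)"
          by simp
        also have "\<dots> = indicator {a..b} x * (indicator {l1 x..h1 x} y * (Fz x y (h2 x y) - Fz x y (l2 x y)))"
        proof (cases "a \<le> x \<and> x \<le> b \<and> l1 x \<le> y \<and> y \<le> h1 x")
          case True
          have "(\<integral>z. indicator {l2 x y..h2 x y} z * g (vector [x, y, z]) \<partial>lborel) = Fz x y (h2 x y) - Fz x y (l2 x y)"
            using le2 True by (intro integral_indicator_FTC Fz)
              (auto intro!: continuous_on_compose2[OF g] continuous_intros)
          then show ?thesis by simp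
        qed (auto simp: indicator_def)
        finally show "(\<integral>z. ?h (x, (y, z)) \<partial>lborel) = indicator {a..b} x * (indicator {l1 x..h1 x} y * (Fz x y (h2 x y) - Fz x y (l2 x y)))" .
      qed
      also have "\<dots> = indicator {a..b} x * (\<integral>y. indicator {l1 x..h1 x} y * (Fz x y (h2 x y) - Fz x y (l2 x y)) \<partial>lborel)" by simp
      also have "\<dots> = indicator {a..b} x * (Fy x (h1 x) - Fy x (l1 x))"
      proof (cases "a \<le> x \<and> x \<le> b")
        case True
        then show ?thesis using le1 integral_indicator_FTC[OF _ G Fy, of "l1 x" "h1 x" x] by simp
      qed (auto simp: indicator_def)
      finally show ?case .
    qed
    show "(\<lambda>x. \<integral>q. ?h (x, q) \<partial>lborel) \<in> borel_measurable lborel"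
      using lborel_pair.integrable_fst'[OF int] by simp
    show "(\<lambda>x. indicator {a..b} x * (Fy x (h1 x) - Fy x (l1 x))) \<in> borel_measurable lborel"
      using borel_measurable_continuous_onI[OF H] by simp
  qed
  also have "\<dots> = Fx b - Fx a"
    by (rule integral_indicator_FTC[OF le H Fx])
  finally show ?thesis .
qed

lemma integral_cell2:
  fixes g :: "real^2 \<Rightarrow> real"
  assumes K: "compact K" and K_iff: "\<And>x y. vector [x, y] \<in> K \<longleftrightarrow> a \<le> x \<and> x \<le> b \<and> l1 x \<le> y \<and> y \<le> h1 x"
    and g: "continuous_on UNIV g"
    and Fy: "\<And>x y. ((\<lambda>y. Fy x y) has_real_derivative g (vector [x, y])) (at y)"
    and le1: "\<And>x. a \<le> x \<Longrightarrow> x \<le> b \<Longrightarrow> l1 x \<le> h1 x"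
    and H: "continuous_on UNIV (\<lambda>x. Fy x (h1 x) - Fy x (l1 x))"
    and Fx: "\<And>x. (Fx has_real_derivative Fy x (h1 x) - Fy x (l1 x)) (at x)"
    and le: "a \<le> b"
  shows "(LINT v:K|lborel. g v) = Fx b - Fx a"
proof -
  let ?k = "\<lambda>v. indicator K v *\<^sub>R g v"
  have [measurable]: "K \<in> sets borel" using K by (auto intro: borel_closed compact_imp_closed)
  have [measurable]: "g \<in> borel_measurable borel" using g by (rule borel_measurable_continuous_onI)
  have m [measurable]: "(\<lambda>p :: real \<times> real. vector [fst p, snd p] :: real^2) \<in> borel_measurable borel"
    by (intro borel_measurable_continuous_onI continuous_intros)
  let ?h = "\<lambda>p :: real \<times> real. ?k (vector [fst p, snd p])"
  have "integrable (lborel :: (real^2) measure) ?k"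
    using K g by (intro borel_integrable_compact) (auto intro: continuous_on_subset)
  then have "integrable (distr (lborel :: (real \<times> real) measure) borel (\<lambda>p. vector [fst p, snd p] :: real^2)) ?k"
    by (simp only: distr_vector2)
  then have int: "integrable (lborel \<Otimes>\<^sub>M lborel) ?h"
    by (subst (asm) integrable_distr_eq) (auto simp: lborel_prod)
  have "(LINT v:K|lborel. g v) = (\<integral>v. ?k v \<partial>distr (lborel :: (real \<times> real) measure) borel (\<lambda>p. vector [fst p, snd p]))"
    by (simp add: distr_vector2 set_lebesgue_integral_def)
  also have "\<dots> = (\<integral>p. ?h p \<partial>(lborel \<Otimes>\<^sub>M lborel))"
    unfolding lborel_prod by (rule integral_distr) auto
  also have "\<dots> = (\<integral>x. \<integral>y. ?h (x, y) \<partial>lborel \<partial>lborel)"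
    by (rule lborel_pair.integral_fst'[OF int, symmetric])
  also have "\<dots> = (\<integral>x. indicator {a..b} x * (Fy x (h1 x) - Fy x (l1 x)) \<partial>lborel)"
  proof (rule Bochner_Integration.integral_cong[OF refl])
    fix x
    have "(\<integral>y. ?h (x, y) \<partial>lborel) = (\<integral>y. indicator {a..b} x * (indicator {l1 x..h1 x} y * g (vector [x, y])) \<partial>lborel)"
      by (rule Bochner_Integration.integral_cong[OF refl]) (auto simp: indicator_def K_iff)
    also have "\<dots> = indicator {a..b} x * (\<integral>y. indicator {l1 x..h1 x} y * g (vector [x, y]) \<partial>lborel)"
      by simp
    also have "\<dots> = indicator {a..b} x * (Fy x (h1 x) - Fy x (l1 x))"
    proof (cases "a \<le> x \<and> x \<le> b")
      case True
      have "(\<integral>y. indicator {l1 x..h1 x} y * g (vector [x, y]) \<partial>lborel) = Fy x (h1 x) - Fy x (l1 x)"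
        using le1 True by (intro integral_indicator_FTC Fy)
          (auto intro!: continuous_on_compose2[OF g] continuous_intros)
      then show ?thesis by simp
    qed (auto simp: indicator_def)
    finally show "(\<integral>y. ?h (x, y) \<partial>lborel) = indicator {a..b} x * (Fy x (h1 x) - Fy x (l1 x))" .
  qed
  also have "\<dots> = Fx b - Fx a"
    by (rule integral_indicator_FTC[OF le H Fx])
  finally show ?thesis .
qed

text \<open>The two halves meet in a hyperplane, which is a null set. This serves polytopes whose
  bounding functions change their affine expression along a coordinate hyperplane.\<close>

lemma set_integral_split_hyperplane:
  fixes g :: "real^'n \<Rightarrow> real"
  assumes K: "compact K" and g: "continuous_on UNIV g"
  shows "(LINT v:K|lborel. g v) = (LINT v:K \<inter> {v. v $ i \<le> c}|lborel. g v) + (LINT v:K \<inter> {v. v $ i \<ge> c}|lborel. g v)"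
proof -
  have cl: "closed {v :: real^'n. v $ i \<le> c}" "closed {v :: real^'n. v $ i \<ge> c}"
    by (intro closed_Collect_le continuous_intros)+
  have int: "integrable lborel (\<lambda>v. indicator (K \<inter> S) v *\<^sub>R g v)" if "closed S" for S
    using K that g by (intro borel_integrable_compact compact_Int_closed) (auto intro: continuous_on_subset)
  have "negligible {v :: real^'n. axis i 1 \<bullet> v = c}"
    by (rule negligible_hyperplane) (simp add: axis_eq_0_iff)
  then have "AE v in lebesgue. v \<notin> {v :: real^'n. axis i 1 \<bullet> v = c}"
    unfolding negligible_iff_null_sets by (rule AE_not_in)
  then have ae: "AE v :: real^'n in lborel. v $ i \<noteq> c"
    by (simp add: AE_completion_iff inner_axis' )
  have [measurable]: "K \<in> sets borel" using K by (auto intro: borel_closed compact_imp_closed)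
  have [measurable]: "g \<in> borel_measurable borel" using g by (rule borel_measurable_continuous_onI)
  have "(LINT v:K|lborel. g v) = (\<integral>v. indicator (K \<inter> {v. v $ i \<le> c}) v *\<^sub>R g v + indicator (K \<inter> {v. v $ i \<ge> c}) v *\<^sub>R g v \<partial>lborel)"
    unfolding set_lebesgue_integral_def
  proof (rule integral_cong_AE)
    show "AE v in lborel. indicator K v *\<^sub>R g v = indicator (K \<inter> {v. v $ i \<le> c}) v *\<^sub>R g v + indicator (K \<inter> {v. v $ i \<ge> c}) v *\<^sub>R g v"
      using ae by eventually_elim (auto simp: indicator_def)
  qed (use int[OF cl(1)] int[OF cl(2)] in auto)
  also have "\<dots> = (LINT v:K \<inter> {v. v $ i \<le> c}|lborel. g v) + (LINT v:K \<inter> {v. v $ i \<ge> c}|lborel. g v)"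
    unfolding set_lebesgue_integral_def by (rule Bochner_Integration.integral_add[OF int[OF cl(1)] int[OF cl(2)]])
  finally show ?thesis .
qed

section \<open>Vertices of the anticanonical polytope\<close>

definition idot :: "int^'n \<Rightarrow> int^'n \<Rightarrow> int" where
  "idot a b = (\<Sum>i\<in>UNIV. a $ i * b $ i)"

lemma idot_add_left: "idot (a + b) c = idot a c + idot b c"
  by (simp add: idot_def distrib_right sum.distrib)

lemma idot_add_right: "idot a (b + c) = idot a b + idot a c"
  by (simp add: idot_def distrib_left sum.distrib)

lemma idot_smult_left: "idot (k *s a) c = k * idot a c"
  by (simp add: idot_def sum_distrib_left mult.assoc)

lemma idot_smult_right: "idot a (k *s c) = k * idot a c"
  by (simp add: idot_def sum_distrib_left mult.left_commute)

lemma idot_zero [simp]: "idot 0 c = 0" "idot a 0 = 0"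
  by (simp_all add: idot_def)

lemma idot_sum_left: "idot (\<Sum>a\<in>T. f a) c = (\<Sum>a\<in>T. idot (f a) c)"
  by (induction T rule: infinite_finite_induct) (simp_all add: idot_add_left)

lemma idot_axis [simp]: "idot a (axis i 1) = a $ i" "idot (axis i 1) a = a $ i"
  by (simp_all add: idot_def axis_def if_distrib if_distribR cong: if_cong)

lemma inner_vec_of_int: "vec_of_int a \<bullet> vec_of_int b = of_int (idot a b)"
  by (simp add: vec_of_int_def inner_vec_def idot_def)

lemma vec_of_int_add: "vec_of_int (a + b) = vec_of_int a + vec_of_int b"
  by (simp add: vec_of_int_def vec_eq_iff)

lemma vec_of_int_smult: "vec_of_int (k *s a) = of_int k *\<^sub>R vec_of_int a"
  by (simp add: vec_of_int_def vec_eq_iff)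

lemma vec_of_int_sum: "vec_of_int (\<Sum>a\<in>T. f a) = (\<Sum>a\<in>T. vec_of_int (f a))"
  by (induction T rule: infinite_finite_induct) (simp_all add: vec_of_int_add)

lemma smult_sum_right: "k *s (\<Sum>a\<in>T. f a) = (\<Sum>a\<in>T. k *s (f a :: 'a::semiring_0^'n))"
  by (simp add: vec_eq_iff sum_distrib_left)

lemma smult_sum_left: "(\<Sum>a\<in>T. k a) *s (v :: 'a::semiring_0^'n) = (\<Sum>a\<in>T. k a *s v)"
  by (simp add: vec_eq_iff sum_distrib_right)

lemma vec_of_int_axis: "vec_of_int (axis i 1) = axis i 1"
  by (simp add: vec_of_int_def vec_eq_iff axis_def)

definition dual_basis :: "(int^'n) set \<Rightarrow> (int^'n \<Rightarrow> int^'n) \<Rightarrow> bool" where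
  "dual_basis T D \<longleftrightarrow> finite T \<and> (\<forall>a\<in>T. \<forall>b\<in>T. idot b (D a) = (if a = b then 1 else 0)) \<and>
     (\<forall>z. z = (\<Sum>a\<in>T. idot z (D a) *s a))"

lemma dual_basisD:
  assumes "dual_basis T D"
  shows dual_basis_finite: "finite T"
    and dual_basis_dual: "a \<in> T \<Longrightarrow> b \<in> T \<Longrightarrow> idot b (D a) = (if a = b then 1 else 0)"
    and dual_basis_expand: "z = (\<Sum>a\<in>T. idot z (D a) *s a)"
  using assms unfolding dual_basis_def by blast+

lemma dual_basis_imp_lattice_basis:
  assumes "dual_basis T D" shows "lattice_basis T"
  unfolding lattice_basis_def
proof (intro conjI allI impI ballI)
  show "finite T" using assms by (simp add: dual_basis_def)
  show "\<exists>c. z = (\<Sum>b\<in>T. c b *s b)" for z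
    by (rule exI[of _ "\<lambda>a. idot z (D a)"], rule dual_basis_expand[OF assms])
  fix c b assume c: "(\<Sum>b\<in>T. c b *s b) = 0" and b: "b \<in> T"
  have "0 = idot (\<Sum>b\<in>T. c b *s b) (D b)" by (simp add: c)
  also have "\<dots> = (\<Sum>a\<in>T. c a * idot a (D b))" by (simp add: idot_sum_left idot_smult_left)
  also have "\<dots> = (\<Sum>a\<in>T. if a = b then c b else 0)"
    using assms b by (intro sum.cong) (auto simp: dual_basis_def)
  also have "\<dots> = c b" using b assms by (simp add: dual_basis_def)
  finally show "c b = 0" by simp
qed

lemma vec_expand_axis: "(z :: int^'n) = (\<Sum>i\<in>UNIV. z $ i *s axis i 1)"
  by (simp add: vec_eq_iff axis_def if_distrib cong: if_cong)

text \<open>Coordinates with respect to a lattice basis are unique, hence additive, so the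
  coordinate of \<open>a\<close> is the pairing with the vector of its values on the unit
  vectors.\<close>

lemma lattice_basis_imp_dual_basis:
  assumes "lattice_basis T"
  obtains D where "dual_basis T D"
proof -
  have fin: "finite T" using assms by (simp add: lattice_basis_def)
  obtain C where C: "\<And>z. z = (\<Sum>b\<in>T. C z b *s b)"
    using assms unfolding lattice_basis_def by metis
  have uniq: "\<forall>b\<in>T. c b = C z b" if "z = (\<Sum>b\<in>T. c b *s b)" for c z
  proof -
    have "(\<Sum>b\<in>T. (c b - C z b) *s b) = (\<Sum>b\<in>T. c b *s b) - (\<Sum>b\<in>T. C z b *s b)"
      by (simp add: vector_sub_rdistrib sum_subtractf)
    also have "\<dots> = 0" by (simp only: that[symmetric] C[symmetric] diff_self)
    finally have "\<forall>b\<in>T. c b - C z b = 0" using assms unfolding lattice_basis_def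
      by (elim conjE) (drule spec[of _ "\<lambda>b. c b - C z b"], simp)
    then show ?thesis by simp
  qed
  define D where "D a = (\<chi> i. C (axis i 1) a)" for a
  have D: "idot z (D a) = C z a" if "a \<in> T" for z a
  proof -
    have "z = (\<Sum>i\<in>UNIV. z $ i *s axis i 1)" by (rule vec_expand_axis)
    also have "\<dots> = (\<Sum>i\<in>UNIV. z $ i *s (\<Sum>b\<in>T. C (axis i 1) b *s b))"
      using C by simp
    also have "\<dots> = (\<Sum>i\<in>UNIV. \<Sum>b\<in>T. (z $ i * C (axis i 1) b) *s b)"
      by (simp add: smult_sum_right vector_smult_assoc)
    also have "\<dots> = (\<Sum>b\<in>T. (\<Sum>i\<in>UNIV. z $ i * C (axis i 1) b) *s b)"
      by (subst sum.swap) (simp add: smult_sum_left)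
    finally have "(\<Sum>i\<in>UNIV. z $ i * C (axis i 1) a) = C z a"
      using uniq[of z "\<lambda>b. \<Sum>i\<in>UNIV. z $ i * C (axis i 1) b"] that by auto
    then show ?thesis by (simp add: idot_def D_def)
  qed
  have "dual_basis T D" unfolding dual_basis_def
  proof (intro conjI ballI allI)
    fix z show "z = (\<Sum>a\<in>T. idot z (D a) *s a)" using C[of z] D by (simp cong: sum.cong)
  next
    fix a b assume ab: "a \<in> T" "b \<in> T"
    have "b = (\<Sum>c\<in>T. (if c = b then 1 else 0) *s c)"
    proof -
      have "(\<Sum>c\<in>T. (if c = b then 1 else 0) *s c) = (\<Sum>c\<in>T. if c = b then b else 0)" by (intro sum.cong) auto
      then show ?thesis using ab fin by simp
    qed
    then show "idot b (D a) = (if a = b then 1 else 0)"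
      using uniq[of b "\<lambda>c. if c = b then 1 else 0"] ab by (simp add: D)
  qed (rule fin)
  then show ?thesis by (rule that)
qed

lemma dual_basis_expand_real:
  fixes y :: "real^'n"
  assumes "dual_basis T D"
  shows "y = (\<Sum>a\<in>T. (vec_of_int a \<bullet> y) *\<^sub>R vec_of_int (D a))"
proof -
  have "(\<Sum>a\<in>T. (vec_of_int a \<bullet> y) *\<^sub>R vec_of_int (D a)) $ i = y $ i" for i
  proof -
    have "vec_of_int (axis i 1) \<bullet> y = vec_of_int (\<Sum>a\<in>T. idot (axis i 1) (D a) *s a) \<bullet> y"
      by (rule arg_cong[OF dual_basis_expand[OF assms]])
    then have "y $ i = (\<Sum>a\<in>T. of_int (D a $ i) * (vec_of_int a \<bullet> y))"
      by (simp add: vec_of_int_axis vec_of_int_sum vec_of_int_smult inner_sum_left inner_axis')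
    then show ?thesis by (simp add: sum_component vec_of_int_def mult.commute)
  qed
  then show ?thesis by (simp add: vec_eq_iff)
qed

text \<open>Over the reals \<open>T\<close> becomes a vector space basis; independence is tested by
  pairing with the dual vectors.\<close>

lemma dual_basis_card:
  fixes T :: "(int^'n) set"
  assumes "dual_basis T D" shows "card T = CARD('n)"
proof -
  let ?B = "vec_of_int ` T"
  have fin: "finite T" using assms by (simp add: dual_basis_def)
  have inj: "inj_on vec_of_int T" by (auto simp: inj_on_def)
  have "independent ?B"
  proof (rule independent_if_scalars_zero)
    show "finite ?B" using fin by simp
    fix c x assume c: "(\<Sum>x\<in>?B. c x *\<^sub>R x) = 0" and x: "x \<in> ?B"
    then obtain b where b: "b \<in> T" "x = vec_of_int b" by auto
    have "0 = (\<Sum>x\<in>?B. c x *\<^sub>R x) \<bullet> vec_of_int (D b)" by (simp add: c)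
    also have "\<dots> = (\<Sum>a\<in>T. c (vec_of_int a) * of_int (idot a (D b)))"
      by (simp add: sum.reindex[OF inj] inner_sum_left inner_vec_of_int)
    also have "\<dots> = (\<Sum>a\<in>T. if a = b then c x else 0)"
      using assms b by (intro sum.cong) (auto simp: dual_basis_def)
    also have "\<dots> = c x" using b fin by simp
    finally show "c x = 0" by simp
  qed
  moreover have "span ?B = UNIV"
  proof -
    have "axis i 1 \<in> span ?B" for i :: 'n
    proof -
      have "vec_of_int (axis i 1) = vec_of_int (\<Sum>a\<in>T. idot (axis i 1) (D a) *s a)"
        by (rule arg_cong[OF dual_basis_expand[OF assms]])
      then have "(axis i 1 :: real^'n) = (\<Sum>a\<in>T. of_int (idot (axis i 1) (D a)) *\<^sub>R vec_of_int a)"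
        by (simp only: vec_of_int_axis vec_of_int_sum vec_of_int_smult)
      then show ?thesis by (simp only:) (intro span_sum span_scale span_base, auto)
    qed
    then have "(Basis :: (real^'n) set) \<subseteq> span ?B" by (auto simp: Basis_vec_def)
    then show ?thesis by (metis span_Basis span_mono span_span top.extremum_uniqueI)
  qed
  ultimately have "card ?B = CARD('n)"
    by (metis dim_eq_card_independent dim_span_eq_card_independent dim_UNIV DIM_cart DIM_real mult_1_right)
  then show ?thesis by (simp add: card_image inj)
qed

section \<open>Integral vertices and the edges between them\<close>

definition tight :: "(int^'n) set \<Rightarrow> int^'n \<Rightarrow> (int^'n) set" where
  "tight \<Lambda> w = {a \<in> \<Lambda>. idot a w = -1}"

text \<open>Integral form of an extreme point with the Delzant condition. By
  \<open>extreme_imp_fan_vertex\<close> every extreme point of the polytope of a toric Fano set has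
  this form, so that the combinatorics can be done over the integers.\<close>

definition fan_vertex :: "(int^'n) set \<Rightarrow> int^'n \<Rightarrow> bool" where
  "fan_vertex \<Lambda> w \<longleftrightarrow> (\<forall>a\<in>\<Lambda>. idot a w \<ge> -1) \<and> lattice_basis (tight \<Lambda> w)"

lemma vec_of_int_in_polytope: "vec_of_int w \<in> anticanonical_polytope \<Lambda> \<longleftrightarrow> (\<forall>a\<in>\<Lambda>. idot a w \<ge> -1)"
proof -
  have "vec_of_int a \<bullet> vec_of_int w + 1 \<ge> 0 \<longleftrightarrow> idot a w \<ge> -1" for a
  proof -
    have "vec_of_int a \<bullet> vec_of_int w + 1 = of_int (idot a w + 1)" by (simp add: inner_vec_of_int)
    then show ?thesis by (simp only: of_int_0_le_iff) auto
  qed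
  then show ?thesis by (simp add: anticanonical_polytope_def)
qed

lemma vec_of_int_in_facet: "vec_of_int w \<in> anticanonical_polytope \<Lambda> \<Longrightarrow> vec_of_int w \<in> facet \<Lambda> a \<longleftrightarrow> idot a w = -1"
proof -
  have "vec_of_int a \<bullet> vec_of_int w + 1 = of_int (idot a w + 1)" by (simp add: inner_vec_of_int)
  then show "vec_of_int w \<in> anticanonical_polytope \<Lambda> \<Longrightarrow> vec_of_int w \<in> facet \<Lambda> a \<longleftrightarrow> idot a w = -1"
    unfolding facet_def facet_hyperplane_def by (simp del: of_int_add) (simp add: inner_vec_of_int, linarith)
qed

lemma convex_anticanonical_polytope: "convex (anticanonical_polytope \<Lambda>)"
proof -
  have eq: "t + 1 \<ge> 0 \<longleftrightarrow> t \<ge> -1" for t :: real by auto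
  have "anticanonical_polytope \<Lambda> = (\<Inter>a\<in>\<Lambda>. {x. vec_of_int a \<bullet> x \<ge> -1})"
    unfolding anticanonical_polytope_def by (intro set_eqI) (simp add: eq)
  then show ?thesis by (auto intro!: convex_INT convex_halfspace_ge)
qed

lemma extreme_imp_fan_vertex:
  assumes "toric_Fano \<Lambda>" "v extreme_point_of anticanonical_polytope \<Lambda>"
  obtains w where "v = vec_of_int w" "fan_vertex \<Lambda> w"
proof -
  have v: "v \<in> anticanonical_polytope \<Lambda>" using assms(2) by (simp add: extreme_point_of_def)
  obtain w where w: "v = vec_of_int w" "lattice_basis {a \<in> \<Lambda>. v \<in> facet \<Lambda> a}"
    using assms by (auto simp: toric_Fano_def)
  moreover have "{a \<in> \<Lambda>. v \<in> facet \<Lambda> a} = tight \<Lambda> w"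
    using v vec_of_int_in_facet unfolding w tight_def by blast
  ultimately have "fan_vertex \<Lambda> w" using v vec_of_int_in_polytope unfolding fan_vertex_def w by auto
  with w show ?thesis using that by blast
qed

text \<open>If the point lay inside a segment of the polytope, the inequalities tight at it would be
  tight at both ends, so the difference of the ends would pair to 0 with all these
  generators.\<close>

lemma extreme_pointI_tight:
  assumes x: "x \<in> anticanonical_polytope \<Lambda>"
    and sep: "\<And>y. (\<And>a. a \<in> \<Lambda> \<Longrightarrow> vec_of_int a \<bullet> x = -1 \<Longrightarrow> vec_of_int a \<bullet> y = 0) \<Longrightarrow> y = 0"
  shows "x extreme_point_of anticanonical_polytope \<Lambda>"
  unfolding extreme_point_of_def
proof (intro conjI ballI x notI)
  fix p q assume pq: "p \<in> anticanonical_polytope \<Lambda>" "q \<in> anticanonical_polytope \<Lambda>" and xs: "x \<in> open_segment p q"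
  then obtain u where u: "p \<noteq> q" "0 < u" "u < 1" "x = (1 - u) *\<^sub>R p + u *\<^sub>R q" by (auto simp: in_segment)
  have "vec_of_int a \<bullet> (p - q) = 0" if a: "a \<in> \<Lambda>" "vec_of_int a \<bullet> x = -1" for a
  proof -
    have p1: "vec_of_int a \<bullet> p + 1 \<ge> 0" and q1: "vec_of_int a \<bullet> q + 1 \<ge> 0"
      using pq a by (auto simp: anticanonical_polytope_def)
    have "(1 - u) * (vec_of_int a \<bullet> p + 1) + u * (vec_of_int a \<bullet> q + 1) = 0"
      using a(2) by (simp add: u(4) inner_add_right algebra_simps)
    moreover have "(1 - u) * (vec_of_int a \<bullet> p + 1) \<ge> 0" "u * (vec_of_int a \<bullet> q + 1) \<ge> 0" using u p1 q1 by simp_all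
    ultimately have "(1 - u) * (vec_of_int a \<bullet> p + 1) = 0" "u * (vec_of_int a \<bullet> q + 1) = 0" by linarith+
    then show ?thesis using u by (simp add: inner_diff_right)
  qed
  then have "p - q = 0" by (rule sep)
  then show False using u by simp
qed

lemma small_step:
  fixes d :: "int^'n"
  assumes fin: "finite \<Lambda>"
  obtains \<epsilon> :: real where "\<epsilon> > 0" "\<And>b. b \<in> \<Lambda> \<Longrightarrow> \<epsilon> * \<bar>of_int (idot b d)\<bar> \<le> 1"
proof
  let ?S = "1 + (\<Sum>b\<in>\<Lambda>. \<bar>real_of_int (idot b d)\<bar>)"
  have S: "?S > 0" by (simp add: add_pos_nonneg sum_nonneg)
  then show "1 / ?S > 0" by simp
  fix b assume "b \<in> \<Lambda>"
  then have "\<bar>real_of_int (idot b d)\<bar> \<le> ?S" using fin member_le_sum[of b \<Lambda> "\<lambda>b. \<bar>real_of_int (idot b d)\<bar>"] by simp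
  then show "1 / ?S * \<bar>real_of_int (idot b d)\<bar> \<le> 1" using S by (simp add: divide_le_eq)
qed

text \<open>The cone sought belongs to a vertex at which the linear functional \<open>x\<close>
  attains its minimum on the polytope: the coefficients of \<open>x\<close> are its slopes along the
  edges, and these are nonnegative at a minimum.\<close>

lemma toric_Fano_cone_covering:
  fixes \<Lambda> :: "(int^'n) set" and x :: "int^'n"
  assumes F: "toric_Fano \<Lambda>"
  obtains w c where "fan_vertex \<Lambda> w" "\<And>a. a \<in> tight \<Lambda> w \<Longrightarrow> c a \<ge> 0" "x = (\<Sum>a\<in>tight \<Lambda> w. c a *s a)"
proof -
  let ?P = "anticanonical_polytope \<Lambda>"
  have fin: "finite \<Lambda>" and bd: "bounded ?P" using F by (auto simp: toric_Fano_def)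
  have cP: "compact ?P" using bd by (simp add: compact_eq_bounded_closed)
  have "0 \<in> ?P" by (simp add: anticanonical_polytope_def)
  then have "\<exists>p\<in>?P. \<forall>y\<in>?P. vec_of_int x \<bullet> p \<le> vec_of_int x \<bullet> y"
    by (intro continuous_attains_inf cP continuous_intros) auto
  then obtain p where p: "p \<in> ?P" "\<And>y. y \<in> ?P \<Longrightarrow> vec_of_int x \<bullet> p \<le> vec_of_int x \<bullet> y"
    by blast
  let ?G = "?P \<inter> {y. vec_of_int x \<bullet> y = vec_of_int x \<bullet> p}"
  have "?G face_of ?P"
    by (rule face_of_Int_supporting_hyperplane_ge[OF convex_anticanonical_polytope]) (use p in auto)
  moreover have "compact ?G" using cP by (intro compact_Int_closed closed_hyperplane)
  moreover have "convex ?G" by (intro convex_Int convex_anticanonical_polytope convex_hyperplane)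
  moreover have "?G \<noteq> {}" using p by auto
  \<comment> \<open>The minimum may be attained on a larger face; an extreme point of that face is
    an extreme point of P.\<close>
  ultimately obtain v where "v extreme_point_of ?G" "?G face_of ?P" using extreme_point_exists_convex by metis
  then have v: "v extreme_point_of ?P" "v \<in> ?G" using extreme_point_of_face by blast+
  obtain w where w: "v = vec_of_int w" "fan_vertex \<Lambda> w" by (rule extreme_imp_fan_vertex[OF F v(1)])
  obtain D where D: "dual_basis (tight \<Lambda> w) D"
    using w(2) lattice_basis_imp_dual_basis unfolding fan_vertex_def by metis
  show ?thesis
  proof (rule that[OF w(2), of "\<lambda>a. idot x (D a)"])
    show "x = (\<Sum>a\<in>tight \<Lambda> w. idot x (D a) *s a)" by (rule dual_basis_expand[OF D])
    fix a assume a: "a \<in> tight \<Lambda> w"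
    obtain \<epsilon> :: real where \<epsilon>: "\<epsilon> > 0" "\<And>b. b \<in> \<Lambda> \<Longrightarrow> \<epsilon> * \<bar>of_int (idot b (D a))\<bar> \<le> 1"
      using small_step[OF fin] by metis
    \<comment> \<open>The step size is small enough that no inequality that is strict at
      \<open>v\<close> gets violated.\<close>
    have "v + \<epsilon> *\<^sub>R vec_of_int (D a) \<in> ?P"
      unfolding anticanonical_polytope_def
    proof (intro CollectI ballI)
      fix b assume b: "b \<in> \<Lambda>"
      have eq: "vec_of_int b \<bullet> (v + \<epsilon> *\<^sub>R vec_of_int (D a)) + 1 = of_int (idot b w) + \<epsilon> * of_int (idot b (D a)) + 1"
        by (simp add: w inner_add_right inner_vec_of_int)
      show "0 \<le> vec_of_int b \<bullet> (v + \<epsilon> *\<^sub>R vec_of_int (D a)) + 1"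
      proof (cases "b \<in> tight \<Lambda> w")
        case True
        then have "idot b (D a) \<ge> 0" "idot b w = -1" using D a by (auto simp: dual_basis_def tight_def)
        then show ?thesis unfolding eq using \<epsilon>(1) by simp
      next
        case False
        then have "idot b w \<ge> 0" using w(2) b unfolding fan_vertex_def tight_def by force
        then have "real_of_int (idot b w) \<ge> 0" by simp
        moreover have "\<epsilon> * of_int (idot b (D a)) \<ge> -1"
          using \<epsilon>(2)[OF b] \<epsilon>(1) by (smt (verit) abs_le_iff mult_minus_right mult_left_mono)
        ultimately show ?thesis unfolding eq by linarith
      qed
    qed
    then have "vec_of_int x \<bullet> v \<le> vec_of_int x \<bullet> (v + \<epsilon> *\<^sub>R vec_of_int (D a))" using p(2) v(2) by auto
    then have "0 \<le> \<epsilon> * of_int (idot x (D a))" by (simp add: inner_add_right inner_vec_of_int)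
    then show "idot x (D a) \<ge> 0" using \<epsilon>(1) by (simp add: zero_le_mult_iff)
  qed
qed

text \<open>Here \<open>d\<close> is the direction of the edge along which \<open>a\<close> ceases
  to be tight, \<open>n\<close> the generator of the facet that ends this edge, and
  \<open>idot n w + 1\<close> its lattice length. The value -1 of \<open>idot n d\<close> reflects
  that the tight generators at both ends are lattice bases.\<close>

definition vertex_neighbours :: "(int^'n) set \<Rightarrow> bool" where
  "vertex_neighbours \<Lambda> \<longleftrightarrow> (\<forall>w a d. fan_vertex \<Lambda> w \<longrightarrow> a \<in> tight \<Lambda> w \<longrightarrow>
     (\<forall>b\<in>tight \<Lambda> w. idot b d = (if b = a then 1 else 0)) \<longrightarrow>
     (\<exists>n\<in>\<Lambda>. idot n d = -1 \<and> fan_vertex \<Lambda> (w + (idot n w + 1) *s d) \<and>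
        tight \<Lambda> (w + (idot n w + 1) *s d) = insert n (tight \<Lambda> w - {a})))"

text \<open>The ratio test of the simplex method finds the far end of the edge. It is an extreme
  point, so by the definition of a toric Fano set it is integral and its tight generators form a
  lattice basis; this basis shares all but one element with the old one.\<close>

lemma toric_Fano_vertex_neighbours:
  fixes \<Lambda> :: "(int^'n) set"
  assumes F: "toric_Fano \<Lambda>"
  shows "vertex_neighbours \<Lambda>"
  unfolding vertex_neighbours_def
proof (intro allI impI)
  fix w a d :: "int^'n"
  assume w: "fan_vertex \<Lambda> w" and a: "a \<in> tight \<Lambda> w" and d: "\<forall>b\<in>tight \<Lambda> w. idot b d = (if b = a then 1 else 0)"
  let ?P = "anticanonical_polytope \<Lambda>" and ?T = "tight \<Lambda> w"
  have fin: "finite \<Lambda>" and bd: "bounded ?P" using F by (auto simp: toric_Fano_def)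
  obtain D where D: "dual_basis ?T D"
    using w lattice_basis_imp_dual_basis unfolding fan_vertex_def by metis
  have finT: "finite ?T" using fin by (auto simp: tight_def)
  have expand: "z = (\<Sum>b\<in>?T. idot z (D b) *s b)" for z by (rule dual_basis_expand[OF D])
  have Da: "idot z (D a) = idot z d" for z
  proof -
    have "idot z d = (\<Sum>b\<in>?T. idot z (D b) * idot b d)"
      by (subst expand[of z]) (simp only: idot_sum_left idot_smult_left)
    also have "\<dots> = (\<Sum>b\<in>?T. if b = a then idot z (D a) else 0)" using d by (intro sum.cong) auto
    also have "\<dots> = idot z (D a)" using a finT by simp
    finally show ?thesis by simp
  qed
  have ad: "idot a d = 1" using a d by auto
  have dne: "vec_of_int d \<noteq> 0" using ad by auto
  define N where "N = {n \<in> \<Lambda>. idot n d < 0}"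
  obtain n0 where "n0 \<in> \<Lambda>" "vec_of_int n0 \<bullet> vec_of_int d < 0" using bounded_polytope_neg[OF bd dne] by blast
  then have "n0 \<in> N" by (simp add: N_def inner_vec_of_int)
  then have N: "finite N" "N \<noteq> {}" using fin by (auto simp: N_def)
  \<comment> \<open>The parameter at which the edge reaches the hyperplane of \<open>n\<close>; the
    smallest such parameter ends the edge.\<close>
  define t where "t n = real_of_int (idot n w + 1) / real_of_int (- idot n d)" for n
  obtain n where n: "n \<in> N" "\<And>m. m \<in> N \<Longrightarrow> t n \<le> t m"
    using ex_is_arg_min_if_finite[OF N, of t] unfolding is_arg_min_linorder by blast
  have n1: "n \<in> \<Lambda>" "idot n d < 0" using n by (auto simp: N_def)
  have notT: "idot m w \<ge> 0" if "m \<in> N" for m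
  proof -
    have "m \<notin> ?T" using d that by (auto simp: N_def split: if_splits)
    then show ?thesis using w that unfolding fan_vertex_def tight_def N_def by force
  qed
  have tn: "t n > 0" unfolding t_def using notT[OF n(1)] n1 by (intro divide_pos_pos) auto
  define v where "v = vec_of_int w + t n *\<^sub>R vec_of_int d"
  have dot: "vec_of_int m \<bullet> v = of_int (idot m w) + t n * of_int (idot m d)" for m
    by (simp add: v_def inner_add_right inner_vec_of_int)
  have vP: "v \<in> ?P" unfolding anticanonical_polytope_def
  proof (intro CollectI ballI)
    fix m assume m: "m \<in> \<Lambda>"
    show "0 \<le> vec_of_int m \<bullet> v + 1"
    proof (cases "idot m d < 0")
      case True
      then have "t n \<le> t m" using n(2) m by (simp add: N_def)
      then have "t n * of_int (- idot m d) \<le> t m * of_int (- idot m d)" using True by (intro mult_right_mono) auto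
      also have "\<dots> = of_int (idot m w + 1)" using True by (simp add: t_def)
      finally show ?thesis by (simp add: dot)
    next
      case False
      then have "t n * of_int (idot m d) \<ge> 0" using tn by simp
      moreover have "real_of_int (idot m w) \<ge> -1" using w m unfolding fan_vertex_def by force
      ultimately show ?thesis unfolding dot by linarith
    qed
  qed
  have nv: "vec_of_int n \<bullet> v = -1"
    using n1 by (simp add: dot t_def field_simps)
  have bv: "vec_of_int b \<bullet> v = -1" if "b \<in> ?T - {a}" for b
    using that d by (simp add: dot tight_def)
  have "v extreme_point_of ?P"
  proof (rule extreme_pointI_tight[OF vP])
    fix y assume y: "\<And>m. m \<in> \<Lambda> \<Longrightarrow> vec_of_int m \<bullet> v = -1 \<Longrightarrow> vec_of_int m \<bullet> y = 0"
    have by0: "vec_of_int b \<bullet> y = 0" if "b \<in> ?T - {a}" for b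
      using y[of b] bv[OF that] that by (auto simp: tight_def)
    have zy: "vec_of_int z \<bullet> y = of_int (idot z d) * (vec_of_int a \<bullet> y)" for z
    proof -
      have "vec_of_int z \<bullet> y = (\<Sum>b\<in>?T. of_int (idot z (D b)) * (vec_of_int b \<bullet> y))"
        by (subst expand[of z]) (simp only: vec_of_int_sum vec_of_int_smult inner_sum_left inner_scaleR_left)
      also have "\<dots> = (\<Sum>b\<in>?T. if b = a then of_int (idot z (D a)) * (vec_of_int a \<bullet> y) else 0)"
        using by0 by (intro sum.cong) auto
      finally show ?thesis using a finT by (simp add: Da)
    qed
    have "vec_of_int a \<bullet> y = 0" using y[OF n1(1) nv] zy[of n] n1 by simp
    then have "axis i 1 \<bullet> y = 0" for i using zy[of "axis i 1"] by (simp add: vec_of_int_axis)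
    then show "y = 0" by (simp add: vec_eq_iff inner_axis')
  qed
  then obtain w' where w': "v = vec_of_int w'" "fan_vertex \<Lambda> w'" by (rule extreme_imp_fan_vertex[OF F])
  let ?T' = "tight \<Lambda> w'"
  have mem': "m \<in> ?T' \<longleftrightarrow> m \<in> \<Lambda> \<and> vec_of_int m \<bullet> v = -1" for m
  proof -
    have "vec_of_int m \<bullet> v = of_int (idot m w')" by (simp add: w' inner_vec_of_int)
    then show ?thesis unfolding tight_def by (simp, linarith)
  qed
  have "b \<in> \<Lambda>" if "b \<in> ?T" for b using that by (simp add: tight_def)
  then have sub: "insert n (?T - {a}) \<subseteq> ?T'" using nv bv n1(1) unfolding subset_iff mem' by blast
  have finT': "finite ?T'" using fin by (auto simp: tight_def)
  have ind': "\<And>c. (\<Sum>b\<in>?T'. c b *s b) = 0 \<Longrightarrow> \<forall>b\<in>?T'. c b = 0"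
    using w'(2) unfolding fan_vertex_def lattice_basis_def by blast
  have nT: "n \<notin> ?T" using d n1 by (auto split: if_splits)
  have "?T' \<subseteq> insert n (?T - {a})"
  proof
    fix m assume m: "m \<in> ?T'"
    show "m \<in> insert n (?T - {a})"
    proof (rule ccontr)
      assume nm: "m \<notin> insert n (?T - {a})"
      have z: "z = idot z d *s a + (\<Sum>b\<in>?T - {a}. idot z (D b) *s b)" for z
        by (subst expand[of z], subst sum.remove[OF finT a]) (simp add: Da)
      \<comment> \<open>Eliminating \<open>a\<close> between the expansions of \<open>m\<close> and
        \<open>n\<close> gives a linear relation among the generators tight at the new vertex. Its
        coefficient at \<open>m\<close> is \<open>idot n d\<close>, which is negative, against
        independence.\<close>
      define k where "k b = (if b = m then idot n d else if b = n then - idot m d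
         else if b \<in> ?T - {a} then idot m d * idot n (D b) - idot n d * idot m (D b) else 0)" for b
      have "(\<Sum>b\<in>?T'. k b *s b) = (\<Sum>b\<in>insert m (insert n (?T - {a})). k b *s b)"
        using m sub finT' by (intro sum.mono_neutral_right) (auto simp: k_def)
      also have "\<dots> = idot n d *s m + ((- idot m d) *s n + (\<Sum>b\<in>?T - {a}. k b *s b))"
        using nm nT finT by (auto simp: k_def)
      also have "(\<Sum>b\<in>?T - {a}. k b *s b) = (\<Sum>b\<in>?T - {a}. idot m d *s (idot n (D b) *s b) - idot n d *s (idot m (D b) *s b))"
        using nm nT by (intro sum.cong) (auto simp: k_def vector_sub_rdistrib vector_smult_assoc)
      also have "\<dots> = idot m d *s (\<Sum>b\<in>?T - {a}. idot n (D b) *s b) - idot n d *s (\<Sum>b\<in>?T - {a}. idot m (D b) *s b)"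
        by (simp add: sum_subtractf smult_sum_right)
      also have "(\<Sum>b\<in>?T - {a}. idot n (D b) *s b) = n - idot n d *s a" using z[of n] by (simp add: algebra_simps)
      also have "(\<Sum>b\<in>?T - {a}. idot m (D b) *s b) = m - idot m d *s a" using z[of m] by (simp add: algebra_simps)
      also have "idot n d *s m + ((- idot m d) *s n + (idot m d *s (n - idot n d *s a) - idot n d *s (m - idot m d *s a))) = 0"
        by (simp add: vec_eq_iff algebra_simps)
      finally have "k m = 0" using ind' m by blast
      then show False using n1 by (simp add: k_def)
    qed
  qed
  with sub have T': "?T' = insert n (?T - {a})" by blast
  \<comment> \<open>The dropped generator \<open>a\<close> is an integral combination of the new
    basis; pairing with \<open>d\<close> leaves only the term of \<open>n\<close>, so
    \<open>idot n d\<close> divides 1.\<close>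
  have nd: "idot n d = -1"
  proof -
    obtain e where e: "a = (\<Sum>b\<in>?T'. e b *s b)" using w'(2) unfolding fan_vertex_def lattice_basis_def by blast
    have "1 = idot (\<Sum>b\<in>?T'. e b *s b) d" using ad e by simp
    also have "\<dots> = (\<Sum>b\<in>?T'. e b * idot b d)" by (simp only: idot_sum_left idot_smult_left)
    also have "\<dots> = e n * idot n d + (\<Sum>b\<in>?T - {a}. e b * idot b d)" unfolding T' using finT nT by simp
    also have "(\<Sum>b\<in>?T - {a}. e b * idot b d) = 0" using d by (intro sum.neutral) auto
    finally have "e n * idot n d = 1" by simp
    then show ?thesis using n1(2) zmult_eq_1_iff[of "e n" "idot n d"] by auto
  qed
  have "w' = w + (idot n w + 1) *s d"
  proof -
    have "vec_of_int w' = vec_of_int (w + (idot n w + 1) *s d)"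
      using w'(1) by (simp add: v_def t_def nd vec_of_int_add vec_of_int_smult algebra_simps)
    then show ?thesis by simp
  qed
  then show "\<exists>n\<in>\<Lambda>. idot n d = -1 \<and> fan_vertex \<Lambda> (w + (idot n w + 1) *s d) \<and>
        tight \<Lambda> (w + (idot n w + 1) *s d) = insert n (tight \<Lambda> w - {a})"
    using n1(1) nd w'(2) T' by blast
qed

lemma fan_vertex_dual_basis:
  assumes "fan_vertex \<Lambda> w"
  obtains D where "dual_basis (tight \<Lambda> w) D"
  using assms lattice_basis_imp_dual_basis unfolding fan_vertex_def by metis

text \<open>
  The hypothesis on neighbours lets the simplex method run inside \<open>W\<close>: a linear functional
  attains its minimum over the polytope at a point of \<open>W\<close>, so the polytope is the convex hull of \<open>W\<close>.
\<close>

lemma toric_FanoI: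
  fixes \<Lambda> :: "(int^'n::{finite,wellorder}) set"
  assumes fin: "finite \<Lambda>" and W: "finite W" "W \<noteq> {}" "\<And>w. w \<in> W \<Longrightarrow> fan_vertex \<Lambda> w"
    and nb: "\<And>w a. w \<in> W \<Longrightarrow> a \<in> tight \<Lambda> w \<Longrightarrow>
      \<exists>w'\<in>W. (\<forall>b\<in>tight \<Lambda> w - {a}. idot b w' = -1) \<and> idot a w' \<noteq> -1"
    and cov: "\<And>a. a \<in> \<Lambda> \<Longrightarrow> \<exists>w\<in>W. a \<in> tight \<Lambda> w"
  shows "toric_Fano \<Lambda>"
proof -
  let ?P = "anticanonical_polytope \<Lambda>" and ?H = "convex hull (vec_of_int ` W)"
  have cH: "compact ?H" using W(1) by (simp add: finite_imp_compact_convex_hull)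
  have WP: "vec_of_int w \<in> ?P" if "w \<in> W" for w
    using W(3)[OF that] unfolding vec_of_int_in_polytope fan_vertex_def by blast
  have "?P \<subseteq> ?H"
  proof
    fix x assume x: "x \<in> ?P"
    show "x \<in> ?H"
    proof (rule ccontr)
      assume "x \<notin> ?H"
      then obtain c \<beta> where c: "c \<bullet> x < \<beta>" "\<And>y. y \<in> ?H \<Longrightarrow> \<beta> < c \<bullet> y"
        using separating_hyperplane_closed_point[of ?H x] cH compact_imp_closed by (metis convex_convex_hull)
      obtain w where w: "w \<in> W" "\<And>u. u \<in> W \<Longrightarrow> c \<bullet> vec_of_int w \<le> c \<bullet> vec_of_int u"
        using ex_is_arg_min_if_finite[OF W(1,2), of "\<lambda>w. c \<bullet> vec_of_int w"] unfolding is_arg_min_linorder by blast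
      let ?T = "tight \<Lambda> w"
      obtain D where D: "dual_basis ?T D" using W(3)[OF w(1)] by (rule fan_vertex_dual_basis)
      \<comment> \<open>The neighbour w' differs from w only in its pairing with \<open>a\<close>,
        so w' - w is a positive multiple of the edge vector, and \<open>c\<close> does not decrease
        towards w'.\<close>
      have cD: "c \<bullet> vec_of_int (D a) \<ge> 0" if a: "a \<in> ?T" for a
      proof -
        obtain w' where w': "w' \<in> W" "\<And>b. b \<in> ?T - {a} \<Longrightarrow> idot b w' = -1" "idot a w' \<noteq> -1"
          using nb[OF w(1) a] by blast
        have "idot a w' \<ge> -1" using W(3)[OF w'(1)] a unfolding fan_vertex_def tight_def by blast
        then have m: "idot a w' + 1 > 0" using w'(3) by simp
        have "vec_of_int b \<bullet> (vec_of_int w' - vec_of_int w) = (if b = a then of_int (idot a w' + 1) else 0)" if "b \<in> ?T" for b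
          using that w'(2)[of b] by (auto simp: inner_diff_right inner_vec_of_int tight_def)
        then have "vec_of_int w' - vec_of_int w = (\<Sum>b\<in>?T. (if b = a then of_int (idot a w' + 1) else 0) *\<^sub>R vec_of_int (D b))"
          by (subst dual_basis_expand_real[OF D]) (intro sum.cong, auto)
        also have "\<dots> = (\<Sum>b\<in>?T. if b = a then of_int (idot a w' + 1) *\<^sub>R vec_of_int (D a) else 0)"
          by (intro sum.cong) auto
        also have "\<dots> = of_int (idot a w' + 1) *\<^sub>R vec_of_int (D a)"
          using a dual_basis_finite[OF D] by simp
        finally have eq: "vec_of_int w' - vec_of_int w = of_int (idot a w' + 1) *\<^sub>R vec_of_int (D a)" .
        have "0 \<le> c \<bullet> (vec_of_int w' - vec_of_int w)" using w(2)[OF w'(1)] by (simp add: inner_diff_right)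
        then have "0 \<le> of_int (idot a w' + 1) * (c \<bullet> vec_of_int (D a))" unfolding eq by simp
        then show ?thesis using m by (simp only: zero_le_mult_iff of_int_0_le_iff of_int_le_0_iff) linarith
      qed
      have "x - vec_of_int w = (\<Sum>a\<in>?T. (vec_of_int a \<bullet> (x - vec_of_int w)) *\<^sub>R vec_of_int (D a))"
        by (rule dual_basis_expand_real[OF D])
      then have "c \<bullet> (x - vec_of_int w) = (\<Sum>a\<in>?T. (vec_of_int a \<bullet> (x - vec_of_int w)) * (c \<bullet> vec_of_int (D a)))"
        by (metis (no_types, lifting) inner_scaleR_right inner_sum_right sum.cong)
      also have "\<dots> \<ge> 0"
      proof (intro sum_nonneg mult_nonneg_nonneg cD)
        fix a assume a: "a \<in> ?T"
        then have "vec_of_int a \<bullet> x + 1 \<ge> 0" using x by (auto simp: anticanonical_polytope_def tight_def)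
        moreover have "idot a w = -1" using a by (simp add: tight_def)
        ultimately show "0 \<le> vec_of_int a \<bullet> (x - vec_of_int w)" by (simp add: inner_diff_right inner_vec_of_int)
      qed
      finally have "c \<bullet> vec_of_int w \<le> c \<bullet> x" by (simp add: inner_diff_right)
      moreover have "\<beta> < c \<bullet> vec_of_int w" using w(1) by (intro c(2) hull_inc) auto
      ultimately show False using c(1) by simp
    qed
  qed
  moreover have "?H \<subseteq> ?P" using WP by (intro hull_minimal convex_anticanonical_polytope) auto
  ultimately have PH: "?P = ?H" by blast
  have bd: "bounded ?P" unfolding PH using cH by (rule compact_imp_bounded)
  have prim: "primitive_vec a" if "a \<in> \<Lambda>" for a
  proof -
    obtain w where w: "w \<in> W" "a \<in> tight \<Lambda> w" using cov \<open>a \<in> \<Lambda>\<close> by blast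
    obtain D where D: "dual_basis (tight \<Lambda> w) D" using W(3)[OF w(1)] by (rule fan_vertex_dual_basis)
    show ?thesis unfolding primitive_vec_def
    proof (intro allI impI)
      fix k b assume "a = k *s b"
      then have "k * idot b (D a) = 1" using dual_basis_dual[OF D w(2) w(2)] by (simp add: idot_smult_left)
      then show "\<bar>k\<bar> = 1" using zmult_eq_1_iff by force
    qed
  qed
  have nz0: "a \<noteq> 0" if "a \<in> \<Lambda>" for a
  proof
    assume "a = 0"
    then have "a = 0 *s a" by simp
    then have "\<bar>0 :: int\<bar> = 1" using prim[OF that] unfolding primitive_vec_def by blast
    then show False by simp
  qed
  interpret lattice_polytope \<Lambda> using fin nz0 bd by unfold_locales blast+
  define H where "H a = {x. (- vec_of_int a) \<bullet> x \<le> 1}" for a :: "int^'n::_"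
  have Hmem: "x \<in> H a \<longleftrightarrow> vec_of_int a \<bullet> x + 1 \<ge> 0" for a x unfolding H_def by auto
  have PH': "?P = \<Inter>(H ` \<Lambda>)" by (auto simp: anticanonical_polytope_def Hmem)
  \<comment> \<open>Leaving P from a vertex on the facet of \<open>a\<close>, by a short step
    against the edge vector of \<open>a\<close>, violates the inequality of \<open>a\<close> and no
    other.\<close>
  have irr: "\<exists>x. x \<notin> H a \<and> (\<forall>b\<in>\<Lambda> - {a}. x \<in> H b)" if a: "a \<in> \<Lambda>" for a
  proof -
    obtain w where w: "w \<in> W" "a \<in> tight \<Lambda> w" using cov a by blast
    obtain D where D: "dual_basis (tight \<Lambda> w) D" using W(3)[OF w(1)] by (rule fan_vertex_dual_basis)
    obtain \<epsilon> :: real where \<epsilon>: "\<epsilon> > 0" "\<And>b. b \<in> \<Lambda> \<Longrightarrow> \<epsilon> * \<bar>of_int (idot b (D a))\<bar> \<le> 1"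
      using small_step[OF fin] by metis
    let ?x = "vec_of_int w - \<epsilon> *\<^sub>R vec_of_int (D a)"
    have dot: "vec_of_int b \<bullet> ?x = of_int (idot b w) - \<epsilon> * of_int (idot b (D a))" for b
      by (simp add: inner_diff_right inner_vec_of_int)
    have "?x \<notin> H a"
      using w(2) \<epsilon>(1) dual_basis_dual[OF D w(2) w(2)] unfolding Hmem dot by (simp add: tight_def)
    moreover have "?x \<in> H b" if b: "b \<in> \<Lambda> - {a}" for b
    proof (cases "b \<in> tight \<Lambda> w")
      case True
      then show ?thesis using dual_basis_dual[OF D w(2) True] b unfolding Hmem dot by (auto simp: tight_def)
    next
      case False
      then have "idot b w \<ge> 0" using W(3)[OF w(1)] b unfolding fan_vertex_def tight_def by force
      then have "real_of_int (idot b w) \<ge> 0" by simp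
      moreover have "\<epsilon> * of_int (idot b (D a)) \<le> 1"
        using \<epsilon>(2)[of b] b \<epsilon>(1) by (smt (verit) DiffD1 abs_ge_self mult_left_mono)
      ultimately show ?thesis unfolding Hmem dot by linarith
    qed
    ultimately show ?thesis by blast
  qed
  \<comment> \<open>Injectivity allows a normal vector to be assigned to each half-space, as the
    explicit description of the facets of a polyhedron expects.\<close>
  have injH: "inj_on H \<Lambda>"
  proof (rule inj_onI)
    fix a b assume ab: "a \<in> \<Lambda>" "b \<in> \<Lambda>" "H a = H b"
    obtain x where "x \<notin> H a" "\<forall>b\<in>\<Lambda> - {a}. x \<in> H b" using irr[OF ab(1)] by blast
    then show "a = b" using ab by blast
  qed
  have aff: "affine hull ?P = UNIV"
    using zero_interior by (intro affine_hull_nonempty_interior) blast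
  have facets: "facet \<Lambda> a facet_of ?P" if a: "a \<in> \<Lambda>" for a
  proof -
    define N where "N h = - vec_of_int (the_inv_into \<Lambda> H h)" for h
    have N: "N (H b) = - vec_of_int b" if "b \<in> \<Lambda>" for b
      using the_inv_into_f_f[OF injH that] by (simp add: N_def)
    have "C facet_of ?P \<longleftrightarrow> (\<exists>h. h \<in> H ` \<Lambda> \<and> C = ?P \<inter> {x. N h \<bullet> x = 1})" for C
    proof (rule facet_of_polyhedron_explicit)
      show "finite (H ` \<Lambda>)" using fin by simp
      show "?P = affine hull ?P \<inter> \<Inter>(H ` \<Lambda>)" unfolding aff using PH' by simp
      show "N h \<noteq> 0 \<and> h = {x. N h \<bullet> x \<le> 1}" if h: "h \<in> H ` \<Lambda>" for h
      proof -
        obtain b where b: "b \<in> \<Lambda>" "h = H b" using h by blast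
        show ?thesis unfolding b(2) N[OF b(1)] using nz0[OF b(1)] by (simp add: H_def)
      qed
      show "?P \<subset> affine hull ?P \<inter> \<Inter>F'" if F': "F' \<subset> H ` \<Lambda>" for F'
      proof -
        obtain b where b: "b \<in> \<Lambda>" "H b \<notin> F'" using F' by blast
        obtain x where x: "x \<notin> H b" "\<forall>c\<in>\<Lambda> - {b}. x \<in> H c" using irr[OF b(1)] by blast
        have "x \<in> \<Inter>F'" using F' x(2) b by blast
        moreover have "x \<notin> ?P" using x(1) b(1) unfolding PH' by blast
        moreover have "?P \<subseteq> \<Inter>F'" using F' unfolding PH' by blast
        ultimately show ?thesis unfolding aff by blast
      qed
    qed
    moreover have "facet \<Lambda> a = ?P \<inter> {x. N (H a) \<bullet> x = 1}"
    proof -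
      have "vec_of_int a \<bullet> x + 1 = 0 \<longleftrightarrow> N (H a) \<bullet> x = 1" for x
        unfolding N[OF a] by (simp, linarith)
      then show ?thesis by (auto simp: facet_def facet_hyperplane_def)
    qed
    ultimately show ?thesis using a by blast
  qed
  have ext: "v \<in> range vec_of_int \<and> lattice_basis {a \<in> \<Lambda>. v \<in> facet \<Lambda> a}" if v: "v extreme_point_of ?P" for v
  proof -
    have "v \<in> vec_of_int ` W" using v unfolding PH by (rule extreme_point_of_convex_hull)
    then obtain w where w: "w \<in> W" "v = vec_of_int w" by blast
    have "{a \<in> \<Lambda>. v \<in> facet \<Lambda> a} = tight \<Lambda> w"
      using vec_of_int_in_facet[OF WP[OF w(1)]] unfolding w(2) tight_def by blast
    then show ?thesis using W(3)[OF w(1)] w unfolding fan_vertex_def by simp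
  qed
  show ?thesis unfolding toric_Fano_def using fin prim bd facets ext by blast
qed

section \<open>Transport of vertices by lattice automorphisms\<close>

lemma idot_matrix_mult: "idot (A *v a) w = idot a (transpose A *v w)"
proof -
  have "idot (A *v a) w = (\<Sum>i\<in>UNIV. \<Sum>j\<in>UNIV. A $ i $ j * a $ j * w $ i)"
    by (simp add: idot_def matrix_vector_mult_def sum_distrib_right)
  also have "\<dots> = (\<Sum>j\<in>UNIV. \<Sum>i\<in>UNIV. A $ i $ j * a $ j * w $ i)" by (rule sum.swap)
  also have "\<dots> = idot a (transpose A *v w)"
    by (simp add: idot_def matrix_vector_mult_def transpose_def sum_distrib_left mult_ac)
  finally show ?thesis .
qed

lemma matrix_vector_mult_smult_int: "(A :: int^'n^'m) *v (k *s x) = k *s (A *v x)"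
  by (simp add: matrix_vector_mult_def vec_eq_iff sum_distrib_left mult.left_commute)

lemma matrix_vector_mult_sum_int: "(A :: int^'n^'m) *v (\<Sum>a\<in>T. f a) = (\<Sum>a\<in>T. A *v f a)"
  by (induction T rule: infinite_finite_induct) (simp_all add: matrix_vector_right_distrib)

text \<open>Dual vectors transform by the transposed inverse; the inner \<open>B\<close> only
  translates the index back.\<close>

lemma dual_basis_image:
  fixes A :: "int^'n^'n"
  assumes AB: "A ** B = mat 1" "B ** A = mat 1" and D: "dual_basis T D"
  shows "dual_basis ((*v) A ` T) (\<lambda>a. transpose B *v D (B *v a))"
proof -
  have BA: "B *v (A *v x) = x" and AB': "A *v (B *v x) = x" for x
    by (simp_all add: matrix_vector_mul_assoc AB)
  have inj: "inj_on ((*v) A) T" by (metis BA inj_onI)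
  show ?thesis unfolding dual_basis_def
  proof (intro conjI ballI allI)
    show "finite ((*v) A ` T)" using dual_basis_finite[OF D] by simp
    fix a b assume "a \<in> (*v) A ` T" "b \<in> (*v) A ` T"
    then obtain a' b' where ab: "a = A *v a'" "b = A *v b'" "a' \<in> T" "b' \<in> T" by blast
    have "a = b \<longleftrightarrow> a' = b'" using BA unfolding ab by metis
    then show "idot b (transpose B *v D (B *v a)) = (if a = b then 1 else 0)"
      using dual_basis_dual[OF D ab(3,4)] by (simp add: idot_matrix_mult[symmetric] ab(1,2) BA del: transpose_matrix_vector)
  next
    fix z
    have "z = A *v (B *v z)" by (simp add: AB')
    also have "\<dots> = A *v (\<Sum>a\<in>T. idot (B *v z) (D a) *s a)" by (rule arg_cong[OF dual_basis_expand[OF D]])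
    also have "\<dots> = (\<Sum>a\<in>T. idot z (transpose B *v D a) *s (A *v a))"
      by (simp add: matrix_vector_mult_sum_int matrix_vector_mult_smult_int idot_matrix_mult del: transpose_matrix_vector)
    also have "\<dots> = (\<Sum>a\<in>(*v) A ` T. idot z (transpose B *v D (B *v a)) *s a)"
      by (simp add: sum.reindex[OF inj] BA del: transpose_matrix_vector)
    finally show "z = (\<Sum>a\<in>(*v) A ` T. idot z (transpose B *v D (B *v a)) *s a)" .
  qed
qed

lemma lattice_basis_image:
  fixes A :: "int^'n^'n"
  assumes "A ** B = mat 1" "B ** A = mat 1" "lattice_basis T"
  shows "lattice_basis ((*v) A ` T)"
  using assms by (metis dual_basis_image dual_basis_imp_lattice_basis lattice_basis_imp_dual_basis)

lemma tight_image: "tight ((*v) A ` \<Lambda>) w = (*v) A ` tight \<Lambda> (transpose A *v w)"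
  by (auto simp: tight_def idot_matrix_mult)

lemma fan_vertex_image:
  fixes A :: "int^'n^'n"
  assumes AB: "A ** B = mat 1" "B ** A = mat 1"
  shows "fan_vertex ((*v) A ` \<Lambda>) w \<longleftrightarrow> fan_vertex \<Lambda> (transpose A *v w)"
proof -
  have "B *v (A *v x) = x" for x by (simp add: matrix_vector_mul_assoc AB)
  then have "(*v) B ` ((*v) A ` T) = T" for T by (simp add: image_image)
  then have "lattice_basis ((*v) A ` T) \<longleftrightarrow> lattice_basis T" for T
    using lattice_basis_image[OF AB, of T] lattice_basis_image[OF AB(2,1), of "(*v) A ` T"] by auto
  then show ?thesis unfolding fan_vertex_def tight_image by (simp add: idot_matrix_mult del: transpose_matrix_vector)
qed

text \<open>The enumeration consumes this property together with finiteness, primitivity and one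
  distinguished vertex, so these are transported instead of facets and boundedness.\<close>

lemma vertex_neighbours_image:
  fixes A :: "int^'n^'n"
  assumes AB: "A ** B = mat 1" "B ** A = mat 1" and nb: "vertex_neighbours \<Lambda>"
  shows "vertex_neighbours ((*v) A ` \<Lambda>)"
  unfolding vertex_neighbours_def fan_vertex_image[OF AB] tight_image
proof (intro allI impI)
  fix w a d
  let ?w = "transpose A *v w" and ?d = "transpose A *v d"
  assume w: "fan_vertex \<Lambda> ?w" and a: "a \<in> (*v) A ` tight \<Lambda> ?w"
    and d: "\<forall>b\<in>(*v) A ` tight \<Lambda> ?w. idot b d = (if b = a then 1 else 0)"
  obtain a' where a': "a' \<in> tight \<Lambda> ?w" "a = A *v a'" using a by blast
  have inj: "A *v x = A *v y \<longleftrightarrow> x = y" for x y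
    by (metis AB(2) matrix_vector_mul_assoc matrix_vector_mul_lid)
  have "\<forall>b\<in>tight \<Lambda> ?w. idot b ?d = (if b = a' then 1 else 0)"
  proof
    fix b assume "b \<in> tight \<Lambda> ?w"
    then have "idot (A *v b) d = (if A *v b = a then 1 else 0)" using d by blast
    then show "idot b ?d = (if b = a' then 1 else 0)" by (simp add: idot_matrix_mult a'(2) inj del: transpose_matrix_vector)
  qed
  then obtain n where n: "n \<in> \<Lambda>" "idot n ?d = -1" "fan_vertex \<Lambda> (?w + (idot n ?w + 1) *s ?d)"
    "tight \<Lambda> (?w + (idot n ?w + 1) *s ?d) = insert n (tight \<Lambda> ?w - {a'})"
    using nb w a'(1) unfolding vertex_neighbours_def by blast
  have eq: "transpose A *v (w + (idot (A *v n) w + 1) *s d) = ?w + (idot n ?w + 1) *s ?d"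
    by (simp add: matrix_vector_right_distrib matrix_vector_mult_smult_int idot_matrix_mult del: transpose_matrix_vector)
  have im: "(*v) A ` insert n (tight \<Lambda> ?w - {a'}) = insert (A *v n) ((*v) A ` tight \<Lambda> ?w - {a})"
    using inj unfolding a'(2) by auto
  show "\<exists>n\<in>(*v) A ` \<Lambda>. idot n d = -1 \<and> fan_vertex \<Lambda> (transpose A *v (w + (idot n w + 1) *s d)) \<and>
      (*v) A ` tight \<Lambda> (transpose A *v (w + (idot n w + 1) *s d)) = insert n ((*v) A ` tight \<Lambda> ?w - {a})"
  proof (intro bexI[of _ "A *v n"] conjI)
    show "idot (A *v n) d = -1" using n(2) by (simp only: idot_matrix_mult)
    show "fan_vertex \<Lambda> (transpose A *v (w + (idot (A *v n) w + 1) *s d))" unfolding eq by (rule n(3))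
    show "(*v) A ` tight \<Lambda> (transpose A *v (w + (idot (A *v n) w + 1) *s d)) = insert (A *v n) ((*v) A ` tight \<Lambda> ?w - {a})"
      unfolding eq n(4) by (rule im)
    show "A *v n \<in> (*v) A ` \<Lambda>" using n(1) by blast
  qed
qed

lemma primitive_vec_image:
  fixes A :: "int^'n^'n"
  assumes AB: "A ** B = mat 1" "B ** A = mat 1" and a: "primitive_vec a"
  shows "primitive_vec (A *v a)"
  unfolding primitive_vec_def
proof (intro allI impI)
  fix k b assume "A *v a = k *s b"
  then have "B *v (A *v a) = k *s (B *v b)" by (simp add: matrix_vector_mult_smult_int)
  then have "a = k *s (B *v b)" by (simp add: matrix_vector_mul_assoc AB)
  then show "\<bar>k\<bar> = 1" using a unfolding primitive_vec_def by blast
qed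

text \<open>
  Following Obro, the coordinates are adapted to a vertex whose cone contains the sum of all
  generators; this bounds the number and the size of the remaining generators.
\<close>

lemma special_vertex:
  fixes \<Lambda> :: "(int^'n) set"
  assumes F: "toric_Fano \<Lambda>"
  obtains T :: "(int^'n) set" and c :: "int^'n \<Rightarrow> int" where "card T = CARD('n)" "\<And>t. bij_betw t (UNIV :: 'n set) T \<Longrightarrow>
    \<exists>A. invertible A \<and> finite ((*v) A ` \<Lambda>) \<and> (\<forall>a\<in>(*v) A ` \<Lambda>. primitive_vec a) \<and>
      vertex_neighbours ((*v) A ` \<Lambda>) \<and> fan_vertex ((*v) A ` \<Lambda>) (\<chi> i. -1) \<and>
      tight ((*v) A ` \<Lambda>) (\<chi> i. -1) = range (\<lambda>i. axis i 1) \<and>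
      (\<forall>i. (\<Sum>a\<in>(*v) A ` \<Lambda>. a $ i) = c (t i))" "\<And>a. a \<in> T \<Longrightarrow> c a \<ge> 0"
proof -
  have fin: "finite \<Lambda>" and prim: "\<forall>a\<in>\<Lambda>. primitive_vec a" using F by (auto simp: toric_Fano_def)
  define x where "x = \<Sum>\<Lambda>"
  obtain w c where w: "fan_vertex \<Lambda> w" "\<And>a. a \<in> tight \<Lambda> w \<Longrightarrow> c a \<ge> 0" "x = (\<Sum>a\<in>tight \<Lambda> w. c a *s a)"
    using toric_Fano_cone_covering[OF F] by metis
  let ?T = "tight \<Lambda> w"
  obtain D where D: "dual_basis ?T D" using w(1) by (rule fan_vertex_dual_basis)
  have xD: "idot x (D a) = c a" if a: "a \<in> ?T" for a
  proof -
    have "idot x (D a) = (\<Sum>b\<in>?T. c b * idot b (D a))" unfolding w(3) by (simp add: idot_sum_left idot_smult_left)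
    also have "\<dots> = (\<Sum>b\<in>?T. if b = a then c a else 0)"
      using dual_basis_dual[OF D a] by (intro sum.cong) auto
    also have "\<dots> = c a" using a dual_basis_finite[OF D] by simp
    finally show ?thesis .
  qed
  show ?thesis
  proof (rule that[of ?T c])
    show "card ?T = CARD('n)" using D by (rule dual_basis_card)
    show "\<And>a. a \<in> ?T \<Longrightarrow> c a \<ge> 0" by (rule w(2))
    \<comment> \<open>The numbering of the basis is left open; in dimension three it is chosen later
      so as to sort the coefficients.\<close>
    fix t :: "'n \<Rightarrow> int^'n" assume t: "bij_betw t UNIV ?T"
    have tT: "t i \<in> ?T" for i using t bij_betwE by blast
    have tinj: "t i = t j \<longleftrightarrow> i = j" for i j using t by (auto simp: bij_betw_def inj_on_def)
    \<comment> \<open>The rows of \<open>A\<close> are the dual vectors, so it computes coordinates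
      with respect to the basis; the columns of \<open>B\<close> are the basis itself.\<close>
    define A :: "int^'n^'n" where "A = (\<chi> i j. D (t i) $ j)"
    define B :: "int^'n^'n" where "B = (\<chi> i j. t j $ i)"
    have Av: "(A *v z) $ i = idot z (D (t i))" for z i
      by (simp add: A_def matrix_vector_mult_def idot_def mult.commute)
    have Bv: "B *v z = (\<Sum>i\<in>UNIV. z $ i *s t i)" for z
      by (simp add: B_def matrix_vector_mult_def vec_eq_iff mult.commute)
    have At: "A *v t j = axis j 1" for j
      by (intro vec_eq_iff[THEN iffD2] allI) (simp add: Av dual_basis_dual[OF D tT tT] axis_def tinj)
    have BA: "B *v (A *v z) = z" for z
    proof -
      have "B *v (A *v z) = (\<Sum>i\<in>UNIV. idot z (D (t i)) *s t i)" by (simp add: Bv Av)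
      also have "\<dots> = (\<Sum>a\<in>?T. idot z (D a) *s a)" by (rule sum.reindex_bij_betw[OF t])
      finally show ?thesis using dual_basis_expand[OF D, of z] by simp
    qed
    have AB: "A *v (B *v z) = z" for z
      by (simp add: Bv matrix_vector_mult_sum_int matrix_vector_mult_smult_int At vec_expand_axis[of z, symmetric])
    have inv: "A ** B = mat 1" "B ** A = mat 1"
      by (simp_all add: matrix_eq matrix_vector_mul_assoc[symmetric] AB BA)
    \<comment> \<open>All basis elements pair to -1 with \<open>w\<close>, so in the new coordinates
      the vertex has all entries -1.\<close>
    have wA: "transpose A *v (\<chi> i. -1) = w"
    proof -
      have "(\<chi> i. -1) = transpose B *v w"
      proof -
        have "(transpose B *v w) $ i = -1" for i
        proof -
          have "(transpose B *v w) $ i = idot (t i) w"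
            by (simp add: transpose_def B_def matrix_vector_mult_def idot_def del: transpose_matrix_vector)
          then show ?thesis using tT[of i] by (simp add: tight_def)
        qed
        then show ?thesis by (simp add: vec_eq_iff)
      qed
      then show ?thesis
        by (simp add: matrix_vector_mul_assoc matrix_transpose_mul[symmetric] inv(2) transpose_mat del: transpose_matrix_vector)
    qed
    show "\<exists>A. invertible A \<and> finite ((*v) A ` \<Lambda>) \<and> (\<forall>a\<in>(*v) A ` \<Lambda>. primitive_vec a) \<and>
      vertex_neighbours ((*v) A ` \<Lambda>) \<and> fan_vertex ((*v) A ` \<Lambda>) (\<chi> i. -1) \<and>
      tight ((*v) A ` \<Lambda>) (\<chi> i. -1) = range (\<lambda>i. axis i 1) \<and>
      (\<forall>i. (\<Sum>a\<in>(*v) A ` \<Lambda>. a $ i) = c (t i))"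
    proof (intro exI[of _ A] conjI)
      show "invertible A" using inv unfolding invertible_def by blast
      show "finite ((*v) A ` \<Lambda>)" using fin by simp
      show "\<forall>a\<in>(*v) A ` \<Lambda>. primitive_vec a" using primitive_vec_image[OF inv] prim by blast
      show "vertex_neighbours ((*v) A ` \<Lambda>)"
        by (rule vertex_neighbours_image[OF inv toric_Fano_vertex_neighbours[OF F]])
      show "fan_vertex ((*v) A ` \<Lambda>) (\<chi> i. -1)" unfolding fan_vertex_image[OF inv] wA by (rule w(1))
      have "?T = range t" using t by (auto simp: bij_betw_def)
      then show "tight ((*v) A ` \<Lambda>) (\<chi> i. -1) = range (\<lambda>i. axis i 1)"
        unfolding tight_image wA by (simp add: image_image At)
      show "\<forall>i. (\<Sum>a\<in>(*v) A ` \<Lambda>. a $ i) = c (t i)"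
      proof
        fix i
        have "inj_on ((*v) A) \<Lambda>" by (metis BA inj_onI)
        then have "(\<Sum>a\<in>(*v) A ` \<Lambda>. a $ i) = (\<Sum>a\<in>\<Lambda>. (A *v a) $ i)" by (simp add: sum.reindex)
        also have "\<dots> = idot x (D (t i))" by (simp add: Av x_def idot_sum_left[of "\<lambda>a. a"])
        finally show "(\<Sum>a\<in>(*v) A ` \<Lambda>. a $ i) = c (t i)" using xD[OF tT] by simp
      qed
    qed
  qed
qed

section \<open>Enumeration of the toric Fano threefolds\<close>

fun weighted_subs :: "nat \<Rightarrow> (nat \<times> 'a) list \<Rightarrow> 'a list list" where
  "weighted_subs b [] = [[]]"
| "weighted_subs b ((w, x) # xs) =
     weighted_subs b xs @ (if w \<le> b then map (Cons x) (weighted_subs (b - w) xs) else [])"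

text \<open>The total weight prunes the enumeration of subsets. Weight 1 bounds the number of
  generators on level 0, the depth of a generator as weight bounds the total depth of those
  below.\<close>

lemma weighted_subs_complete:
  assumes "\<And>w x. (w, x) \<in> set xs \<Longrightarrow> w = h x" "S \<subseteq> snd ` set xs" "(\<Sum>x\<in>S. h x) \<le> b"
  shows "\<exists>l\<in>set (weighted_subs b xs). set l = S"
  using assms
proof (induction xs arbitrary: b S)
  case Nil
  then show ?case by simp
next
  case (Cons p xs)
  obtain w x where p: "p = (w, x)" by (cases p)
  have w: "w = h x" using Cons.prems(1) p by simp
  have finS: "finite S" using Cons.prems(2) finite_subset by blast
  show ?case
  proof (cases "x \<in> S")
    case True
    have "(\<Sum>y\<in>S. h y) = h x + (\<Sum>y\<in>S - {x}. h y)" using finS True by (rule sum.remove)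
    then have le: "w \<le> b" "(\<Sum>y\<in>S - {x}. h y) \<le> b - w" using Cons.prems(3) w by auto
    have "S - {x} \<subseteq> snd ` set xs" using Cons.prems(2) p by auto
    then obtain l where "l \<in> set (weighted_subs (b - w) xs)" "set l = S - {x}"
      using Cons.IH[of "S - {x}" "b - w"] Cons.prems(1) le(2) by auto
    then show ?thesis using le(1) True by (intro bexI[of _ "x # l"]) (auto simp: p)
  next
    case False
    then have "S \<subseteq> snd ` set xs" using Cons.prems(2) p by auto
    then obtain l where "l \<in> set (weighted_subs b xs)" "set l = S"
      using Cons.IH[of S b] Cons.prems(1,3) by auto
    then show ?thesis by (auto simp: p)
  qed
qed

lemma weighted_subs_distinct:
  assumes "distinct (map snd xs)" "l \<in> set (weighted_subs b xs)"
  shows "distinct l \<and> set l \<subseteq> snd ` set xs"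
  using assms
proof (induction b xs arbitrary: l rule: weighted_subs.induct)
  case (2 b w x xs)
  then show ?case by (fastforce split: if_splits)
qed simp

text \<open>
  Evaluation by rewriting does not short-circuit conjunctions, hence the formulation of the
  quantifiers over lists by conditionals.
\<close>

fun lazy_all :: "('a \<Rightarrow> bool) \<Rightarrow> 'a list \<Rightarrow> bool" where
  "lazy_all P [] = True"
| "lazy_all P (x # xs) = (if P x then lazy_all P xs else False)"

fun lazy_ex :: "('a \<Rightarrow> bool) \<Rightarrow> 'a list \<Rightarrow> bool" where
  "lazy_ex P [] = False"
| "lazy_ex P (x # xs) = (if P x then True else lazy_ex P xs)"

lemma lazy_all_iff: "lazy_all P xs \<longleftrightarrow> (\<forall>x\<in>set xs. P x)"
  by (induction xs) auto

lemma lazy_ex_iff: "lazy_ex P xs \<longleftrightarrow> (\<exists>x\<in>set xs. P x)"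
  by (induction xs) auto

text \<open>
  A vertex \<open>v\<close> is stored with the list of pairs of a generator tight at \<open>v\<close> and the
  corresponding vector of the dual basis; \<open>cb x m y\<close> stands for \<open>x + m y\<close>.
\<close>

fun neighbour_check :: "('v \<Rightarrow> 'v \<Rightarrow> int) \<Rightarrow> ('v \<Rightarrow> int \<Rightarrow> 'v \<Rightarrow> 'v) \<Rightarrow> 'v list \<Rightarrow> nat \<Rightarrow> 'v \<Rightarrow> ('v \<times> 'v) list \<Rightarrow> bool" where
  "neighbour_check dt cb L 0 v S = True"
| "neighbour_check dt cb L (Suc k) v S = lazy_all (\<lambda>(a, d). lazy_ex (\<lambda>n.
     if dt n d = -1 then
       (let v' = cb v (dt n v + 1) d;
            S' = map (\<lambda>(b, e). if b = a then (n, cb d (-2) d) else (b, cb e (dt n e) d)) S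
        in if lazy_all (\<lambda>b. if List.member (map fst S') b then dt b v' = -1 else 0 \<le> dt b v') L
           then neighbour_check dt cb L k v' S' else False)
     else False) L) S"

text \<open>Every edge has a correct choice of \<open>n\<close>, so a fan passes at any depth; the
  check serves as a sieve. At the neighbour the dual vector of \<open>n\<close> is -d, written
  \<open>cb d (-2) d\<close>, and any other \<open>e\<close> becomes e + (dt n e) d, which pairs to
  0 with \<open>n\<close> because \<open>dt n d\<close> is -1.\<close>

lemma neighbour_check_sound:
  fixes rep :: "'v \<Rightarrow> int^'n"
  assumes inj: "inj rep" and dt: "\<And>x y. dt x y = idot (rep x) (rep y)"
    and cb: "\<And>x m y. rep (cb x m y) = rep x + m *s rep y"
    and nb: "vertex_neighbours (rep ` set L)"
    and "fan_vertex (rep ` set L) (rep v)" "tight (rep ` set L) (rep v) = rep ` fst ` set S"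
    and "\<And>a d b e. (a, d) \<in> set S \<Longrightarrow> (b, e) \<in> set S \<Longrightarrow> dt b d = (if b = a then 1 else 0)"
  shows "neighbour_check dt cb L k v S"
  using assms(5-7)
proof (induction k arbitrary: v S)
  case (Suc k)
  let ?\<Lambda> = "rep ` set L"
  have step: "\<exists>n\<in>set L. dt n d = -1 \<and> (let v' = cb v (dt n v + 1) d;
            S' = map (\<lambda>(b, e). if b = a then (n, cb d (-2) d) else (b, cb e (dt n e) d)) S
        in (\<forall>b\<in>set L. if List.member (map fst S') b then dt b v' = -1 else 0 \<le> dt b v') \<and> neighbour_check dt cb L k v' S')"
    if ad: "(a, d) \<in> set S" for a d
  proof -
    have aT: "rep a \<in> tight ?\<Lambda> (rep v)" unfolding Suc.prems(2) using ad by force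
    have dual: "\<forall>b\<in>tight ?\<Lambda> (rep v). idot b (rep d) = (if b = rep a then 1 else 0)"
      unfolding Suc.prems(2) using Suc.prems(3)[OF ad] inj by (auto simp: dt inj_eq)
    obtain n where n: "n \<in> set L" "idot (rep n) (rep d) = -1"
      "fan_vertex ?\<Lambda> (rep v + (idot (rep n) (rep v) + 1) *s rep d)"
      "tight ?\<Lambda> (rep v + (idot (rep n) (rep v) + 1) *s rep d) = insert (rep n) (tight ?\<Lambda> (rep v) - {rep a})"
      using nb Suc.prems(1) aT dual unfolding vertex_neighbours_def by blast
    define v' where "v' = cb v (dt n v + 1) d"
    define S' where "S' = map (\<lambda>(b, e). if b = a then (n, cb d (-2) d) else (b, cb e (dt n e) d)) S"
    have rv': "rep v' = rep v + (idot (rep n) (rep v) + 1) *s rep d" by (simp add: v'_def cb dt)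
    have nd: "dt n d = -1" using n(2) by (simp add: dt)
    have "fst ` set S' = insert n (fst ` set S - {a})"
    proof
      show "fst ` set S' \<subseteq> insert n (fst ` set S - {a})" by (force simp: S'_def split: if_splits)
      show "insert n (fst ` set S - {a}) \<subseteq> fst ` set S'"
      proof
        fix b assume "b \<in> insert n (fst ` set S - {a})"
        then consider "b = n" | e where "(b, e) \<in> set S" "b \<noteq> a" by force
        then show "b \<in> fst ` set S'"
        proof cases
          case 1
          then show ?thesis using ad unfolding S'_def by (force simp: image_iff)
        next
          case 2
          then show ?thesis unfolding S'_def by (force simp: image_iff)
        qed
      qed
    qed
    then have T': "tight ?\<Lambda> (rep v') = rep ` fst ` set S'"
      unfolding rv' n(4) Suc.prems(2) using inj by (auto simp: inj_eq)
    have V': "fan_vertex ?\<Lambda> (rep v')" unfolding rv' by (rule n(3))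
    \<comment> \<open>The old generators pair to 0 or 1 with \<open>d\<close> and the new one to -1,
      so it does not coincide with any of them.\<close>
    have nS: "b \<noteq> n" if "(b, e) \<in> set S" for b e
      using Suc.prems(3)[OF ad that] nd by (auto split: if_splits)
    have dual': "dt b d' = (if b = a' then 1 else 0)" if in': "(a', d') \<in> set S'" "(b, e) \<in> set S'" for a' d' b e
    proof -
      obtain a0 d0 where a0: "(a0, d0) \<in> set S" "(a', d') = (if a0 = a then (n, cb d (-2) d) else (a0, cb d0 (dt n d0) d))"
        using in'(1) unfolding S'_def by auto
      obtain b0 e0 where b0: "(b0, e0) \<in> set S" "b = (if b0 = a then n else b0)"
        using in'(2) unfolding S'_def by (auto split: if_splits)
      have dcb: "dt x (cb y m z) = dt x y + m * dt x z" for x y m z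
        by (simp add: dt cb idot_add_right idot_smult_right)
      show ?thesis
        using a0 b0 Suc.prems(3)[OF ad b0(1)] Suc.prems(3)[OF a0(1) b0(1)] nS[OF a0(1)] nS[OF b0(1)] nd
        by (auto simp: dcb split: if_splits)
    qed
    have "\<forall>b\<in>set L. if List.member (map fst S') b then dt b v' = -1 else 0 \<le> dt b v'"
    proof
      fix b assume b: "b \<in> set L"
      have "dt b v' \<ge> -1" using V' b unfolding fan_vertex_def dt by blast
      moreover have "dt b v' = -1 \<longleftrightarrow> b \<in> fst ` set S'"
      proof -
        have "rep b \<in> tight ?\<Lambda> (rep v') \<longleftrightarrow> dt b v' = -1" using b unfolding tight_def dt by blast
        then show ?thesis unfolding T' inj_image_mem_iff[OF inj] by simp
      qed
      moreover have "List.member (map fst S') b \<longleftrightarrow> b \<in> fst ` set S'" by simp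
      ultimately show "if List.member (map fst S') b then dt b v' = -1 else 0 \<le> dt b v'" by auto
    qed
    moreover have "neighbour_check dt cb L k v' S'" by (rule Suc.IH[OF V' T' dual'])
    ultimately show ?thesis
      using n(1) nd unfolding v'_def S'_def Let_def by blast
  qed
  have conv: "(if P then Q else False) = (P \<and> Q)" for P Q by simp
  show ?case unfolding neighbour_check.simps lazy_all_iff lazy_ex_iff conv Let_def
  proof
    fix p assume pS: "p \<in> set S"
    obtain a d where p: "p = (a, d)" by (cases p)
    show "case p of (a, d) \<Rightarrow> \<exists>n\<in>set L. dt n d = -1 \<and>
        (\<forall>b\<in>set L. if List.member (map fst (map (\<lambda>(b, e). if b = a then (n, cb d (- 2) d) else (b, cb e (dt n e) d)) S)) b
            then dt b (cb v (dt n v + 1) d) = -1 else 0 \<le> dt b (cb v (dt n v + 1) d)) \<and>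
        neighbour_check dt cb L k (cb v (dt n v + 1) d)
          (map (\<lambda>(b, e). if b = a then (n, cb d (- 2) d) else (b, cb e (dt n e) d)) S)"
      using step[of a d] pS unfolding p Let_def prod.case by blast
  qed
qed simp

section \<open>Vectors, candidates and models in dimension three\<close>

fun dot3 :: "int \<times> int \<times> int \<Rightarrow> int \<times> int \<times> int \<Rightarrow> int" where
  "dot3 (a, b, c) (d, e, f) = a * d + b * e + c * f"

fun comb3 :: "int \<times> int \<times> int \<Rightarrow> int \<Rightarrow> int \<times> int \<times> int \<Rightarrow> int \<times> int \<times> int" where
  "comb3 (a, b, c) m (d, e, f) = (a + m * d, b + m * e, c + m * f)"

fun add3 :: "int \<times> int \<times> int \<Rightarrow> int \<times> int \<times> int \<Rightarrow> int \<times> int \<times> int" where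
  "add3 (a, b, c) (d, e, f) = (a + d, b + e, c + f)"

definition sum3 :: "(int \<times> int \<times> int) list \<Rightarrow> int \<times> int \<times> int" where
  "sum3 l = foldr add3 l (0, 0, 0)"

fun ordered3 :: "int \<times> int \<times> int \<Rightarrow> bool" where
  "ordered3 (a, b, c) = (if 0 \<le> a then if a \<le> b then b \<le> c else False else False)"

definition units3 :: "(int \<times> int \<times> int) list" where
  "units3 = [(1, 0, 0), (0, 1, 0), (0, 0, 1)]"

text \<open>
  The possible generators on which the sum of the coordinates is \<open>0\<close> (with weight \<open>1\<close>),
  respectively the negative of the weight.
\<close>

definition level0_3 :: "(nat \<times> int \<times> int \<times> int) list" where
  "level0_3 = [(1, - 1, - 1, 2), (1, - 1, 0, 1), (1, - 1, 1, 0), (1, - 1, 2, - 1), (1, 0, - 1, 1), (1, 0, 1, - 1), (1, 1, - 1, 0), (1, 1, 0, - 1), (1, 2, - 1, - 1)]"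

definition below_3 :: "(nat \<times> int \<times> int \<times> int) list" where
  "below_3 = [(1, - 1, - 1, 1), (1, - 1, 0, 0), (1, - 1, 1, - 1), (1, 0, - 1, 0), (1, 0, 0, - 1), (1, 1, - 1, - 1),
     (2, - 2, - 1, 1), (2, - 2, 1, - 1), (2, - 1, - 2, 1), (2, - 1, - 1, 0), (2, - 1, 0, - 1), (2, - 1, 1, - 2),
     (2, 0, - 1, - 1), (2, 1, - 2, - 1), (2, 1, - 1, - 2), (3, - 3, - 2, 2), (3, - 3, - 1, 1), (3, - 3, 1, - 1),
     (3, - 3, 2, - 2), (3, - 2, - 3, 2), (3, - 2, - 2, 1), (3, - 2, - 1, 0), (3, - 2, 0, - 1), (3, - 2, 1, - 2),
     (3, - 2, 2, - 3), (3, - 1, - 3, 1), (3, - 1, - 2, 0), (3, - 1, - 1, - 1), (3, - 1, 0, - 2), (3, - 1, 1, - 3),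
     (3, 0, - 2, - 1), (3, 0, - 1, - 2), (3, 1, - 3, - 1), (3, 1, - 2, - 2), (3, 1, - 1, - 3), (3, 2, - 3, - 2),
     (3, 2, - 2, - 3)]"

text \<open>The budget 3 is the dimension: it bounds both the number of generators on level 0 and
  the total depth of those below. \<open>ordered3\<close> says that the sum of all generators lies
  in the cone of the unit vectors, with coordinates permuted into increasing order. The sums of the
  lists in \<open>B\<close> are computed once and shared by all \<open>z\<close>.\<close>

definition candidates3 :: "(int \<times> int \<times> int) list list" where
  "candidates3 = (let B = map (\<lambda>b. (b, sum3 b)) (weighted_subs 3 below_3) in
     concat (map (\<lambda>z. let s = add3 (1, 1, 1) (sum3 z) in
       map (\<lambda>(b, _). units3 @ z @ b) (filter (\<lambda>(_, sb). ordered3 (add3 s sb)) B)) (weighted_subs 3 level0_3)))"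

text \<open>The models are ordered by the number of generators, 4 to 8, that is by Picard number 1
  to 5. Indices 0, 4 and 11 are P^3, P^2 x P^1 and (P^1)^3; indices 9, 15 and 17 are the products of
  P^1 with P^2 blown up in one, two and three torus-fixed points.\<close>

definition models3 :: "(int \<times> int \<times> int) list list" where
  "models3 = [[(- 1, - 1, - 1), (0, 0, 1), (0, 1, 0), (1, 0, 0)],
     [(- 2, - 1, - 1), (- 1, 0, 0), (0, 0, 1), (0, 1, 0), (1, 0, 0)],
     [(- 1, - 1, - 1), (- 1, - 1, 0), (0, 0, 1), (0, 1, 0), (1, 0, 0)],
     [(- 1, - 1, - 1), (- 1, 0, 0), (0, 0, 1), (0, 1, 0), (1, 0, 0)],
     [(- 1, - 1, 0), (0, 0, - 1), (0, 0, 1), (0, 1, 0), (1, 0, 0)],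
     [(- 2, - 1, - 1), (- 1, - 1, - 1), (- 1, 0, 0), (0, 0, 1), (0, 1, 0), (1, 0, 0)],
     [(- 1, - 1, - 1), (- 1, - 1, 0), (- 1, 0, 0), (0, 0, 1), (0, 1, 0), (1, 0, 0)],
     [(- 1, - 1, - 1), (- 1, - 1, 0), (0, 0, - 1), (0, 0, 1), (0, 1, 0), (1, 0, 0)],
     [(- 1, - 1, 0), (- 1, 0, - 1), (- 1, 0, 0), (0, 0, 1), (0, 1, 0), (1, 0, 0)],
     [(- 1, - 1, 0), (- 1, 0, 0), (0, 0, - 1), (0, 0, 1), (0, 1, 0), (1, 0, 0)],
     [(- 1, - 1, 0), (- 1, 0, 0), (0, 0, 1), (0, 1, 0), (1, 0, - 1), (1, 0, 0)],
     [(- 1, 0, 0), (0, - 1, 0), (0, 0, - 1), (0, 0, 1), (0, 1, 0), (1, 0, 0)],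
     [(- 1, - 1, - 1), (- 1, - 1, 0), (- 1, 0, 0), (0, - 1, 0), (0, 0, 1), (0, 1, 0), (1, 0, 0)],
     [(- 1, - 1, 0), (- 1, 0, - 1), (- 1, 0, 0), (0, - 1, 0), (0, 0, 1), (0, 1, 0), (1, 0, 0)],
     [(- 1, - 1, 0), (- 1, 0, 0), (- 1, 0, 1), (0, 0, 1), (0, 1, 0), (1, 0, - 1), (1, 0, 0)],
     [(- 1, - 1, 0), (- 1, 0, 0), (0, - 1, 0), (0, 0, - 1), (0, 0, 1), (0, 1, 0), (1, 0, 0)],
     [(- 1, - 1, 0), (- 1, 0, 0), (- 1, 0, 1), (0, 0, - 1), (0, 0, 1), (0, 1, 0), (1, 0, - 1), (1, 0, 0)],
     [(- 1, 0, 0), (- 1, 0, 1), (0, - 1, 0), (0, 0, - 1), (0, 0, 1), (0, 1, 0), (1, 0, - 1), (1, 0, 0)]]"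

text \<open>
  The surviving candidates (without the unit vectors), each with a matrix and its inverse
  (given by rows) that carries the candidate to the model of the given index.
\<close>

definition survivors3 :: "((int \<times> int \<times> int) list \<times>
    ((int \<times> int \<times> int) \<times> (int \<times> int \<times> int) \<times> (int \<times> int \<times> int)) \<times>
    ((int \<times> int \<times> int) \<times> (int \<times> int \<times> int) \<times> (int \<times> int \<times> int)) \<times> nat) list" where
  "survivors3 = [([(- 1, - 1, - 1)], ((1, 0, 0), (0, 1, 0), (0, 0, 1)), ((1, 0, 0), (0, 1, 0), (0, 0, 1)), 0),
     ([(0, 0, - 1), (- 1, - 1, 0)], ((1, 0, 0), (0, 1, 0), (0, 0, 1)), ((1, 0, 0), (0, 1, 0), (0, 0, 1)), 4),
     ([(0, - 1, 0), (- 1, 0, - 1)], ((1, 0, 0), (0, 0, 1), (0, 1, 0)), ((1, 0, 0), (0, 0, 1), (0, 1, 0)), 4),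
     ([(- 1, 0, 0), (0, - 1, - 1)], ((0, 1, 0), (0, 0, 1), (1, 0, 0)), ((0, 0, 1), (1, 0, 0), (0, 1, 0)), 4),
     ([(- 1, 0, 0), (0, - 1, 0), (0, 0, - 1)], ((1, 0, 0), (0, 1, 0), (0, 0, 1)), ((1, 0, 0), (0, 1, 0), (0, 0, 1)), 11),
     ([(- 1, - 1, 1), (0, 0, - 1)], ((0, 0, - 1), (1, 0, 0), (0, 1, 0)), ((0, 1, 0), (0, 0, 1), (- 1, 0, 0)), 3),
     ([(1, 0, - 1), (- 1, 0, 0), (- 1, - 1, 0)], ((1, 0, 0), (0, 1, 0), (0, 0, 1)), ((1, 0, 0), (0, 1, 0), (0, 0, 1)), 10),
     ([(1, - 1, 0), (- 1, 0, 0), (- 1, 0, - 1)], ((1, 0, 0), (0, 0, 1), (0, 1, 0)), ((1, 0, 0), (0, 0, 1), (0, 1, 0)), 10),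
     ([(0, 1, - 1), (0, - 1, 0), (- 1, - 1, 0)], ((0, 1, 0), (1, 0, 0), (0, 0, 1)), ((0, 1, 0), (1, 0, 0), (0, 0, 1)), 10),
     ([(0, - 1, 1), (- 1, 0, - 1)], ((1, 0, - 1), (0, 0, - 1), (0, 1, 0)), ((1, - 1, 0), (0, 0, 1), (0, - 1, 0)), 2),
     ([(0, - 1, 1), (0, 0, - 1), (- 1, 0, - 1)], ((0, 0, 1), (1, 0, 0), (0, 1, 0)), ((0, 1, 0), (0, 0, 1), (1, 0, 0)), 10),
     ([(0, - 1, 1), (- 1, 1, - 1), (0, - 1, 0)], ((1, 0, - 1), (0, 0, - 1), (0, - 1, - 1)), ((1, - 1, 0), (0, 1, - 1), (0, - 1, 0)), 7),
     ([(0, - 1, 1), (- 1, 0, 0), (0, 0, - 1)], ((0, 0, - 1), (0, 1, 0), (1, 0, 0)), ((0, 0, 1), (0, 1, 0), (- 1, 0, 0)), 9),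
     ([(0, - 1, 1), (0, 1, - 1), (- 1, - 1, 0)], ((1, - 1, - 1), (0, - 1, - 1), (0, 0, - 1)), ((1, - 1, 0), (0, - 1, 1), (0, 0, - 1)), 7),
     ([(0, - 1, 1), (0, 1, - 1), (- 1, 0, 0), (0, - 1, 0)], ((0, 0, - 1), (0, - 1, - 1), (1, 0, 0)), ((0, 0, 1), (1, - 1, 0), (- 1, 0, 0)), 15),
     ([(0, - 1, 1), (0, 1, - 1), (- 1, 0, 0), (0, - 1, 0), (0, 0, - 1)], ((0, 1, 0), (1, 0, 0), (0, 0, 1)), ((0, 1, 0), (1, 0, 0), (0, 0, 1)), 17),
     ([(0, - 1, 1), (0, 1, - 1), (- 1, - 1, 1), (0, 0, - 1)], ((0, 0, - 1), (1, 0, 0), (0, 1, 1)), ((0, 1, 0), (1, 0, 1), (- 1, 0, 0)), 14),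
     ([(- 1, 2, - 1), (0, - 1, 1), (0, - 1, 0)], ((0, - 1, - 2), (1, 0, - 1), (0, 0, - 1)), ((0, 1, - 1), (- 1, 0, 2), (0, 0, - 1)), 5),
     ([(- 1, 1, 0), (0, - 1, 0), (0, - 1, - 1)], ((0, 1, 0), (0, 0, 1), (1, 0, 0)), ((0, 0, 1), (1, 0, 0), (0, 1, 0)), 10),
     ([(- 1, 1, 0), (1, - 1, 0), (- 1, 0, 0), (0, - 1, 0), (0, 0, - 1)], ((1, 0, 0), (0, 0, 1), (0, 1, 0)), ((1, 0, 0), (0, 0, 1), (0, 1, 0)), 17),
     ([(- 1, 1, 0), (0, - 1, 1), (0, 0, - 1)], ((0, - 1, - 1), (0, - 1, 0), (1, 0, 0)), ((0, 0, 1), (0, - 1, 0), (- 1, 1, 0)), 6),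
     ([(- 1, 1, 0), (0, - 1, 1), (0, - 1, 0), (0, 0, - 1)], ((0, - 1, - 1), (1, 0, 0), (0, 0, 1)), ((0, 1, 0), (- 1, 0, - 1), (0, 0, 1)), 14),
     ([(- 1, 1, 0), (0, - 1, 1), (0, 1, - 1), (0, - 1, 0)], ((0, - 1, - 1), (0, 0, - 1), (1, 0, 0)), ((0, 0, 1), (- 1, 1, 0), (0, - 1, 0)), 13),
     ([(- 1, 0, 1), (0, - 1, - 1)], ((0, 1, - 1), (0, 0, - 1), (1, 0, 0)), ((0, 0, 1), (1, - 1, 0), (0, - 1, 0)), 2),
     ([(- 1, 0, 1), (0, 0, - 1), (0, - 1, - 1)], ((0, 0, 1), (0, 1, 0), (1, 0, 0)), ((0, 0, 1), (0, 1, 0), (1, 0, 0)), 10),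
     ([(- 1, 0, 1), (0, - 1, 0), (0, 0, - 1)], ((0, 0, - 1), (1, 0, 0), (0, 1, 0)), ((0, 1, 0), (0, 0, 1), (- 1, 0, 0)), 9),
     ([(- 1, 0, 1), (- 1, 0, 0), (1, - 1, - 1)], ((0, 1, - 1), (0, 0, - 1), (- 1, 0, - 1)), ((0, 1, - 1), (1, - 1, 0), (0, - 1, 0)), 7),
     ([(- 1, 0, 1), (1, 0, - 1), (- 1, - 1, 0)], ((- 1, 1, - 1), (- 1, 0, - 1), (0, 0, - 1)), ((0, - 1, 1), (1, - 1, 0), (0, 0, - 1)), 7),
     ([(- 1, 0, 1), (1, 0, - 1), (- 1, 0, 0), (0, - 1, 0)], ((0, 0, - 1), (- 1, 0, - 1), (0, 1, 0)), ((1, - 1, 0), (0, 0, 1), (- 1, 0, 0)), 15),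
     ([(- 1, 0, 1), (1, 0, - 1), (- 1, 0, 0), (0, - 1, 0), (0, 0, - 1)], ((1, 0, 0), (0, 1, 0), (0, 0, 1)), ((1, 0, 0), (0, 1, 0), (0, 0, 1)), 17),
     ([(- 1, 0, 1), (1, 0, - 1), (- 1, - 1, 1), (0, 0, - 1)], ((0, 0, - 1), (0, 1, 0), (1, 0, 1)), ((1, 0, 1), (0, 1, 0), (- 1, 0, 0)), 14),
     ([(- 1, 0, 1), (1, - 1, 0), (- 1, 0, 0), (0, 0, - 1)], ((- 1, 0, - 1), (0, 1, 0), (0, 0, 1)), ((- 1, 0, - 1), (0, 1, 0), (0, 0, 1)), 14),
     ([(- 1, 0, 1), (0, 1, - 1), (0, - 1, 0)], ((0, - 1, - 1), (0, 0, - 1), (1, 0, 0)), ((0, 0, 1), (- 1, 1, 0), (0, - 1, 0)), 6),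
     ([(- 1, 0, 1), (0, - 1, 1), (0, 0, - 1)], ((0, 0, - 1), (1, 0, 0), (0, 1, 0)), ((0, 1, 0), (0, 0, 1), (- 1, 0, 0)), 8),
     ([(- 1, 0, 1), (0, - 1, 1), (1, 0, - 1), (- 1, 0, 0)], ((0, 0, - 1), (- 1, 0, - 1), (0, 1, 0)), ((1, - 1, 0), (0, 0, 1), (- 1, 0, 0)), 12),
     ([(- 1, 0, 1), (0, - 1, 1), (1, 0, - 1), (- 1, 0, 0), (0, 0, - 1)], ((- 1, 0, - 1), (0, 1, 0), (1, 0, 0)), ((0, 0, 1), (0, 1, 0), (- 1, 0, - 1)), 16),
     ([(- 1, 0, 1), (0, - 1, 1), (0, 1, - 1), (0, 0, - 1)], ((0, - 1, - 1), (0, - 1, 0), (1, 0, 0)), ((0, 0, 1), (0, - 1, 0), (- 1, 1, 0)), 13),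
     ([(- 1, 0, 1), (0, - 1, 1), (0, 1, - 1), (0, - 1, 0)], ((0, 0, - 1), (0, - 1, - 1), (1, 0, 0)), ((0, 0, 1), (1, - 1, 0), (- 1, 0, 0)), 12),
     ([(- 1, 0, 1), (0, - 1, 1), (0, 1, - 1), (0, - 1, 0), (0, 0, - 1)], ((0, - 1, - 1), (1, 0, 0), (0, 1, 0)), ((0, 1, 0), (0, 0, 1), (- 1, 0, - 1)), 16),
     ([(- 1, - 1, 2), (0, 0, - 1)], ((0, 0, - 1), (1, 0, 0), (0, 1, 0)), ((0, 1, 0), (0, 0, 1), (- 1, 0, 0)), 1),
     ([(- 1, - 1, 2), (0, 1, - 1), (0, 0, - 1)], ((0, - 2, - 1), (1, - 1, 0), (0, - 1, 0)), ((0, 1, - 1), (0, 0, - 1), (- 1, 0, 2)), 5)]"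

fun apply3 :: "(int \<times> int \<times> int) \<times> (int \<times> int \<times> int) \<times> (int \<times> int \<times> int) \<Rightarrow> int \<times> int \<times> int \<Rightarrow> int \<times> int \<times> int" where
  "apply3 (r, s, t) x = (dot3 r x, dot3 s x, dot3 t x)"

fun rep3 :: "int \<times> int \<times> int \<Rightarrow> int^3" where
  "rep3 (a, b, c) = vector [a, b, c]"

lemma rep3_nth [simp]: "rep3 p $ 1 = fst p" "rep3 p $ 2 = fst (snd p)" "rep3 p $ 3 = snd (snd p)"
  by (cases p; simp)+

lemma rep3_components: "rep3 (a $ 1, a $ 2, a $ 3) = a"
  by (simp add: vec_eq_iff forall_3)

lemma inj_rep3: "inj rep3"
  by (auto simp: inj_def vec_eq_iff forall_3)

lemma surj_rep3: "surj rep3"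
  by (rule surjI[of rep3 "\<lambda>a. (a $ 1, a $ 2, a $ 3)"]) (rule rep3_components)

lemma rep3_comb3: "rep3 (comb3 x m y) = rep3 x + m *s rep3 y"
  by (cases x; cases y) (simp add: vec_eq_iff forall_3)

lemma dot3_rep3: "dot3 x y = idot (rep3 x) (rep3 y)"
  by (cases x; cases y) (simp add: idot_def sum_3)

lemma rep3_units3: "rep3 ` set units3 = range (\<lambda>i. axis i 1)"
proof -
  have "rep3 (1, 0, 0) = axis 1 1" "rep3 (0, 1, 0) = axis 2 1" "rep3 (0, 0, 1) = axis 3 1"
    by (simp_all add: vec_eq_iff forall_3 axis_def)
  then show ?thesis by (auto simp: units3_def UNIV_3)
qed

definition mat3 :: "(int \<times> int \<times> int) \<times> (int \<times> int \<times> int) \<times> (int \<times> int \<times> int) \<Rightarrow> int^3^3" where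
  "mat3 A = vector [rep3 (fst A), rep3 (fst (snd A)), rep3 (snd (snd A))]"

lemma mat3_rep3: "mat3 A *v rep3 x = rep3 (apply3 A x)"
proof -
  have "dot3 r x = fst r * fst x + fst (snd r) * fst (snd x) + snd (snd r) * snd (snd x)" for r
    by (cases r; cases x) simp
  then show ?thesis
    by (cases A) (simp add: mat3_def matrix_vector_mult_def vec_eq_iff forall_3 sum_3)
qed

text \<open>By linearity the product need only be evaluated on the unit vectors.\<close>

lemma mat3_inverse:
  assumes "\<And>e. e \<in> set units3 \<Longrightarrow> apply3 A (apply3 B e) = e"
  shows "mat3 A ** mat3 B = mat 1"
proof -
  have "(mat3 A ** mat3 B) *v axis i 1 = axis i 1" for i
  proof -
    obtain e where e: "e \<in> set units3" "axis i 1 = rep3 e" using rep3_units3 by blast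
    then show ?thesis using assms by (simp add: matrix_vector_mul_assoc[symmetric] mat3_rep3)
  qed
  then have "(mat3 A ** mat3 B) *v z = z" for z
    by (subst (1 2) vec_expand_axis[of z]) (simp only: matrix_vector_mult_sum_int matrix_vector_mult_smult_int)
  then show ?thesis by (simp add: matrix_eq)
qed

text \<open>Depth 3 is enough: every candidate passing three pivots is afterwards carried to a model
  by an explicit matrix. One fan can survive in several forms, since the special vertex and, in case
  of ties, the order of the coordinates are not determined by it.\<close>

lemma filter_candidates3:
  "filter (\<lambda>L. neighbour_check dot3 comb3 L 3 (-1, -1, -1) (map (\<lambda>e. (e, e)) units3)) candidates3 =
   map (\<lambda>(L, _). units3 @ L) survivors3"
  by code_simp

lemma survivors3_models3:
  "list_all (\<lambda>(L, A, B, k). k < 18 \<and> set (map (apply3 A) (units3 @ L)) = set (models3 ! k) \<and>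
     list_all (\<lambda>e. apply3 A (apply3 B e) = e \<and> apply3 B (apply3 A e) = e) units3) survivors3"
  by code_simp

section \<open>Completeness of the candidate list\<close>

lemma sorted_bij3:
  fixes c :: "'a \<Rightarrow> int"
  assumes "card T = 3"
  obtains t :: "3 \<Rightarrow> 'a" where "bij_betw t UNIV T" "c (t 1) \<le> c (t 2)" "c (t 2) \<le> c (t 3)"
proof -
  have "finite T" using assms card.infinite by fastforce
  then obtain xs where xs: "set xs = T" "distinct xs" using finite_distinct_list by blast
  define ys where "ys = sort_key c xs"
  have ys: "set ys = T" "distinct ys" "sorted (map c ys)" unfolding ys_def using xs by simp_all
  have "length ys = 3" using ys assms distinct_card by metis
  then obtain x y z where xyz: "ys = [x, y, z]"
    by (auto simp: numeral_3_eq_3 length_Suc_conv)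
  define t :: "3 \<Rightarrow> 'a" where "t i = (if i = 1 then x else if i = 2 then y else z)" for i
  have t: "t 1 = x" "t 2 = y" "t 3 = z" by (simp_all add: t_def)
  have "x \<noteq> y" "y \<noteq> x" "x \<noteq> z" "z \<noteq> x" "y \<noteq> z" "z \<noteq> y" using ys(2) unfolding xyz by auto
  then have "inj t" unfolding inj_def forall_3 t by simp
  moreover have "range t = T" using ys(1) unfolding xyz UNIV_3 image_insert image_empty t by simp
  ultimately have "bij_betw t UNIV T" by (simp add: bij_betw_def)
  moreover have "c (t 1) \<le> c (t 2)" "c (t 2) \<le> c (t 3)" using ys(3) unfolding xyz t by simp_all
  ultimately show ?thesis by (rule that)
qed

lemma sum3_append: "sum3 (xs @ ys) = add3 (sum3 xs) (sum3 ys)"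
proof (induction xs)
  case Nil
  then show ?case by (cases "sum3 ys") (simp add: sum3_def)
next
  case (Cons x xs)
  then show ?case by (cases x; cases "sum3 xs"; cases "sum3 ys") (simp add: sum3_def)
qed

lemma sum3_distinct:
  "distinct l \<Longrightarrow> sum3 l = (\<Sum>p\<in>set l. fst p, \<Sum>p\<in>set l. fst (snd p), \<Sum>p\<in>set l. snd (snd p))"
proof (induction l)
  case (Cons x l)
  then show ?case by (cases x) (simp add: sum3_def)
qed (simp add: sum3_def)

lemma level0_3_complete:
  fixes x y z :: int
  assumes "x \<ge> -1" "y \<ge> -1" "z \<ge> -1" "x + y + z = 0" "\<not> (x = 0 \<and> y = 0 \<and> z = 0)"
  shows "(x, y, z) \<in> snd ` set level0_3"
proof -
  have z: "z = - x - y" using assms(4) by simp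
  have "x \<in> {-1, 0, 1, 2}" "y \<in> {-1, 0, 1, 2}" using assms by auto
  then show ?thesis using assms(3,5) unfolding z by (elim insertE emptyE; simp add: level0_3_def)
qed

lemma below_3_check:
  "list_all (\<lambda>k. list_all (\<lambda>x. list_all (\<lambda>y.
     (if x + y \<le> 0 \<and> - k \<le> - k - x - y \<and> \<not> (k = 2 \<and> 2 dvd x \<and> 2 dvd y) \<and> \<not> (k = 3 \<and> 3 dvd x \<and> 3 dvd y)
      then List.member (map snd below_3) (x, y, - k - x - y) else True)) [- k..k]) [- k..k]) [1, 2, 3]"
  by code_simp

lemma below_3_complete:
  fixes x y z :: int
  assumes "\<And>t. t \<in> {x, y, z} \<Longrightarrow> t \<ge> -1 \<or> t \<ge> x + y + z" "x + y + z < 0" "x + y + z \<ge> -3"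
    and "\<not> (2 dvd x \<and> 2 dvd y \<and> 2 dvd z)" "\<not> (3 dvd x \<and> 3 dvd y \<and> 3 dvd z)"
  shows "(x, y, z) \<in> snd ` set below_3"
proof -
  define k where "k = - (x + y + z)"
  have z: "z = - k - x - y" by (simp add: k_def)
  have k: "k \<in> {1, 2, 3}" using assms(2,3) unfolding k_def by auto
  \<comment> \<open>Since k \<ge> 1, both alternatives make every entry at least -k; as the entries
    add up to -k, none exceeds k, which leaves the finite range of
    \<open>below_3_check\<close>.\<close>
  have ge: "x \<ge> - k" "y \<ge> - k" "z \<ge> - k"
    using assms(1)[of x] assms(1)[of y] assms(1)[of z] assms(2) unfolding k_def by auto
  then have xy: "x \<in> set [- k..k]" "y \<in> set [- k..k]" "x + y \<le> 0" unfolding z by auto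
  \<comment> \<open>The entries add up to -k, so the third is divisible by k once the first two are,
    and primitivity becomes a condition on x and y.\<close>
  have dv: "\<not> (k = 2 \<and> 2 dvd x \<and> 2 dvd y)" "\<not> (k = 3 \<and> 3 dvd x \<and> 3 dvd y)"
    using assms(4,5) unfolding z by auto
  have "k \<in> set [1, 2, 3]" using k by simp
  then have "List.member (map snd below_3) (x, y, - k - x - y)"
    using below_3_check xy ge(3) dv unfolding list_all_iff z by (smt (verit, ccfv_SIG))
  then show ?thesis unfolding z by simp
qed

lemma primitive_vec_not_dvd:
  assumes "primitive_vec (a :: int^'n)" "k > 1"
  shows "\<not> (\<forall>i. k dvd a $ i)"
proof
  assume "\<forall>i. k dvd a $ i"
  then have "a = k *s (\<chi> i. a $ i div k)" by (simp add: vec_eq_iff)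
  then have "\<bar>k\<bar> = 1" using assms(1) unfolding primitive_vec_def by blast
  then show False using assms(2) by simp
qed

text \<open>The level of a generator is its coordinate sum. Unit vectors lie on level 1, all other
  generators on levels at most 0; since the sum of all generators has nonnegative coordinates, the
  negative levels add up to at least -n. For each i the edge in direction i leads to a vertex with
  one new generator, whose i-th entry is -1, and the inequalities at that vertex bound the i-th
  entry of every remaining generator below by its level.\<close>

lemma special_coordinates_levels:
  fixes \<Lambda> :: "(int^'n) set"
  assumes fin: "finite \<Lambda>" and prim: "\<forall>a\<in>\<Lambda>. primitive_vec a" and nb: "vertex_neighbours \<Lambda>"
    and v0: "fan_vertex \<Lambda> (\<chi> i. -1)" and t0: "tight \<Lambda> (\<chi> i. -1) = range (\<lambda>i. axis i 1)"
    and s: "\<And>i. 0 \<le> (\<Sum>a\<in>\<Lambda>. a $ i)"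
  obtains Z B where "\<Lambda> = range (\<lambda>i. axis i 1) \<union> (Z \<union> B)" "range (\<lambda>i. axis i 1) \<inter> (Z \<union> B) = {}" "Z \<inter> B = {}"
    "card Z \<le> CARD('n)" "\<And>a. a \<in> Z \<Longrightarrow> (\<Sum>i\<in>UNIV. a $ i) = 0" "\<And>a i. a \<in> Z \<Longrightarrow> a $ i \<ge> -1"
    "(\<Sum>a\<in>B. - (\<Sum>i\<in>UNIV. a $ i)) \<le> int CARD('n)" "\<And>a. a \<in> B \<Longrightarrow> (\<Sum>i\<in>UNIV. a $ i) < 0"
    "\<And>a. a \<in> B \<Longrightarrow> (\<Sum>i\<in>UNIV. a $ i) \<ge> - int CARD('n)"
    "\<And>a i. a \<in> B \<Longrightarrow> a $ i \<ge> -1 \<or> a $ i \<ge> (\<Sum>i\<in>UNIV. a $ i)"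
proof -
  define u where "u a = (\<Sum>i\<in>UNIV. a $ i)" for a :: "int^'n"
  define E where "E = range (\<lambda>i :: 'n. axis i (1 :: int))"
  have w0: "idot a (\<chi> i. -1) = - u a" for a by (simp add: idot_def u_def sum_negf)
  have E\<Lambda>: "E \<subseteq> \<Lambda>" using t0 unfolding E_def tight_def by auto
  have uE: "u a = 1" if "a \<in> E" for a using that unfolding E_def u_def by (auto simp: axis_def)
  have uneg: "u a \<le> 0" if "a \<in> \<Lambda>" "a \<notin> E" for a
  proof -
    have "idot a (\<chi> i. -1) \<ge> -1" using v0 that(1) unfolding fan_vertex_def by blast
    moreover have "idot a (\<chi> i. -1) \<noteq> -1" using t0 that unfolding E_def tight_def by blast
    ultimately show ?thesis unfolding w0 by simp
  qed
  \<comment> \<open>The neighbouring vertex is (-1, ..., -1) + (1 - u n) e_i. A generator other than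
    \<open>n\<close> and the unit vectors is not tight there, so it pairs to at least 0 with
    it.\<close>
  have "\<exists>n\<in>\<Lambda>. n $ i = -1 \<and> (\<forall>a\<in>\<Lambda>. a \<notin> E \<longrightarrow> a \<noteq> n \<longrightarrow> u a \<le> (1 - u n) * a $ i)" for i :: 'n
  proof -
    have "axis i 1 \<in> tight \<Lambda> (\<chi> i. -1)" unfolding t0 by blast
    moreover have "\<forall>b\<in>tight \<Lambda> (\<chi> i. -1). idot b (axis i 1) = (if b = axis i 1 then 1 else 0)"
      unfolding t0 by (auto simp: axis_eq_axis) (auto simp: axis_def)
    ultimately obtain n where n: "n \<in> \<Lambda>" "idot n (axis i 1) = -1"
        "fan_vertex \<Lambda> ((\<chi> i. -1) + (idot n (\<chi> i. -1) + 1) *s axis i 1)"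
        "tight \<Lambda> ((\<chi> i. -1) + (idot n (\<chi> i. -1) + 1) *s axis i 1) = insert n (tight \<Lambda> (\<chi> i. -1) - {axis i 1})"
      using nb v0 unfolding vertex_neighbours_def by blast
    have "u a \<le> (1 - u n) * a $ i" if a: "a \<in> \<Lambda>" "a \<notin> E" "a \<noteq> n" for a
    proof -
      let ?w = "(\<chi> i. -1) + (idot n (\<chi> i. -1) + 1) *s axis i 1"
      have "idot a ?w \<ge> -1" using n(3) a(1) unfolding fan_vertex_def by blast
      moreover have "a \<notin> tight \<Lambda> ?w" using a unfolding n(4) t0 E_def by blast
      then have "idot a ?w \<noteq> -1" using a(1) by (simp add: tight_def)
      moreover have "idot a ?w = - u a + (1 - u n) * a $ i"
        by (simp only: idot_add_right idot_smult_right w0 idot_axis) simp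
      ultimately show ?thesis by simp
    qed
    then show ?thesis using n(1,2) by auto
  qed
  then obtain n where n: "\<And>i. n i \<in> \<Lambda>" "\<And>i. n i $ i = -1"
    "\<And>i a. a \<in> \<Lambda> \<Longrightarrow> a \<notin> E \<Longrightarrow> a \<noteq> n i \<Longrightarrow> u a \<le> (1 - u (n i)) * a $ i" by metis
  have nE: "n i \<notin> E" for i using n(2)[of i] unfolding E_def by (auto simp: axis_def split: if_splits)
  have m1: "1 - u (n i) \<ge> 1" for i using uneg[OF n(1) nE] by simp
  have neg: "a = n i \<or> u a \<le> a $ i" if "a \<in> \<Lambda>" "a \<notin> E" "a $ i < 0" for a i
  proof (rule disjCI)
    assume "\<not> u a \<le> a $ i"
    moreover have "(1 - u (n i)) * a $ i \<le> 1 * a $ i" using m1 that(3) by (intro mult_right_mono_neg) auto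
    ultimately show "a = n i" using n(3)[OF that(1,2), of i] by linarith
  qed
  define Z where "Z = {a \<in> \<Lambda>. a \<notin> E \<and> u a = 0}"
  define B where "B = {a \<in> \<Lambda>. a \<notin> E \<and> u a < 0}"
  have \<Lambda>: "\<Lambda> = E \<union> (Z \<union> B)" "E \<inter> (Z \<union> B) = {}" "Z \<inter> B = {}"
    using E\<Lambda> uneg unfolding Z_def B_def by force+
  have finZB: "finite E" "finite Z" "finite B" using fin \<Lambda>(1) by (metis finite_Un)+
  have nz: "a \<noteq> 0" if "a \<in> \<Lambda>" for a
    using primitive_vec_not_dvd[of a 2] prim that by auto
  \<comment> \<open>A nonzero vector on level 0 has a negative entry, say the i-th; as its level 0
    would exceed that entry, it must be the exceptional generator \<open>n i\<close>.\<close>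
  have Zn: "Z \<subseteq> range n"
  proof
    fix a assume a: "a \<in> Z"
    have "\<exists>i. a $ i < 0"
    proof (rule ccontr)
      assume "\<not> ?thesis"
      then have "a $ i \<ge> 0" for i by (simp add: not_less)
      moreover have "(\<Sum>i\<in>UNIV. a $ i) = 0" using a by (simp add: Z_def u_def)
      ultimately have "a = 0" by (simp add: sum_nonneg_eq_0_iff vec_eq_iff)
      then show False using nz a by (auto simp: Z_def)
    qed
    then obtain i where "a $ i < 0" by blast
    then show "a \<in> range n" using neg[of a i] a by (auto simp: Z_def)
  qed
  have "card Z \<le> card (range n)" using Zn by (intro card_mono) auto
  also have "\<dots> \<le> card (UNIV :: 'n set)" by (rule card_image_le) simp
  finally have cardZ: "card Z \<le> CARD('n)" .
  have cardE: "(\<Sum>a\<in>E. u a) = int CARD('n)"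
  proof -
    have "inj (\<lambda>i :: 'n. axis i (1 :: int))" by (simp add: inj_def axis_eq_axis)
    then have "card E = CARD('n)" unfolding E_def by (simp add: card_image)
    then show ?thesis using uE by simp
  qed
  \<comment> \<open>Balance of levels: the unit vectors contribute n and level 0 contributes
    nothing.\<close>
  have "0 \<le> (\<Sum>a\<in>\<Lambda>. u a)" unfolding u_def by (subst sum.swap) (intro sum_nonneg s)
  also have "\<dots> = (\<Sum>a\<in>E. u a) + ((\<Sum>a\<in>Z. u a) + (\<Sum>a\<in>B. u a))"
    using finZB \<Lambda>(2,3) by (subst \<Lambda>(1)) (simp add: sum.union_disjoint)
  also have "(\<Sum>a\<in>Z. u a) = 0" by (simp add: Z_def)
  finally have sumB: "(\<Sum>a\<in>B. - u a) \<le> int CARD('n)" using cardE by (simp add: sum_negf)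
  have uB: "u a \<ge> - int CARD('n)" if "a \<in> B" for a
  proof -
    have "- u a \<le> (\<Sum>a\<in>B. - u a)" using that finZB by (intro member_le_sum) (auto simp: B_def)
    then show ?thesis using sumB by simp
  qed
  show ?thesis
  proof (rule that[of Z B, folded u_def E_def])
    show "\<Lambda> = E \<union> (Z \<union> B)" "E \<inter> (Z \<union> B) = {}" "Z \<inter> B = {}" using \<Lambda> by blast+
    show "card Z \<le> CARD('n)" by (rule cardZ)
    show "u a = 0" if "a \<in> Z" for a using that by (simp add: Z_def)
    show "a $ i \<ge> -1" if "a \<in> Z" for a i
      using neg[of a i] n(2)[of i] that by (cases "a $ i < 0") (auto simp: Z_def)
    show "(\<Sum>a\<in>B. - u a) \<le> int CARD('n)" by (rule sumB)
    show "u a < 0" if "a \<in> B" for a using that by (simp add: B_def)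
    show "u a \<ge> - int CARD('n)" if "a \<in> B" for a by (rule uB[OF that])
    show "a $ i \<ge> -1 \<or> a $ i \<ge> u a" if "a \<in> B" for a i
      using neg[of a i] n(2)[of i] that by (cases "a $ i < 0") (auto simp: B_def)
  qed
qed

lemma special_coordinates_candidates3:
  fixes \<Lambda> :: "(int^3) set"
  assumes fin: "finite \<Lambda>" and prim: "\<forall>a\<in>\<Lambda>. primitive_vec a" and nb: "vertex_neighbours \<Lambda>"
    and v0: "fan_vertex \<Lambda> (\<chi> i. -1)" and t0: "tight \<Lambda> (\<chi> i. -1) = range (\<lambda>i. axis i 1)"
    and s: "0 \<le> (\<Sum>a\<in>\<Lambda>. a $ 1)" "(\<Sum>a\<in>\<Lambda>. a $ 1) \<le> (\<Sum>a\<in>\<Lambda>. a $ 2)" "(\<Sum>a\<in>\<Lambda>. a $ 2) \<le> (\<Sum>a\<in>\<Lambda>. a $ 3)"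
  shows "\<exists>L\<in>set candidates3. \<Lambda> = rep3 ` set L \<and>
    neighbour_check dot3 comb3 L 3 (-1, -1, -1) (map (\<lambda>e. (e, e)) units3)"
proof -
  define E where "E = range (\<lambda>i :: 3. axis i (1 :: int))"
  have "0 \<le> (\<Sum>a\<in>\<Lambda>. a $ i)" for i using s exhaust_3[of i] by auto
  then obtain Z B where \<Lambda>: "\<Lambda> = E \<union> (Z \<union> B)" "E \<inter> (Z \<union> B) = {}" "Z \<inter> B = {}"
    and Z: "card Z \<le> CARD(3)" "\<And>a. a \<in> Z \<Longrightarrow> (\<Sum>i\<in>UNIV. a $ i) = 0" "\<And>a i. a \<in> Z \<Longrightarrow> a $ i \<ge> -1"
    and B: "(\<Sum>a\<in>B. - (\<Sum>i\<in>UNIV. a $ i)) \<le> int CARD(3)" "\<And>a. a \<in> B \<Longrightarrow> (\<Sum>i\<in>UNIV. a $ i) < 0"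
      "\<And>a. a \<in> B \<Longrightarrow> (\<Sum>i\<in>UNIV. a $ i) \<ge> - int CARD(3)"
      "\<And>a i. a \<in> B \<Longrightarrow> a $ i \<ge> -1 \<or> a $ i \<ge> (\<Sum>i\<in>UNIV. a $ i)"
    by (rule special_coordinates_levels[OF fin prim nb v0 t0, folded E_def]) blast
  note Z = Z[unfolded sum_3] and B = B[unfolded sum_3]
  have dv: "\<not> (\<forall>i. k dvd a $ i)" if "k > 1" "a \<in> \<Lambda>" for k a
    using primitive_vec_not_dvd that prim by blast
  have nz: "a \<noteq> 0" if "a \<in> \<Lambda>" for a using dv[of 2, OF _ that] by auto
  let ?Z = "rep3 -` Z" and ?B = "rep3 -` B"
  have imZ: "rep3 ` ?Z = Z" "rep3 ` ?B = B" using surj_rep3 by (simp_all add: surj_image_vimage_eq)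
  have injs: "inj_on rep3 S" for S using inj_rep3 by (rule inj_on_subset) simp
  have "(\<Sum>p\<in>?Z. 1 :: nat) \<le> 3" using Z(1) card_image[OF injs, of ?Z] unfolding imZ by simp
  moreover have "?Z \<subseteq> snd ` set level0_3"
  proof
    fix p assume "p \<in> ?Z"
    then have p: "rep3 p \<in> Z" "rep3 p \<in> \<Lambda>" using \<Lambda> by auto
    obtain x y z where xyz: "p = (x, y, z)" by (cases p)
    show "p \<in> snd ` set level0_3" unfolding xyz
      using Z(3)[OF p(1), of 1] Z(3)[OF p(1), of 2] Z(3)[OF p(1), of 3] Z(2)[OF p(1)] nz[OF p(2)]
      by (intro level0_3_complete) (auto simp: xyz vec_eq_iff forall_3)
  qed
  moreover have "w = 1" if "(w, x) \<in> set level0_3" for w x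
    using that by (auto simp: level0_3_def)
  ultimately obtain z where z: "z \<in> set (weighted_subs 3 level0_3)" "set z = ?Z"
    using weighted_subs_complete[of level0_3 "\<lambda>_. 1" ?Z 3] by blast
  define h where "h p = nat (- (fst p + fst (snd p) + snd (snd p)))" for p :: "int \<times> int \<times> int"
  have "(\<Sum>p\<in>?B. h p) \<le> 3"
  proof -
    have "int (h p) = - (rep3 p $ 1 + rep3 p $ 2 + rep3 p $ 3)" if "p \<in> ?B" for p
      using B(2)[of "rep3 p"] that by (simp add: h_def)
    then have "int (\<Sum>p\<in>?B. h p) = (\<Sum>p\<in>?B. - (rep3 p $ 1 + rep3 p $ 2 + rep3 p $ 3))"
      unfolding of_nat_sum by (intro sum.cong refl)
    also have "\<dots> = (\<Sum>a\<in>rep3 ` ?B. - (a $ 1 + a $ 2 + a $ 3))" by (simp only: sum.reindex[OF injs] o_def)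
    finally show ?thesis using B(1) unfolding imZ by (simp del: of_nat_sum)
  qed
  moreover have "?B \<subseteq> snd ` set below_3"
  proof
    fix p assume "p \<in> ?B"
    then have p: "rep3 p \<in> B" "rep3 p \<in> \<Lambda>" using \<Lambda> by auto
    obtain x y z where xyz: "p = (x, y, z)" by (cases p)
    show "p \<in> snd ` set below_3" unfolding xyz
      using B(4)[OF p(1), of 1] B(4)[OF p(1), of 2] B(4)[OF p(1), of 3] B(2,3)[OF p(1)] dv[OF _ p(2), of 2] dv[OF _ p(2), of 3]
      by (intro below_3_complete) (auto simp: xyz forall_3)
  qed
  moreover have "w = h x" if "(w, x) \<in> set below_3" for w x
    using that by (auto simp: below_3_def h_def)
  ultimately obtain b where b: "b \<in> set (weighted_subs 3 below_3)" "set b = ?B"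
    using weighted_subs_complete[of below_3 h ?B 3] by blast
  define L where "L = units3 @ z @ b"
  have setL: "\<Lambda> = rep3 ` set L"
    unfolding L_def set_append image_Un z(2) b(2) imZ rep3_units3 using \<Lambda>(1) unfolding E_def .
  have dz: "distinct z" "distinct b"
    using weighted_subs_distinct[OF _ z(1)] weighted_subs_distinct[OF _ b(1)]
    by (auto simp: level0_3_def below_3_def)
  have "set units3 \<subseteq> rep3 -` E" using rep3_units3 unfolding E_def by blast
  then have "set units3 \<inter> (set z \<union> set b) = {}" "set z \<inter> set b = {}"
    unfolding z(2) b(2) using \<Lambda>(2,3) by blast+
  \<comment> \<open>\<open>sum3\<close> adds up a list while \<open>s\<close> is about a set, so
    repetitions have to be excluded.\<close>
  then have dL: "distinct L" using dz unfolding L_def by (auto simp: units3_def)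
  have "(\<Sum>a\<in>\<Lambda>. a $ i) = (\<Sum>p\<in>set L. rep3 p $ i)" for i
    unfolding setL by (simp add: sum.reindex[OF injs])
  then have "ordered3 (sum3 L)" using s unfolding sum3_distinct[OF dL] by simp
  moreover have "sum3 L = add3 (add3 (1, 1, 1) (sum3 z)) (sum3 b)"
  proof -
    have "sum3 units3 = (1, 1, 1)" by (simp add: sum3_def units3_def)
    then show ?thesis unfolding L_def sum3_append
      by (cases "sum3 z"; cases "sum3 b") (simp add: add.assoc)
  qed
  ultimately have "L \<in> set candidates3"
    using z(1) b(1) unfolding candidates3_def Let_def L_def by force
  moreover have "neighbour_check dot3 comb3 L 3 (-1, -1, -1) (map (\<lambda>e. (e, e)) units3)"
  proof -
    have w: "rep3 (-1, -1, -1) = (\<chi> i. -1)" by (simp add: vec_eq_iff forall_3)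
    have f: "fst ` set (map (\<lambda>e. (e, e)) units3) = set units3" by force
    have t: "tight (rep3 ` set L) (rep3 (-1, -1, -1)) = rep3 ` fst ` set (map (\<lambda>e. (e, e)) units3)"
      unfolding f w setL[symmetric] t0 rep3_units3 by (rule refl)
    have d: "dot3 b d = (if b = a then 1 else 0)"
      if "(a, d) \<in> set (map (\<lambda>e. (e, e)) units3)" "(b, e) \<in> set (map (\<lambda>e. (e, e)) units3)" for a d b e
    proof -
      have "list_all (\<lambda>a. list_all (\<lambda>b. dot3 b a = (if b = a then 1 else 0)) units3) units3" by code_simp
      moreover have "a \<in> set units3" "d = a" "b \<in> set units3" using that by auto
      ultimately show ?thesis unfolding list_all_iff by blast
    qed
    have nb': "vertex_neighbours (rep3 ` set L)" unfolding setL[symmetric] by (rule nb)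
    have v0': "fan_vertex (rep3 ` set L) (rep3 (-1, -1, -1))" unfolding setL[symmetric] w by (rule v0)
    show ?thesis
      by (rule neighbour_check_sound[where rep = rep3 and dt = dot3 and cb = comb3 and L = L and v = "(-1, -1, -1)" and k = 3
            and S = "map (\<lambda>e. (e, e)) units3", OF inj_rep3 dot3_rep3 rep3_comb3 nb' v0' t]) (rule d)
  qed
  ultimately show ?thesis using setL by blast
qed

theorem toric_Fano3_classification:
  fixes \<Lambda> :: "(int^3) set"
  assumes F: "toric_Fano \<Lambda>"
  obtains A k where "invertible A" "k < 18" "(*v) A ` \<Lambda> = rep3 ` set (models3 ! k)"
proof -
  obtain T :: "(int^3) set" and c :: "int^3 \<Rightarrow> int" where T: "card T = CARD(3)" "\<And>t. bij_betw t (UNIV :: 3 set) T \<Longrightarrow>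
    \<exists>A. invertible A \<and> finite ((*v) A ` \<Lambda>) \<and> (\<forall>a\<in>(*v) A ` \<Lambda>. primitive_vec a) \<and>
      vertex_neighbours ((*v) A ` \<Lambda>) \<and> fan_vertex ((*v) A ` \<Lambda>) (\<chi> i. -1) \<and>
      tight ((*v) A ` \<Lambda>) (\<chi> i. -1) = range (\<lambda>i. axis i 1) \<and>
      (\<forall>i. (\<Sum>a\<in>(*v) A ` \<Lambda>. a $ i) = c (t i))" "\<And>a. a \<in> T \<Longrightarrow> c a \<ge> 0"
    using special_vertex[OF F] by metis
  \<comment> \<open>Numbering the coordinates by increasing coefficients of the sum brings the fan
    into the form demanded by \<open>ordered3\<close>.\<close>
  obtain t :: "3 \<Rightarrow> int^3" where t: "bij_betw t UNIV T" "c (t 1) \<le> c (t 2)" "c (t 2) \<le> c (t 3)"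
    using sorted_bij3[of T c] T(1) by auto
  obtain A where A: "invertible A" "finite ((*v) A ` \<Lambda>)" "\<forall>a\<in>(*v) A ` \<Lambda>. primitive_vec a"
      "vertex_neighbours ((*v) A ` \<Lambda>)" "fan_vertex ((*v) A ` \<Lambda>) (\<chi> i. -1)"
      "tight ((*v) A ` \<Lambda>) (\<chi> i. -1) = range (\<lambda>i. axis i 1)"
      "\<And>i. (\<Sum>a\<in>(*v) A ` \<Lambda>. a $ i) = c (t i)"
    using T(2)[OF t(1)] by blast
  have "c (t 1) \<ge> 0" using T(3) t(1) bij_betwE by blast
  then obtain L where L: "L \<in> set candidates3" "(*v) A ` \<Lambda> = rep3 ` set L"
      "neighbour_check dot3 comb3 L 3 (-1, -1, -1) (map (\<lambda>e. (e, e)) units3)"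
    using special_coordinates_candidates3[OF A(2-6)] t(2,3) unfolding A(7) by blast
  then have "L \<in> set (map (\<lambda>(L, _). units3 @ L) survivors3)"
    unfolding filter_candidates3[symmetric] by simp
  then obtain K M N k where K: "(K, M, N, k) \<in> set survivors3" "L = units3 @ K" by auto
  have "case (K, M, N, k) of (L, A, B, k) \<Rightarrow> k < 18 \<and> set (map (apply3 A) (units3 @ L)) = set (models3 ! k) \<and>
     list_all (\<lambda>e. apply3 A (apply3 B e) = e \<and> apply3 B (apply3 A e) = e) units3"
    using survivors3_models3 K(1) unfolding list_all_iff by blast
  then have k: "k < 18" "apply3 M ` set L = set (models3 ! k)"
      "\<And>e. e \<in> set units3 \<Longrightarrow> apply3 M (apply3 N e) = e" "\<And>e. e \<in> set units3 \<Longrightarrow> apply3 N (apply3 M e) = e"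
    unfolding K(2) by (auto simp: list_all_iff)
  have "invertible (mat3 M)"
    using mat3_inverse[OF k(3)] mat3_inverse[OF k(4)] unfolding invertible_def by blast
  then have "invertible (mat3 M ** A)" using A(1) by (rule invertible_mult)
  moreover have "(*v) (mat3 M ** A) ` \<Lambda> = (*v) (mat3 M) ` (*v) A ` \<Lambda>"
    by (simp add: image_image matrix_vector_mul_assoc)
  moreover have "(*v) (mat3 M) ` rep3 ` set L = rep3 ` set (models3 ! k)"
    unfolding k(2)[symmetric] by (simp add: image_image mat3_rep3)
  ultimately show ?thesis using k(1) L(2) that by metis
qed

section \<open>Integration of polynomials by iterated antiderivatives\<close>

text \<open>
  A polynomial is a list of monomials; \<open>(c, i, j, k)\<close> stands for \<open>c x^i y^j z^k\<close>. An affine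
  bound \<open>(c, d, e)\<close> for the last variable stands for \<open>c + d x + e y\<close>.
\<close>

type_synonym polynomial = "(int \<times> nat \<times> nat \<times> nat) list"

type_synonym bound = "int \<times> int \<times> int"

fun peval :: "polynomial \<Rightarrow> real \<Rightarrow> real \<Rightarrow> real \<Rightarrow> real" where
  "peval [] x y z = 0"
| "peval ((c, i, j, k) # p) x y z = of_int c * x ^ i * y ^ j * z ^ k + peval p x y z"

fun beval :: "bound \<Rightarrow> real \<Rightarrow> real \<Rightarrow> real" where
  "beval (c, d, e) x y = of_int c + of_int d * x + of_int e * y"

text \<open>The division is exact under \<open>integrable_coeffs\<close> and meaningless otherwise.
  Integer coefficients keep the evaluation free of fractions.\<close>

fun antiderivative :: "polynomial \<Rightarrow> polynomial" where
  "antiderivative [] = []"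
| "antiderivative ((c, i, j, k) # p) = (c div int (Suc k), i, j, Suc k) # antiderivative p"

fun integrable_coeffs :: "polynomial \<Rightarrow> bool" where
  "integrable_coeffs [] = True"
| "integrable_coeffs ((c, i, j, k) # p) = (if c mod int (Suc k) = 0 then integrable_coeffs p else False)"

fun bmult :: "bound \<Rightarrow> (int \<times> nat \<times> nat) list \<Rightarrow> (int \<times> nat \<times> nat) list" where
  "bmult b [] = []"
| "bmult (c, d, e) ((m, i, j) # p) =
     (if c = 0 then [] else [(c * m, i, j)]) @ (if d = 0 then [] else [(d * m, Suc i, j)]) @
     (if e = 0 then [] else [(e * m, i, Suc j)]) @ bmult (c, d, e) p"

fun bpower :: "bound \<Rightarrow> nat \<Rightarrow> (int \<times> nat \<times> nat) list \<Rightarrow> (int \<times> nat \<times> nat) list" where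
  "bpower b 0 p = p"
| "bpower b (Suc k) p = bmult b (bpower b k p)"

text \<open>Substitutes the bound for the last variable and renames \<open>x, y\<close> to \<open>y, z\<close>.\<close>

fun substitute :: "int \<Rightarrow> bound \<Rightarrow> polynomial \<Rightarrow> polynomial" where
  "substitute s b [] = []"
| "substitute s b ((c, i, j, k) # p) = map (\<lambda>(c, i, j). (s * c, 0, i, j)) (bpower b k [(c, i, j)]) @ substitute s b p"

definition integrate :: "polynomial \<Rightarrow> bound \<times> bound \<Rightarrow> polynomial" where
  "integrate p lh = (let q = antiderivative p in substitute 1 (snd lh) q @ substitute (- 1) (fst lh) q)"

fun constant_term :: "polynomial \<Rightarrow> int" where
  "constant_term [] = 0"
| "constant_term ((c, i, j, k) # p) = (if i = 0 then if j = 0 then if k = 0 then c + constant_term p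
     else constant_term p else constant_term p else constant_term p)"

lemma peval_append: "peval (p @ q) x y z = peval p x y z + peval q x y z"
  by (induction p) auto

lemma peval_antiderivative:
  assumes "integrable_coeffs p"
  shows "((\<lambda>z. peval (antiderivative p) x y z) has_real_derivative peval p x y z) (at z)"
  using assms
proof (induction p)
  case Nil
  have "peval [] x y = (\<lambda>z. 0)" by (rule ext) simp
  then show ?case by simp
next
  case (Cons m p)
  obtain c i j k where m: "m = (c, i, j, k)" by (cases m)
  have dv: "c mod int (Suc k) = 0" and p: "integrable_coeffs p"
    using Cons.prems by (auto simp: m split: if_splits)
  have "int (Suc k) * (c div int (Suc k)) = c" using dv by (simp add: mult_div_mod_eq[symmetric] mod_eq_0_iff_dvd)
  then have c: "real_of_int (c div int (Suc k)) * real (Suc k) = of_int c"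
    by (metis mult.commute of_int_mult of_int_of_nat_eq)
  have "((\<lambda>z. of_int (c div int (Suc k)) * x ^ i * y ^ j * z ^ Suc k) has_real_derivative
      of_int (c div int (Suc k)) * x ^ i * y ^ j * (real (Suc k) * z ^ k)) (at z)"
    by (rule derivative_eq_intros refl | simp)+
  moreover have "of_int (c div int (Suc k)) * x ^ i * y ^ j * (real (Suc k) * z ^ k) = of_int c * x ^ i * y ^ j * z ^ k"
    unfolding c[symmetric] by (simp only: mult_ac)
  ultimately have "((\<lambda>z. of_int (c div int (Suc k)) * x ^ i * y ^ j * z ^ Suc k) has_real_derivative
      of_int c * x ^ i * y ^ j * z ^ k) (at z)" by (rule DERIV_cong)
  from DERIV_add[OF this Cons.IH[OF p]] show ?case unfolding m by simp
qed

lemma continuous_on_peval [continuous_intros]: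
  assumes "continuous_on S f" "continuous_on S g" "continuous_on S h"
  shows "continuous_on S (\<lambda>t. peval p (f t) (g t) (h t))"
proof (induction p)
  case (Cons m p)
  then show ?case by (cases m) (auto intro!: continuous_intros assms)
qed simp

definition peval2 :: "(int \<times> nat \<times> nat) list \<Rightarrow> real \<Rightarrow> real \<Rightarrow> real" where
  "peval2 p x y = (\<Sum>(c, i, j)\<leftarrow>p. of_int c * x ^ i * y ^ j)"

lemma peval2_bmult: "peval2 (bmult b p) x y = beval b x y * peval2 p x y"
  by (induction b p rule: bmult.induct) (auto simp: peval2_def algebra_simps)

lemma peval2_bpower: "peval2 (bpower b k p) x y = beval b x y ^ k * peval2 p x y"
  by (induction k) (simp_all add: peval2_bmult)

lemma peval_map2: "peval (map (\<lambda>(c, i, j). (s * c, 0, i, j)) p) w x y = of_int s * peval2 p x y"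
  by (induction p) (auto simp: peval2_def algebra_simps)

lemma peval_substitute: "peval (substitute s b p) w x y = of_int s * peval p x y (beval b x y)"
proof (induction p)
  case (Cons m p)
  obtain c i j k where "m = (c, i, j, k)" by (cases m)
  then show ?case using Cons
    by (simp add: peval_append peval_map2 peval2_bpower) (simp add: peval2_def algebra_simps)
qed simp

lemma peval_integrate:
  "peval (integrate p (l, h)) w x y = peval (antiderivative p) x y (beval h x y) - peval (antiderivative p) x y (beval l x y)"
  by (simp add: integrate_def Let_def peval_append peval_substitute)

lemma peval_constant_term: "peval p 0 0 0 = of_int (constant_term p)"
  by (induction p rule: constant_term.induct) (auto simp: power_0_left)

text \<open>\<open>None\<close> signals that one of the divisions on the way was not exact.\<close>

definition cell3_integral :: "(bound \<times> bound) \<times> (bound \<times> bound) \<times> (bound \<times> bound) \<Rightarrow> polynomial \<Rightarrow> int option" where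
  "cell3_integral bs p = (let q = integrate p (snd (snd bs)); r = integrate q (fst (snd bs)) in
     if integrable_coeffs p then if integrable_coeffs q then if integrable_coeffs r
     then Some (constant_term (integrate r (fst bs))) else None else None else None)"

text \<open>Each integration moves the remaining variables to the last slots. Thus in the bounds for
  y the coefficient of x is the last one, and the bounds for x are constants.\<close>

definition in_cell3 :: "(bound \<times> bound) \<times> (bound \<times> bound) \<times> (bound \<times> bound) \<Rightarrow> real \<Rightarrow> real \<Rightarrow> real \<Rightarrow> bool" where
  "in_cell3 bs x y z \<longleftrightarrow> (case bs of ((a, b), (l1, h1), (l2, h2)) \<Rightarrow>
     beval a 0 0 \<le> x \<and> x \<le> beval b 0 0 \<and> beval l1 0 x \<le> y \<and> y \<le> beval h1 0 x \<and> beval l2 x y \<le> z \<and> z \<le> beval h2 x y)"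

text \<open>With reversed bounds the antiderivatives would yield a signed value although the section
  is empty.\<close>

definition valid_cell3 :: "(bound \<times> bound) \<times> (bound \<times> bound) \<times> (bound \<times> bound) \<Rightarrow> bool" where
  "valid_cell3 bs \<longleftrightarrow> (case bs of ((a, b), (l1, h1), (l2, h2)) \<Rightarrow> beval a 0 0 \<le> beval b 0 0 \<and>
     (\<forall>x. beval a 0 0 \<le> x \<longrightarrow> x \<le> beval b 0 0 \<longrightarrow> beval l1 0 x \<le> beval h1 0 x \<and>
       (\<forall>y. beval l1 0 x \<le> y \<longrightarrow> y \<le> beval h1 0 x \<longrightarrow> beval l2 x y \<le> beval h2 x y)))"

lemma continuous_on_beval [continuous_intros]:
  assumes "continuous_on S f" "continuous_on S g"
  shows "continuous_on S (\<lambda>t. beval b (f t) (g t))"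
  by (cases b) (auto intro!: continuous_intros assms)

lemma cell3_integral:
  fixes K :: "(real^3) set"
  assumes K: "compact K" "\<And>x y z. vector [x, y, z] \<in> K \<longleftrightarrow> in_cell3 bs x y z"
    and v: "valid_cell3 bs" and I: "cell3_integral bs p = Some I"
  shows "(LINT v:K|lborel. peval p (v $ 1) (v $ 2) (v $ 3)) = of_int I"
proof -
  obtain a b l1 h1 l2 h2 where bs: "bs = ((a, b), (l1, h1), (l2, h2))" by (metis prod.exhaust)
  define q where "q = integrate p (l2, h2)"
  define r where "r = integrate q (l1, h1)"
  have int: "integrable_coeffs p" "integrable_coeffs q" "integrable_coeffs r"
    and I: "I = constant_term (integrate r (a, b))"
    using I unfolding cell3_integral_def bs by (auto simp: Let_def q_def r_def split: if_splits)
  have q: "peval (antiderivative p) x y (beval h2 x y) - peval (antiderivative p) x y (beval l2 x y) = peval q w x y" for w x y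
    by (simp add: q_def peval_integrate)
  have r: "peval (antiderivative q) 0 x (beval h1 0 x) - peval (antiderivative q) 0 x (beval l1 0 x) = peval r 0 0 x" for x
    by (simp add: r_def peval_integrate)
  have "(LINT v:K|lborel. peval p (v $ 1) (v $ 2) (v $ 3)) =
      peval (antiderivative r) 0 0 (beval b 0 0) - peval (antiderivative r) 0 0 (beval a 0 0)"
  proof (rule integral_cell3[OF K(1),
      where Fz = "\<lambda>x y z. peval (antiderivative p) x y z" and Fy = "\<lambda>x y. peval (antiderivative q) 0 x y"
        and a = "beval a 0 0" and b = "beval b 0 0" and ?l1.0 = "\<lambda>x. beval l1 0 x" and ?h1.0 = "\<lambda>x. beval h1 0 x"
        and ?l2.0 = "\<lambda>x y. beval l2 x y" and ?h2.0 = "\<lambda>x y. beval h2 x y"])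
    show "vector [x, y, z] \<in> K \<longleftrightarrow> beval a 0 0 \<le> x \<and> x \<le> beval b 0 0 \<and> beval l1 0 x \<le> y \<and> y \<le> beval h1 0 x \<and>
        beval l2 x y \<le> z \<and> z \<le> beval h2 x y" for x y z
      unfolding K(2) in_cell3_def bs by simp
    show "((\<lambda>z. peval (antiderivative p) x y z) has_real_derivative
        peval p ((vector [x, y, z] :: real^3) $ 1) ((vector [x, y, z] :: real^3) $ 2) ((vector [x, y, z] :: real^3) $ 3)) (at z)" for x y z
      using peval_antiderivative[OF int(1)] by simp
    show "((\<lambda>y. peval (antiderivative q) 0 x y) has_real_derivative
       peval (antiderivative p) x y (beval h2 x y) - peval (antiderivative p) x y (beval l2 x y)) (at y)" for x y
      unfolding q[of _ _ 0] by (rule peval_antiderivative[OF int(2)])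
    show "((\<lambda>x. peval (antiderivative r) 0 0 x) has_real_derivative
       peval (antiderivative q) 0 x (beval h1 0 x) - peval (antiderivative q) 0 x (beval l1 0 x)) (at x)" for x
      unfolding r by (rule peval_antiderivative[OF int(3)])
  qed (use v in \<open>auto simp: valid_cell3_def bs intro!: continuous_intros\<close>)
  also have "\<dots> = peval (integrate r (a, b)) 0 0 0" by (simp add: peval_integrate)
  finally show ?thesis by (simp add: peval_constant_term I)
qed

definition cell2_integral :: "(bound \<times> bound) \<times> (bound \<times> bound) \<Rightarrow> polynomial \<Rightarrow> int option" where
  "cell2_integral bs q = (let r = integrate q (snd bs) in
     if integrable_coeffs q then if integrable_coeffs r
     then Some (constant_term (integrate r (fst bs))) else None else None)"

definition in_cell2 :: "(bound \<times> bound) \<times> (bound \<times> bound) \<Rightarrow> real \<Rightarrow> real \<Rightarrow> bool" where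
  "in_cell2 bs x y \<longleftrightarrow> (case bs of ((a, b), (l1, h1)) \<Rightarrow>
     beval a 0 0 \<le> x \<and> x \<le> beval b 0 0 \<and> beval l1 0 x \<le> y \<and> y \<le> beval h1 0 x)"

definition valid_cell2 :: "(bound \<times> bound) \<times> (bound \<times> bound) \<Rightarrow> bool" where
  "valid_cell2 bs \<longleftrightarrow> (case bs of ((a, b), (l1, h1)) \<Rightarrow> beval a 0 0 \<le> beval b 0 0 \<and>
     (\<forall>x. beval a 0 0 \<le> x \<longrightarrow> x \<le> beval b 0 0 \<longrightarrow> beval l1 0 x \<le> beval h1 0 x))"

lemma cell2_integral:
  fixes K :: "(real^2) set"
  assumes K: "compact K" "\<And>x y. vector [x, y] \<in> K \<longleftrightarrow> in_cell2 bs x y"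
    and v: "valid_cell2 bs" and I: "cell2_integral bs q = Some I"
  shows "(LINT v:K|lborel. peval q 0 (v $ 1) (v $ 2)) = of_int I"
proof -
  obtain a b l1 h1 where bs: "bs = ((a, b), (l1, h1))" by (metis prod.exhaust)
  define r where "r = integrate q (l1, h1)"
  have int: "integrable_coeffs q" "integrable_coeffs r"
    and I: "I = constant_term (integrate r (a, b))"
    using I unfolding cell2_integral_def bs by (auto simp: Let_def r_def split: if_splits)
  have r: "peval (antiderivative q) 0 x (beval h1 0 x) - peval (antiderivative q) 0 x (beval l1 0 x) = peval r 0 0 x" for x
    by (simp add: r_def peval_integrate)
  have "(LINT v:K|lborel. peval q 0 (v $ 1) (v $ 2)) =
      peval (antiderivative r) 0 0 (beval b 0 0) - peval (antiderivative r) 0 0 (beval a 0 0)"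
  proof (rule integral_cell2[OF K(1), where Fy = "\<lambda>x y. peval (antiderivative q) 0 x y"
        and a = "beval a 0 0" and b = "beval b 0 0" and ?l1.0 = "\<lambda>x. beval l1 0 x" and ?h1.0 = "\<lambda>x. beval h1 0 x"])
    show "vector [x, y] \<in> K \<longleftrightarrow> beval a 0 0 \<le> x \<and> x \<le> beval b 0 0 \<and> beval l1 0 x \<le> y \<and> y \<le> beval h1 0 x" for x y
      unfolding K(2) in_cell2_def bs by simp
    show "((\<lambda>y. peval (antiderivative q) 0 x y) has_real_derivative
       peval q 0 ((vector [x, y] :: real^2) $ 1) ((vector [x, y] :: real^2) $ 2)) (at y)" for x y
      using peval_antiderivative[OF int(1)] by simp
    show "((\<lambda>x. peval (antiderivative r) 0 0 x) has_real_derivative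
       peval (antiderivative q) 0 x (beval h1 0 x) - peval (antiderivative q) 0 x (beval l1 0 x)) (at x)" for x
      unfolding r by (rule peval_antiderivative[OF int(2)])
  qed (use v in \<open>auto simp: valid_cell2_def bs intro!: continuous_intros\<close>)
  also have "\<dots> = peval (integrate r (a, b)) 0 0 0" by (simp add: peval_integrate)
  finally show ?thesis by (simp add: peval_constant_term I)
qed

section \<open>Polystable threefolds\<close>

text \<open>Vertices of the polytopes of the models, in the order of \<open>models3\<close>; a
  simple 3-polytope with r facets has 2r - 4 of them.\<close>

definition vertices3 :: "(int \<times> int \<times> int) list list" where
  "vertices3 = [[(3, - 1, - 1), (- 1, 3, - 1), (- 1, - 1, 3), (- 1, - 1, - 1)],
     [(1, 0, - 1), (1, - 1, 0), (- 1, 4, - 1), (- 1, - 1, 4), (1, - 1, - 1), (- 1, - 1, - 1)],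
     [(2, - 1, 0), (- 1, 2, 0), (- 1, - 1, 3), (2, - 1, - 1), (- 1, 2, - 1), (- 1, - 1, - 1)],
     [(1, 1, - 1), (1, - 1, 1), (- 1, 3, - 1), (- 1, - 1, 3), (1, - 1, - 1), (- 1, - 1, - 1)],
     [(2, - 1, 1), (- 1, 2, 1), (2, - 1, - 1), (- 1, 2, - 1), (- 1, - 1, 1), (- 1, - 1, - 1)],
     [(0, 2, - 1), (0, - 1, 2), (1, 0, - 1), (1, - 1, 0), (- 1, 3, - 1), (- 1, - 1, 3), (1, - 1, - 1), (- 1, - 1, - 1)],
     [(1, 0, 0), (- 1, 2, 0), (1, - 1, 1), (- 1, - 1, 3), (1, 0, - 1), (- 1, 2, - 1), (1, - 1, - 1), (- 1, - 1, - 1)],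
     [(2, - 1, 0), (- 1, 2, 0), (1, - 1, 1), (- 1, 1, 1), (2, - 1, - 1), (- 1, 2, - 1), (- 1, - 1, 1), (- 1, - 1, - 1)],
     [(1, 0, 0), (- 1, 2, 2), (1, 0, - 1), (- 1, 2, - 1), (1, - 1, 0), (- 1, - 1, 2), (1, - 1, - 1), (- 1, - 1, - 1)],
     [(1, 0, 1), (1, 0, - 1), (- 1, 2, 1), (- 1, 2, - 1), (1, - 1, 1), (1, - 1, - 1), (- 1, - 1, 1), (- 1, - 1, - 1)],
     [(1, 0, - 1), (1, 0, 2), (- 1, 2, - 1), (- 1, 2, 0), (1, - 1, - 1), (1, - 1, 2), (- 1, - 1, - 1), (- 1, - 1, 0)],
     [(1, 1, 1), (1, 1, - 1), (1, - 1, 1), (1, - 1, - 1), (- 1, 1, 1), (- 1, 1, - 1), (- 1, - 1, 1), (- 1, - 1, - 1)],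
     [(1, 0, 0), (0, 1, 0), (1, - 1, 1), (- 1, 1, 1), (- 1, - 1, 3), (1, 0, - 1), (0, 1, - 1), (1, - 1, - 1), (- 1, 1, - 1), (- 1, - 1, - 1)],
     [(1, 0, 0), (0, 1, 1), (1, 0, - 1), (0, 1, - 1), (1, - 1, 0), (- 1, 1, 2), (- 1, - 1, 2), (1, - 1, - 1), (- 1, 1, - 1), (- 1, - 1, - 1)],
     [(1, 0, 0), (1, 0, 2), (0, 1, - 1), (- 1, 2, - 1), (- 1, 2, 0), (1, - 1, 0), (1, - 1, 2), (0, - 1, - 1), (- 1, - 1, - 1), (- 1, - 1, 0)],
     [(1, 0, 1), (1, 0, - 1), (0, 1, 1), (0, 1, - 1), (1, - 1, 1), (1, - 1, - 1), (- 1, 1, 1), (- 1, 1, - 1), (- 1, - 1, 1), (- 1, - 1, - 1)],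
     [(1, 0, 0), (1, 0, 1), (0, 1, - 1), (0, 1, 1), (- 1, 2, - 1), (- 1, 2, 0), (1, - 1, 0), (1, - 1, 1), (0, - 1, - 1), (0, - 1, 1), (- 1, - 1, - 1), (- 1, - 1, 0)],
     [(1, 1, 0), (1, - 1, 0), (1, 1, 1), (1, - 1, 1), (0, 1, - 1), (0, - 1, - 1), (0, 1, 1), (- 1, 1, - 1), (- 1, 1, 0), (0, - 1, 1), (- 1, - 1, - 1), (- 1, - 1, 0)]]"

fun cross3 :: "int \<times> int \<times> int \<Rightarrow> int \<times> int \<times> int \<Rightarrow> int \<times> int \<times> int" where
  "cross3 (a, b, c) (d, e, f) = (b * f - c * e, c * d - a * f, a * e - b * d)"

text \<open>
  If the determinant of \<open>a, b, c\<close> is \<open>1\<close> or \<open>-1\<close>, its product with the three cross products is the dual basis.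
\<close>

fun dual3 :: "(int \<times> int \<times> int) list \<Rightarrow> ((int \<times> int \<times> int) \<times> int \<times> int \<times> int) list" where
  "dual3 [a, b, c] = (let m = dot3 a (cross3 b c); z = (0, 0, 0) in
     [(a, comb3 z m (cross3 b c)), (b, comb3 z m (cross3 c a)), (c, comb3 z m (cross3 a b))])"
| "dual3 _ = []"

definition dual_check3 :: "((int \<times> int \<times> int) \<times> int \<times> int \<times> int) list \<Rightarrow> bool" where
  "dual_check3 S \<longleftrightarrow> list_all (\<lambda>(a, d). list_all (\<lambda>(b, e). dot3 b d = (if b = a then 1 else 0)) S) S \<and>
     list_all (\<lambda>u. foldr (\<lambda>(a, d) x. comb3 x (dot3 u d) a) S (0, 0, 0) = u) units3 \<and> distinct (map fst S)"

definition fan_check3 :: "(int \<times> int \<times> int) list \<Rightarrow> (int \<times> int \<times> int) list \<Rightarrow> bool" where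
  "fan_check3 L W \<longleftrightarrow> W \<noteq> [] \<and> list_all (\<lambda>a. list_ex (\<lambda>v. dot3 a v = -1) W) L \<and>
     list_all (\<lambda>v. let T = filter (\<lambda>a. dot3 a v = -1) L in
       list_all (\<lambda>a. -1 \<le> dot3 a v) L \<and> length T = 3 \<and> map fst (dual3 T) = T \<and> dual_check3 (dual3 T) \<and>
       list_all (\<lambda>a. list_ex (\<lambda>w. dot3 a w \<noteq> -1 \<and> list_all (\<lambda>b. b = a \<or> dot3 b w = -1) T) W) T) W"

lemma models3_fan_check: "list_all (\<lambda>k. fan_check3 (models3 ! k) (vertices3 ! k)) [0..<18]"
  by code_simp

text \<open>Reconstructing a vector from its pairings with the dual vectors is linear, so it
  suffices that the check reproduces the unit vectors.\<close>

lemma dual_check3_sound: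
  assumes "dual_check3 S"
  shows "lattice_basis (rep3 ` fst ` set S)"
proof -
  note c = assms[unfolded dual_check3_def list_all_iff]
  have all: "\<forall>(a, d)\<in>set S. \<forall>(b, e)\<in>set S. dot3 b d = (if b = a then 1 else 0)"
    by (rule conjunct1[OF c])
  have ex: "foldr (\<lambda>(a, d) x. comb3 x (dot3 u d) a) S (0, 0, 0) = u" if "u \<in> set units3" for u
    by (rule bspec[OF conjunct1[OF conjunct2[OF c]] that])
  have dist: "distinct (map fst S)" by (rule conjunct2[OF conjunct2[OF c]])
  have dual: "dot3 b d = (if b = a then 1 else 0)" if "(a, d) \<in> set S" "(b, e) \<in> set S" for a d b e
    using bspec[OF bspec[OF all that(1), unfolded prod.case] that(2)] by simp
  define D where "D z = rep3 (the (map_of S (inv rep3 z)))" for z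
  have D: "D (rep3 a) = rep3 d" if "(a, d) \<in> set S" for a d
  proof -
    have "map_of S a = Some d" using map_of_eq_Some_iff[OF dist] that by blast
    then show ?thesis by (simp add: D_def inv_f_f[OF inj_rep3])
  qed
  have inj: "inj_on (\<lambda>p. rep3 (fst p)) (set S)"
  proof (rule inj_onI)
    fix p q assume "p \<in> set S" "q \<in> set S" "rep3 (fst p) = rep3 (fst q)"
    then show "p = q" using dist inj_rep3 by (metis distinct_map inj_eq inj_on_def)
  qed
  have "dual_basis (rep3 ` fst ` set S) D" unfolding dual_basis_def
  proof (intro conjI ballI allI)
    fix x y assume "x \<in> rep3 ` fst ` set S" "y \<in> rep3 ` fst ` set S"
    then obtain a d b e where ab: "x = rep3 a" "(a, d) \<in> set S" "y = rep3 b" "(b, e) \<in> set S" by auto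
    show "idot y (D x) = (if x = y then 1 else 0)"
      using dual[OF ab(2,4)] inj_rep3 by (auto simp: ab(1,3) D[OF ab(2)] dot3_rep3 inj_eq)
  next
    fix z :: "int^3"
    have fold: "rep3 (foldr (\<lambda>(a, d) x. comb3 x (dot3 u d) a) S' (0, 0, 0)) = (\<Sum>(a, d)\<leftarrow>S'. idot (rep3 u) (rep3 d) *s rep3 a)" for u S'
    proof (induction S')
      case Nil
      then show ?case by (simp add: vec_eq_iff forall_3)
    next
      case (Cons p S')
      then show ?case by (cases p) (simp add: rep3_comb3 dot3_rep3 add.commute)
    qed
    define h where "h z = (\<Sum>(a, d)\<leftarrow>S. idot z (rep3 d) *s rep3 a)" for z
    have hsum: "h z = (\<Sum>p\<in>set S. idot z (rep3 (snd p)) *s rep3 (fst p))" for z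
      unfolding h_def using dist by (subst sum_list_distinct_conv_sum_set) (auto simp: distinct_map case_prod_unfold)
    have unit: "h (axis i 1) = axis i 1" for i
    proof -
      obtain u where u: "u \<in> set units3" "axis i 1 = rep3 u" using rep3_units3 by blast
      show ?thesis unfolding u(2) h_def fold[symmetric] ex[OF u(1)] ..
    qed
    have hlin: "h (\<Sum>i\<in>UNIV. z $ i *s axis i 1) = (\<Sum>i\<in>UNIV. z $ i *s h (axis i 1))"
    proof -
      have "h (\<Sum>i\<in>UNIV. z $ i *s axis i 1) = (\<Sum>p\<in>set S. \<Sum>i\<in>UNIV. (z $ i * idot (axis i 1) (rep3 (snd p))) *s rep3 (fst p))"
        unfolding hsum by (simp only: idot_sum_left idot_smult_left smult_sum_left)
      also have "\<dots> = (\<Sum>i\<in>UNIV. z $ i *s h (axis i 1))"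
        unfolding hsum smult_sum_right vector_smult_assoc by (rule sum.swap)
      finally show ?thesis .
    qed
    have "h z = z" using hlin unfolding unit vec_expand_axis[of z, symmetric] .
    also have "h z = (\<Sum>p\<in>set S. idot z (D (rep3 (fst p))) *s rep3 (fst p))"
      unfolding hsum using D by (intro sum.cong) auto
    also have "\<dots> = (\<Sum>a\<in>(\<lambda>p. rep3 (fst p)) ` set S. idot z (D a) *s a)"
      by (simp add: sum.reindex[OF inj])
    also have "(\<lambda>p. rep3 (fst p)) ` set S = rep3 ` fst ` set S" by (simp add: image_image)
    finally show "z = (\<Sum>a\<in>rep3 ` fst ` set S. idot z (D a) *s a)" by simp
  qed simp
  then show ?thesis by (rule dual_basis_imp_lattice_basis)
qed

lemma fan_check3_sound:
  assumes "fan_check3 L W"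
  shows "toric_Fano (rep3 ` set L)"
proof (rule toric_FanoI[where W = "rep3 ` set W"])
  let ?T = "\<lambda>v. filter (\<lambda>a. dot3 a v = -1) L"
  note c = assms[unfolded fan_check3_def Let_def list_all_iff list_ex_iff]
  have W1: "W \<noteq> []" by (rule conjunct1[OF c])
  have v: "(\<forall>a\<in>set L. -1 \<le> dot3 a v) \<and> length (?T v) = 3 \<and> map fst (dual3 (?T v)) = ?T v \<and> dual_check3 (dual3 (?T v)) \<and>
      (\<forall>a\<in>set (?T v). \<exists>w\<in>set W. dot3 a w \<noteq> -1 \<and> (\<forall>b\<in>set (?T v). b = a \<or> dot3 b w = -1))" if "v \<in> set W" for v
    by (rule bspec[OF conjunct2[OF conjunct2[OF c]] that])
  have T: "tight (rep3 ` set L) (rep3 v) = rep3 ` set (?T v)" for v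
    by (auto simp: tight_def dot3_rep3)
  show "finite (rep3 ` set L)" "finite (rep3 ` set W)" "rep3 ` set W \<noteq> {}" using W1 by simp_all
  fix w assume "w \<in> rep3 ` set W"
  then obtain x where x: "w = rep3 x" "x \<in> set W" by blast
  have vx: "\<forall>a\<in>set L. -1 \<le> dot3 a x" "map fst (dual3 (?T x)) = ?T x" "dual_check3 (dual3 (?T x))"
      "\<forall>a\<in>set (?T x). \<exists>w\<in>set W. dot3 a w \<noteq> -1 \<and> (\<forall>b\<in>set (?T x). b = a \<or> dot3 b w = -1)"
    using v[OF x(2)] by blast+
  have "set (?T x) = fst ` set (dual3 (?T x))" using vx(2) by (metis set_map)
  then have "lattice_basis (rep3 ` set (?T x))" using dual_check3_sound[OF vx(3)] by simp
  then show "fan_vertex (rep3 ` set L) w"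
    using vx(1) unfolding fan_vertex_def x(1) T by (auto simp: dot3_rep3)
  fix a assume "a \<in> tight (rep3 ` set L) w"
  then obtain y where y: "a = rep3 y" "y \<in> set (?T x)" unfolding x(1) T by blast
  obtain w' where w': "w' \<in> set W" "dot3 y w' \<noteq> -1" "\<forall>b\<in>set (?T x). b = y \<or> dot3 b w' = -1"
    using bspec[OF vx(4) y(2)] by blast
  show "\<exists>w'\<in>rep3 ` set W. (\<forall>b\<in>tight (rep3 ` set L) w - {a}. idot b w' = -1) \<and> idot a w' \<noteq> -1"
    unfolding x(1) T y(1)
  proof (intro bexI[of _ "rep3 w'"] conjI ballI)
    fix b assume "b \<in> rep3 ` set (?T x) - {rep3 y}"
    then obtain z where z: "b = rep3 z" "z \<in> set (?T x)" "z \<noteq> y" by blast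
    show "idot b (rep3 w') = -1" using bspec[OF w'(3) z(2)] z(3) unfolding z(1) dot3_rep3[symmetric] by simp
  qed (use w' in \<open>simp_all add: dot3_rep3[symmetric]\<close>)
next
  fix a assume "a \<in> rep3 ` set L"
  then obtain y where y: "a = rep3 y" "y \<in> set L" by blast
  have "\<exists>v\<in>set W. dot3 y v = -1"
    by (rule bspec[OF conjunct1[OF conjunct2[OF assms[unfolded fan_check3_def Let_def list_all_iff list_ex_iff]]] y(2)])
  then obtain w where "w \<in> set W" "dot3 y w = -1" by blast
  then show "\<exists>w\<in>rep3 ` set W. a \<in> tight (rep3 ` set L) w"
    using y by (intro bexI[of _ "rep3 w"]) (simp_all add: tight_def dot3_rep3[symmetric])
qed

lemma toric_Fano_models3:
  assumes "k < 18"
  shows "toric_Fano (rep3 ` set (models3 ! k))"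
proof (rule fan_check3_sound)
  have "k \<in> set [0..<18]" using assms by simp
  then show "fan_check3 (models3 ! k) (vertices3 ! k)"
    using models3_fan_check unfolding list_all_iff by blast
qed

text \<open>Built from addition and membership alone, hence unchanged by lattice automorphisms. The
  last entry counts the ordered triples of generators with sum 0. Together the four entries separate
  the eighteen models.\<close>

definition fan_invariant :: "(int^'n) set \<Rightarrow> nat \<times> bool \<times> nat \<times> nat" where
  "fan_invariant \<Lambda> = (card \<Lambda>, \<Sum>\<Lambda> \<in> \<Lambda>, card {a \<in> \<Lambda>. a + \<Sum>\<Lambda> \<in> \<Lambda>}, card {p \<in> \<Lambda> \<times> \<Lambda>. - (fst p + snd p) \<in> \<Lambda>})"

lemma fan_invariant_image:
  fixes A :: "int^'n^'n"
  assumes A: "invertible A"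
  shows "fan_invariant ((*v) A ` \<Lambda>) = fan_invariant \<Lambda>"
proof -
  obtain B where "B ** A = mat 1" using A by (auto simp: invertible_def)
  then have BA: "B *v (A *v x) = x" for x by (simp add: matrix_vector_mul_assoc)
  then have inj: "inj ((*v) A)" by (metis injI)
  have inj': "inj_on ((*v) A) S" for S using inj by (rule inj_on_subset) simp
  have s: "\<Sum>((*v) A ` \<Lambda>) = A *v \<Sum>\<Lambda>"
    by (simp add: sum.reindex[OF inj'] matrix_vector_mult_sum_int)
  have m: "A *v x \<in> (*v) A ` \<Lambda> \<longleftrightarrow> x \<in> \<Lambda>" for x by (rule inj_image_mem_iff[OF inj])
  have "{a \<in> (*v) A ` \<Lambda>. a + A *v \<Sum>\<Lambda> \<in> (*v) A ` \<Lambda>} = (*v) A ` {a \<in> \<Lambda>. A *v a + A *v \<Sum>\<Lambda> \<in> (*v) A ` \<Lambda>}"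
    by blast
  then have "{a \<in> (*v) A ` \<Lambda>. a + A *v \<Sum>\<Lambda> \<in> (*v) A ` \<Lambda>} = (*v) A ` {a \<in> \<Lambda>. a + \<Sum>\<Lambda> \<in> \<Lambda>}"
    by (simp only: matrix_vector_right_distrib[symmetric] m)
  moreover have "{p \<in> (*v) A ` \<Lambda> \<times> (*v) A ` \<Lambda>. - (fst p + snd p) \<in> (*v) A ` \<Lambda>} =
      map_prod ((*v) A) ((*v) A) ` {p \<in> \<Lambda> \<times> \<Lambda>. - (fst p + snd p) \<in> \<Lambda>}"
  proof -
    have n: "- (A *v x + A *v y) = A *v (- (x + y))" for x y
      by (simp add: matrix_vector_mult_def vec_eq_iff sum_negf sum.distrib sum_subtractf algebra_simps)
    have "{p \<in> (*v) A ` \<Lambda> \<times> (*v) A ` \<Lambda>. - (fst p + snd p) \<in> (*v) A ` \<Lambda>} =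
        map_prod ((*v) A) ((*v) A) ` {p \<in> \<Lambda> \<times> \<Lambda>. - (A *v fst p + A *v snd p) \<in> (*v) A ` \<Lambda>}"
      by (force simp del: minus_add_distrib)
    then show ?thesis by (simp only: n m)
  qed
  moreover have "inj_on (map_prod ((*v) A) ((*v) A)) S" for S
    by (rule inj_on_subset[OF map_prod_inj_on[OF inj inj]]) simp
  ultimately show ?thesis unfolding fan_invariant_def s m by (simp add: card_image inj')
qed

definition invariant3 :: "(int \<times> int \<times> int) list \<Rightarrow> nat \<times> bool \<times> nat \<times> nat" where
  "invariant3 L = (let s = sum3 L in (length L, List.member L s, length (filter (\<lambda>a. List.member L (add3 a s)) L),
     length (filter (\<lambda>p. List.member L (comb3 (0, 0, 0) (-1) (add3 (fst p) (snd p)))) (List.product L L))))"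

lemma fan_invariant_rep3:
  assumes d: "distinct L"
  shows "fan_invariant (rep3 ` set L) = invariant3 L"
proof -
  have injs: "inj_on rep3 S" for S using inj_rep3 by (rule inj_on_subset) simp
  have m: "rep3 x \<in> rep3 ` set L \<longleftrightarrow> List.member L x" for x
    by (simp add: inj_image_mem_iff[OF inj_rep3])
  have add: "rep3 x + rep3 y = rep3 (add3 x y)" for x y
    by (cases x; cases y) (simp add: vec_eq_iff forall_3)
  have neg: "- rep3 x = rep3 (comb3 (0, 0, 0) (-1) x)" for x
    by (cases x) (simp add: vec_eq_iff forall_3)
  have s: "\<Sum>(rep3 ` set L) = rep3 (sum3 L)"
    by (simp add: sum.reindex[OF injs] sum3_distinct[OF d] vec_eq_iff forall_3)
  have "{a \<in> rep3 ` set L. a + rep3 (sum3 L) \<in> rep3 ` set L} = rep3 ` {a \<in> set L. rep3 a + rep3 (sum3 L) \<in> rep3 ` set L}"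
    by blast
  also have "\<dots> = rep3 ` set (filter (\<lambda>a. List.member L (add3 a (sum3 L))) L)"
    by (simp only: add m set_filter)
  finally have s1: "{a \<in> rep3 ` set L. a + rep3 (sum3 L) \<in> rep3 ` set L} = rep3 ` set (filter (\<lambda>a. List.member L (add3 a (sum3 L))) L)" .
  have s2: "{p \<in> rep3 ` set L \<times> rep3 ` set L. - (fst p + snd p) \<in> rep3 ` set L} =
      map_prod rep3 rep3 ` set (filter (\<lambda>p. List.member L (comb3 (0, 0, 0) (-1) (add3 (fst p) (snd p)))) (List.product L L))"
  proof -
    have "{p \<in> rep3 ` set L \<times> rep3 ` set L. - (fst p + snd p) \<in> rep3 ` set L} =
        map_prod rep3 rep3 ` {p \<in> set L \<times> set L. - (rep3 (fst p) + rep3 (snd p)) \<in> rep3 ` set L}"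
      by (force simp del: minus_add_distrib rep3.simps)
    then show ?thesis by (simp only: add neg m set_filter set_product)
  qed
  have "inj_on (map_prod rep3 rep3) S" for S
    by (rule inj_on_subset[OF map_prod_inj_on[OF inj_rep3 inj_rep3]]) simp
  then have card: "distinct F \<Longrightarrow> card (rep3 ` set F) = length F"
      "distinct G \<Longrightarrow> card (map_prod rep3 rep3 ` set G) = length G" for F G
    by (simp_all add: card_image injs distinct_card)
  have "distinct (List.product L L)" using d by (simp add: distinct_product)
  then show ?thesis
    using d by (simp only: fan_invariant_def invariant3_def Let_def s s1 s2 m card distinct_filter)
qed

lemma invariants_models3: "list_all distinct models3 \<and> distinct (map invariant3 models3) \<and> length models3 = 18"
  by code_simp

lemma models3_inequivalent:
  assumes "i < 18" "j < 18" "i \<noteq> j" "invertible A"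
  shows "(*v) A ` rep3 ` set (models3 ! i) \<noteq> rep3 ` set (models3 ! j)"
proof
  assume "(*v) A ` rep3 ` set (models3 ! i) = rep3 ` set (models3 ! j)"
  then have "fan_invariant (rep3 ` set (models3 ! i)) = fan_invariant (rep3 ` set (models3 ! j))"
    using fan_invariant_image[OF assms(4), of "rep3 ` set (models3 ! i)"] by simp
  moreover have "distinct (models3 ! i)" "distinct (models3 ! j)" "length models3 = 18"
    using invariants_models3 assms by (auto simp: list_all_iff)
  ultimately have "map invariant3 models3 ! i = map invariant3 models3 ! j"
    using assms by (simp add: fan_invariant_rep3)
  then show False
    using invariants_models3 assms by (subst (asm) nth_eq_iff_index_eq) auto
qed

section \<open>Certificates for the models of threefolds\<close>

definition polyhedron3 :: "(int \<times> int \<times> int) list \<Rightarrow> real \<Rightarrow> real \<Rightarrow> real \<Rightarrow> bool" where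
  "polyhedron3 L x y z \<longleftrightarrow> list_all (\<lambda>(a, b, c). 0 \<le> of_int a * x + of_int b * y + of_int c * z + 1) L"

lemma polytope_rep3: "v \<in> anticanonical_polytope (rep3 ` set L) \<longleftrightarrow> polyhedron3 L (v $ 1) (v $ 2) (v $ 3)"
proof -
  have "vec_of_int (rep3 p) \<bullet> v = of_int (fst p) * v $ 1 + of_int (fst (snd p)) * v $ 2 + of_int (snd (snd p)) * v $ 3" for p
    by (simp add: inner_vec_def sum_3 vec_of_int_def)
  then show ?thesis by (auto simp: anticanonical_polytope_def polyhedron3_def list_all_iff)
qed

text \<open>
  The multiples of \<open>V\<close> and of \<open>(V - 1) x_i\<close> whose integrals have to vanish, where
  \<open>V\<close> is the affine function with numerators \<open>c\<close> over the denominator \<open>D\<close>; the factor \<open>4320\<close>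
  keeps the coefficients of the iterated antiderivatives integral.
\<close>

fun moment_polynomials3 :: "int \<times> int \<times> int \<times> int \<Rightarrow> int \<Rightarrow> polynomial list" where
  "moment_polynomials3 (a, b, c, d) D = (let a' = 4320 * a; b' = 4320 * b; c' = 4320 * c; d' = 4320 * d; e' = 4320 * (d - D) in
    [[(a', 1, 0, 0), (b', 0, 1, 0), (c', 0, 0, 1), (d', 0, 0, 0)],
     [(a', 2, 0, 0), (b', 1, 1, 0), (c', 1, 0, 1), (e', 1, 0, 0)],
     [(a', 1, 1, 0), (b', 0, 2, 0), (c', 0, 1, 1), (e', 0, 1, 0)],
     [(a', 1, 0, 1), (b', 0, 1, 1), (c', 0, 0, 2), (e', 0, 0, 1)]])"

text \<open>The two inequalities of \<open>affine_certificate\<close> for n = 3, multiplied by the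
  denominator \<open>D\<close>; the final -1 is the slack \<epsilon> = 1/D.\<close>

fun affine_bounds3 :: "int \<times> int \<times> int \<times> int \<Rightarrow> int \<Rightarrow> real \<Rightarrow> real \<Rightarrow> real \<Rightarrow> bool" where
  "affine_bounds3 (a, b, c, d) D x y z \<longleftrightarrow> 0 \<le> of_int a * x + of_int b * y + of_int c * z + of_int (d + 3 * D) \<and>
     4 * (of_int a * x + of_int b * y + of_int c * z + of_int d) \<le> of_int (5 * D - d - 1)"

lemma certificate3:
  assumes F: "toric_Fano (rep3 ` set L)" and D: "D > 0"
    and I: "\<And>p. p \<in> set (moment_polynomials3 c D) \<Longrightarrow>
      (LINT v:anticanonical_polytope (rep3 ` set L)|lborel. peval p (v $ 1) (v $ 2) (v $ 3)) = 0"
    and bounds: "\<And>x y z. polyhedron3 L x y z \<Longrightarrow> affine_bounds3 c D x y z"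
  shows "polystability_certificate (rep3 ` set L)"
proof -
  interpret lattice_polytope "rep3 ` set L"
    using F toric_Fano_nonzero[OF F] by unfold_locales (auto simp: toric_Fano_def)
  obtain a1 a2 a3 d where c: "c = (a1, a2, a3, d)" by (cases c)
  define V where "V x = (of_int a1 * x $ 1 + of_int a2 * x $ 2 + of_int a3 * x $ 3 + of_int d) / of_int D" for x :: "real^3"
  have Vaff: "affine_function V"
  proof -
    have "V = (\<lambda>x. (vector [of_int a1 / of_int D, of_int a2 / of_int D, of_int a3 / of_int D] :: real^3) \<bullet> x + of_int d / of_int D)"
      by (simp add: V_def fun_eq_iff inner_vec_def sum_3 add_divide_distrib)
    then show ?thesis unfolding affine_function_def by blast
  qed
  have DV: "of_int D * V x = of_int a1 * x $ 1 + of_int a2 * x $ 2 + of_int a3 * x $ 3 + of_int d" for x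
    using D by (simp add: V_def)
  let ?\<Lambda> = "rep3 ` set L"
  have zero: "interior_integral ?\<Lambda> g = 0"
    if "(LINT v:P|lborel. peval p (v $ 1) (v $ 2) (v $ 3)) = 0" "\<And>v. peval p (v $ 1) (v $ 2) (v $ 3) = 4320 * of_int D * g v" for p g
  proof -
    have "4320 * of_int D * interior_integral ?\<Lambda> g = 0"
      unfolding interior_integral_cmult[symmetric] using that by (simp add: interior_integral_def)
    then show ?thesis using D by simp
  qed
  have ident: "4320 * of_int D * (V v * t - t) =
      4320 * ((of_int a1 * v $ 1 + of_int a2 * v $ 2 + of_int a3 * v $ 3 + of_int d) * t - of_int D * t)" for v t
    unfolding DV[symmetric] by (simp add: algebra_simps)
  have I0: "interior_integral ?\<Lambda> V = 0"
  proof (rule zero[OF I[of "[(4320 * a1, 1, 0, 0), (4320 * a2, 0, 1, 0), (4320 * a3, 0, 0, 1), (4320 * d, 0, 0, 0)]"]])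
    show "peval [(4320 * a1, 1, 0, 0), (4320 * a2, 0, 1, 0), (4320 * a3, 0, 0, 1), (4320 * d, 0, 0, 0)] (v $ 1) (v $ 2) (v $ 3) =
        4320 * of_int D * V v" for v
      unfolding mult.assoc[of _ "of_int D"] DV by (simp add: algebra_simps)
  qed (simp add: c Let_def)
  have I1: "interior_integral ?\<Lambda> (\<lambda>x. V x * x $ 1 - x $ 1) = 0"
  proof (rule zero[OF I[of "[(4320 * a1, 2, 0, 0), (4320 * a2, 1, 1, 0), (4320 * a3, 1, 0, 1), (4320 * (d - D), 1, 0, 0)]"]])
    show "peval [(4320 * a1, 2, 0, 0), (4320 * a2, 1, 1, 0), (4320 * a3, 1, 0, 1), (4320 * (d - D), 1, 0, 0)] (v $ 1) (v $ 2) (v $ 3) =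
        4320 * of_int D * (V v * v $ 1 - v $ 1)" for v
      unfolding ident by (simp add: algebra_simps power2_eq_square)
  qed (simp add: c Let_def)
  have I2: "interior_integral ?\<Lambda> (\<lambda>x. V x * x $ 2 - x $ 2) = 0"
  proof (rule zero[OF I[of "[(4320 * a1, 1, 1, 0), (4320 * a2, 0, 2, 0), (4320 * a3, 0, 1, 1), (4320 * (d - D), 0, 1, 0)]"]])
    show "peval [(4320 * a1, 1, 1, 0), (4320 * a2, 0, 2, 0), (4320 * a3, 0, 1, 1), (4320 * (d - D), 0, 1, 0)] (v $ 1) (v $ 2) (v $ 3) =
        4320 * of_int D * (V v * v $ 2 - v $ 2)" for v
      unfolding ident by (simp add: algebra_simps power2_eq_square)
  qed (simp add: c Let_def)
  have I3: "interior_integral ?\<Lambda> (\<lambda>x. V x * x $ 3 - x $ 3) = 0"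
  proof (rule zero[OF I[of "[(4320 * a1, 1, 0, 1), (4320 * a2, 0, 1, 1), (4320 * a3, 0, 0, 2), (4320 * (d - D), 0, 0, 1)]"]])
    show "peval [(4320 * a1, 1, 0, 1), (4320 * a2, 0, 1, 1), (4320 * a3, 0, 0, 2), (4320 * (d - D), 0, 0, 1)] (v $ 1) (v $ 2) (v $ 3) =
        4320 * of_int D * (V v * v $ 3 - v $ 3)" for v
      unfolding ident by (simp add: algebra_simps power2_eq_square)
  qed (simp add: c Let_def)
  show ?thesis
  proof (rule affine_certificate[OF Vaff I0])
    have "\<forall>i. interior_integral ?\<Lambda> (\<lambda>x. V x * x $ i - x $ i) = 0"
      unfolding forall_3 using I1 I2 I3 by blast
    then show "interior_integral ?\<Lambda> (\<lambda>x. V x * x $ i - x $ i) = 0" for i ..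
    show "0 < 1 / real_of_int D" using D by simp
    fix x assume "x \<in> P"
    then have "affine_bounds3 c D (x $ 1) (x $ 2) (x $ 3)" using bounds polytope_rep3 by blast
    then have "0 \<le> of_int D * V x + of_int (d + 3 * D) - of_int d" "4 * (of_int D * V x) \<le> of_int (5 * D - d - 1)"
      unfolding DV c by auto
    then have 1: "0 \<le> of_int D * (3 + V x)" and 2: "of_int D * (4 * V x) \<le> of_int D * (5 - V 0 - 1 / of_int D)"
      using D DV[of 0] by (simp_all add: algebra_simps)
    show "0 \<le> real CARD(3) + V x" using 1 D by (simp add: zero_le_mult_iff)
    have "4 * V x \<le> 5 - V 0 - 1 / of_int D"
      using 2 D by (simp only: mult_le_cancel_left_pos of_int_0_less_iff)
    then show "V 0 + (real CARD(3) + 1) * V x \<le> real CARD(3) + 2 - 1 / of_int D" by simp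
  qed
qed

text \<open>For polytopes in which y is bounded on either side by one affine function of x, and z by
  one affine function of x and y.\<close>

lemma certificate3_one_cell:
  assumes F: "toric_Fano (rep3 ` set L)" and D: "D > 0"
    and I: "list_all (\<lambda>p. cell3_integral cell p = Some 0) (moment_polynomials3 c D)"
    and "\<And>x y z. polyhedron3 L x y z \<longleftrightarrow> in_cell3 cell x y z" "valid_cell3 cell"
    and bounds: "\<And>x y z. polyhedron3 L x y z \<Longrightarrow> affine_bounds3 c D x y z"
  shows "polystability_certificate (rep3 ` set L)"
proof (rule certificate3[OF F D _ bounds])
  have "compact (anticanonical_polytope (rep3 ` set L))" using F by (simp add: toric_Fano_def compact_eq_bounded_closed)
  then show "(LINT v:anticanonical_polytope (rep3 ` set L)|lborel. peval p (v $ 1) (v $ 2) (v $ 3)) = 0"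
    if "p \<in> set (moment_polynomials3 c D)" for p
    using cell3_integral[of "anticanonical_polytope (rep3 ` set L)" cell p 0] assms(4,5) I that
    by (simp add: polytope_rep3 list_all_iff)
qed

text \<open>For polytopes in which a bound on y or z is a maximum or minimum of two affine functions
  that switch at x = 0. Only the sum of the two partial integrals has to vanish.\<close>

lemma certificate3_two_cells:
  assumes F: "toric_Fano (rep3 ` set L)" and D: "D > 0"
    and I: "list_all (\<lambda>p. case (cell3_integral cell p, cell3_integral cell' p) of (Some i, Some j) \<Rightarrow> i + j = 0 | _ \<Rightarrow> False)
       (moment_polynomials3 c D)"
    and c1: "\<And>x y z. polyhedron3 L x y z \<and> x \<le> 0 \<longleftrightarrow> in_cell3 cell x y z" "valid_cell3 cell"
    and c2: "\<And>x y z. polyhedron3 L x y z \<and> x \<ge> 0 \<longleftrightarrow> in_cell3 cell' x y z" "valid_cell3 cell'"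
    and bounds: "\<And>x y z. polyhedron3 L x y z \<Longrightarrow> affine_bounds3 c D x y z"
  shows "polystability_certificate (rep3 ` set L)"
proof (rule certificate3[OF F D _ bounds])
  let ?P = "anticanonical_polytope (rep3 ` set L)"
  have cP: "compact ?P" using F by (simp add: toric_Fano_def compact_eq_bounded_closed)
  have "closed {v :: real^3. v $ 1 \<le> 0}" "closed {v :: real^3. v $ 1 \<ge> 0}"
    by (intro closed_Collect_le continuous_intros)+
  then have cc: "compact (?P \<inter> {v. v $ 1 \<le> 0})" "compact (?P \<inter> {v. v $ 1 \<ge> 0})"
    using cP by (auto intro: compact_Int_closed)
  fix p assume "p \<in> set (moment_polynomials3 c D)"
  then have "case (cell3_integral cell p, cell3_integral cell' p) of (Some i, Some j) \<Rightarrow> i + j = 0 | _ \<Rightarrow> False"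
    using I unfolding list_all_iff by blast
  then obtain i j where ij: "cell3_integral cell p = Some i" "cell3_integral cell' p = Some j" "i + j = 0"
    by (cases "cell3_integral cell p"; cases "cell3_integral cell' p") auto
  have "(LINT v:?P|lborel. peval p (v $ 1) (v $ 2) (v $ 3)) =
     (LINT v:?P \<inter> {v. v $ 1 \<le> 0}|lborel. peval p (v $ 1) (v $ 2) (v $ 3)) +
     (LINT v:?P \<inter> {v. v $ 1 \<ge> 0}|lborel. peval p (v $ 1) (v $ 2) (v $ 3))"
    by (rule set_integral_split_hyperplane[OF cP]) (intro continuous_intros)
  also have "\<dots> = of_int i + of_int j"
    using cell3_integral[OF cc(1) _ c1(2) ij(1)] cell3_integral[OF cc(2) _ c2(2) ij(2)] c1(1) c2(1)
    by (simp add: polytope_rep3)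
  also have "\<dots> = 0" using ij(3) by (simp flip: of_int_add)
  finally show "(LINT v:?P|lborel. peval p (v $ 1) (v $ 2) (v $ 3)) = 0" .
qed

lemmas cell3_simps = models3_def polyhedron3_def in_cell3_def valid_cell3_def

text \<open>In this and the following certificates V = c/D solves the linear system \<integral> V =
  0, \<integral> V x_i = \<integral> x_i. The solution is 0 when the barycentre of the polytope is
  the origin, as for the models 0, 4, 10, 11 and 17.\<close>

lemma certificate3_0: "polystability_certificate (rep3 ` set (models3 ! 0))"
  by (rule certificate3_one_cell[OF toric_Fano_models3, where c = "(0, 0, 0, 0)" and D = 1
      and cell = "(((- 1, 0, 0), (3, 0, 0)), ((- 1, 0, 0), (2, 0, - 1)), ((- 1, 0, 0), (1, - 1, - 1)))"], simp, simp, code_simp)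
    (auto simp: cell3_simps)

lemma certificate3_1: "polystability_certificate (rep3 ` set (models3 ! 1))"
  by (rule certificate3_one_cell[OF toric_Fano_models3, where c = "(- 620, 0, 0, - 240)" and D = 349
      and cell = "(((- 1, 0, 0), (1, 0, 0)), ((- 1, 0, 0), (2, 0, - 2)), ((- 1, 0, 0), (1, - 2, - 1)))"], simp, simp, code_simp)
    (auto simp: cell3_simps)

lemma certificate3_2: "polystability_certificate (rep3 ` set (models3 ! 2))"
  by (rule certificate3_one_cell[OF toric_Fano_models3, where c = "(- 20, - 20, 0, - 5)" and D = 43
      and cell = "(((- 1, 0, 0), (2, 0, 0)), ((- 1, 0, 0), (1, 0, - 1)), ((- 1, 0, 0), (1, - 1, - 1)))"], simp, simp, code_simp)
    (auto simp: cell3_simps)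

lemma certificate3_3: "polystability_certificate (rep3 ` set (models3 ! 3))"
  by (rule certificate3_one_cell[OF toric_Fano_models3, where c = "(- 70, 0, 0, - 15)" and D = 97
      and cell = "(((- 1, 0, 0), (1, 0, 0)), ((- 1, 0, 0), (2, 0, - 1)), ((- 1, 0, 0), (1, - 1, - 1)))"], simp, simp, code_simp)
    (auto simp: cell3_simps)

lemma certificate3_4: "polystability_certificate (rep3 ` set (models3 ! 4))"
  by (rule certificate3_one_cell[OF toric_Fano_models3, where c = "(0, 0, 0, 0)" and D = 1
      and cell = "(((- 1, 0, 0), (2, 0, 0)), ((- 1, 0, 0), (1, 0, - 1)), ((- 1, 0, 0), (1, 0, 0)))"], simp, simp, code_simp)
    (auto simp: cell3_simps)

lemma certificate3_6: "polystability_certificate (rep3 ` set (models3 ! 6))"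
  by (rule certificate3_one_cell[OF toric_Fano_models3, where c = "(- 17750, - 7600, 0, - 4868)" and D = 17787
      and cell = "(((- 1, 0, 0), (1, 0, 0)), ((- 1, 0, 0), (1, 0, - 1)), ((- 1, 0, 0), (1, - 1, - 1)))"], simp, simp, code_simp)
    (auto simp: cell3_simps)

lemma certificate3_8: "polystability_certificate (rep3 ` set (models3 ! 8))"
  by (rule certificate3_one_cell[OF toric_Fano_models3, where c = "(- 260, 0, 0, - 80)" and D = 219
      and cell = "(((- 1, 0, 0), (1, 0, 0)), ((- 1, 0, 0), (1, 0, - 1)), ((- 1, 0, 0), (1, - 1, 0)))"], simp, simp, code_simp)
    (auto simp: cell3_simps)

text \<open>A product of a surface with P^1: the segment has barycentre 0, so V is that of the
  surface factor, P^2 blown up in one point.\<close>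

lemma certificate3_9: "polystability_certificate (rep3 ` set (models3 ! 9))"
  by (rule certificate3_one_cell[OF toric_Fano_models3, where c = "(- 6, 0, 0, - 1)" and D = 11
      and cell = "(((- 1, 0, 0), (1, 0, 0)), ((- 1, 0, 0), (1, 0, - 1)), ((- 1, 0, 0), (1, 0, 0)))"], simp, simp, code_simp)
    (auto simp: cell3_simps)

lemma certificate3_10: "polystability_certificate (rep3 ` set (models3 ! 10))"
  by (rule certificate3_one_cell[OF toric_Fano_models3, where c = "(0, 0, 0, 0)" and D = 1
      and cell = "(((- 1, 0, 0), (1, 0, 0)), ((- 1, 0, 0), (1, 0, - 1)), ((- 1, 0, 0), (1, 1, 0)))"], simp, simp, code_simp)
    (auto simp: cell3_simps)

lemma certificate3_11: "polystability_certificate (rep3 ` set (models3 ! 11))"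
  by (rule certificate3_one_cell[OF toric_Fano_models3, where c = "(0, 0, 0, 0)" and D = 1
      and cell = "(((- 1, 0, 0), (1, 0, 0)), ((- 1, 0, 0), (1, 0, 0)), ((- 1, 0, 0), (1, 0, 0)))"], simp, simp, code_simp)
    (auto simp: cell3_simps)

text \<open>Again a product with P^1; V comes from P^2 blown up in two points.\<close>

lemma certificate3_15: "polystability_certificate (rep3 ` set (models3 ! 15))"
  by (rule certificate3_two_cells[OF toric_Fano_models3, where c = "(- 168, - 168, 0, - 32)" and D = 409
      and cell = "(((- 1, 0, 0), (0, 0, 0)), ((- 1, 0, 0), (1, 0, 0)), ((- 1, 0, 0), (1, 0, 0)))" and cell' = "(((0, 0, 0), (1, 0, 0)), ((- 1, 0, 0), (1, 0, - 1)), ((- 1, 0, 0), (1, 0, 0)))"], simp, simp, code_simp)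
    (auto simp: cell3_simps)

lemma certificate3_16: "polystability_certificate (rep3 ` set (models3 ! 16))"
  by (rule certificate3_two_cells[OF toric_Fano_models3, where c = "(- 36, 0, 0, - 5)" and D = 67
      and cell = "(((- 1, 0, 0), (0, 0, 0)), ((- 1, 0, 0), (1, 0, - 1)), ((- 1, 0, 0), (1, 1, 0)))" and cell' = "(((0, 0, 0), (1, 0, 0)), ((- 1, 0, 0), (1, 0, - 1)), ((- 1, 1, 0), (1, 0, 0)))"], simp, simp, code_simp)
    (auto simp: cell3_simps)

lemma certificate3_17: "polystability_certificate (rep3 ` set (models3 ! 17))"
  by (rule certificate3_two_cells[OF toric_Fano_models3, where c = "(0, 0, 0, 0)" and D = 1
      and cell = "(((- 1, 0, 0), (0, 0, 0)), ((- 1, 0, 0), (1, 0, 0)), ((- 1, 0, 0), (1, 1, 0)))" and cell' = "(((0, 0, 0), (1, 0, 0)), ((- 1, 0, 0), (1, 0, 0)), ((- 1, 1, 0), (1, 0, 0)))"], simp, simp, code_simp)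
    (auto simp: cell3_simps)

section \<open>Toric del Pezzo surfaces\<close>

fun dot2 :: "int \<times> int \<Rightarrow> int \<times> int \<Rightarrow> int" where
  "dot2 (a, b) (d, e) = a * d + b * e"

fun comb2 :: "int \<times> int \<Rightarrow> int \<Rightarrow> int \<times> int \<Rightarrow> int \<times> int" where
  "comb2 (a, b) m (d, e) = (a + m * d, b + m * e)"

fun apply2 :: "(int \<times> int) \<times> int \<times> int \<Rightarrow> int \<times> int \<Rightarrow> int \<times> int" where
  "apply2 (r, s) x = (dot2 r x, dot2 s x)"

definition units2 :: "(int \<times> int) list" where
  "units2 = [(1, 0), (0, 1)]"

definition level0_2 :: "(nat \<times> int \<times> int) list" where
  "level0_2 = [(1, - 1, 1), (1, 1, - 1)]"

definition below_2 :: "(nat \<times> int \<times> int) list" where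
  "below_2 = [(1, - 1, 0), (1, 0, - 1), (2, - 1, - 1)]"

text \<open>There are only twenty candidates, so the coordinates are not sorted here.\<close>

definition candidates2 :: "(int \<times> int) list list" where
  "candidates2 = concat (map (\<lambda>z. map (\<lambda>b. units2 @ z @ b) (weighted_subs 2 below_2)) (weighted_subs 2 level0_2))"

text \<open>In this order: P^2, P^1 x P^1, and P^2 blown up in one, two and three torus-fixed
  points.\<close>

definition models2 :: "(int \<times> int) list list" where
  "models2 = [[(1, 0), (0, 1), (- 1, - 1)], [(1, 0), (0, 1), (- 1, 0), (0, - 1)], [(1, 0), (0, 1), (- 1, - 1), (- 1, 0)], [(1, 0), (0, 1), (- 1, - 1), (- 1, 0), (0, - 1)], [(1, 0), (0, 1), (- 1, 0), (0, - 1), (1, - 1), (- 1, 1)]]"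

definition survivors2 :: "((int \<times> int) list \<times> ((int \<times> int) \<times> int \<times> int) \<times> ((int \<times> int) \<times> int \<times> int) \<times> nat) list" where
  "survivors2 = [([(- 1, - 1)], ((- 1, 0), (- 1, 1)), ((- 1, 0), (- 1, 1)), 0),
     ([(- 1, 0), (0, - 1)], ((- 1, 0), (0, - 1)), ((- 1, 0), (0, - 1)), 1),
     ([(1, - 1), (- 1, 0)], ((- 1, - 1), (0, - 1)), ((- 1, 1), (0, - 1)), 2),
     ([(1, - 1), (- 1, 0), (0, - 1)], ((- 1, 0), (0, 1)), ((- 1, 0), (0, 1)), 3),
     ([(- 1, 1), (0, - 1)], ((- 1, - 1), (- 1, 0)), ((0, - 1), (- 1, 1)), 2),
     ([(- 1, 1), (- 1, 0), (0, - 1)], ((0, - 1), (1, 0)), ((0, 1), (- 1, 0)), 3),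
     ([(- 1, 1), (1, - 1), (0, - 1)], ((- 1, - 1), (- 1, 0)), ((0, - 1), (- 1, 1)), 3),
     ([(- 1, 1), (1, - 1), (- 1, 0)], ((- 1, - 1), (0, - 1)), ((- 1, 1), (0, - 1)), 3),
     ([(- 1, 1), (1, - 1), (- 1, 0), (0, - 1)], ((- 1, - 1), (0, 1)), ((- 1, - 1), (0, 1)), 4)]"

lemma filter_candidates2:
  "filter (\<lambda>L. neighbour_check dot2 comb2 L 3 (-1, -1) (map (\<lambda>e. (e, e)) units2)) candidates2 =
   map (\<lambda>(L, _). units2 @ L) survivors2"
  by code_simp

lemma survivors2_models2:
  "list_all (\<lambda>(L, A, B, k). k < 5 \<and> set (map (apply2 A) (units2 @ L)) = set (models2 ! k) \<and>
     list_all (\<lambda>e. apply2 A (apply2 B e) = e \<and> apply2 B (apply2 A e) = e) units2) survivors2"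
  by code_simp

fun rep2 :: "int \<times> int \<Rightarrow> int^2" where
  "rep2 (a, b) = vector [a, b]"

lemma rep2_nth [simp]: "rep2 p $ 1 = fst p" "rep2 p $ 2 = snd p"
  by (cases p; simp)+

lemma rep2_components: "rep2 (a $ 1, a $ 2) = a"
  by (simp add: vec_eq_iff forall_2)

lemma inj_rep2: "inj rep2"
  by (auto simp: inj_def vec_eq_iff forall_2)

lemma surj_rep2: "surj rep2"
  by (rule surjI[of rep2 "\<lambda>a. (a $ 1, a $ 2)"]) (rule rep2_components)

lemma rep2_comb2: "rep2 (comb2 x m y) = rep2 x + m *s rep2 y"
  by (cases x; cases y) (simp add: vec_eq_iff forall_2)

lemma dot2_rep2: "dot2 x y = idot (rep2 x) (rep2 y)"
  by (cases x; cases y) (simp add: idot_def sum_2)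

lemma rep2_units2: "rep2 ` set units2 = range (\<lambda>i. axis i 1)"
proof -
  have "rep2 (1, 0) = axis 1 1" "rep2 (0, 1) = axis 2 1"
    by (simp_all add: vec_eq_iff forall_2 axis_def)
  then show ?thesis by (auto simp: units2_def UNIV_2)
qed

definition mat2 :: "(int \<times> int) \<times> int \<times> int \<Rightarrow> int^2^2" where
  "mat2 A = vector [rep2 (fst A), rep2 (snd A)]"

lemma mat2_rep2: "mat2 A *v rep2 x = rep2 (apply2 A x)"
proof -
  have "dot2 r x = fst r * fst x + snd r * snd x" for r
    by (cases r; cases x) simp
  then show ?thesis
    by (cases A) (simp add: mat2_def matrix_vector_mult_def vec_eq_iff forall_2 sum_2)
qed

lemma mat2_inverse:
  assumes "\<And>e. e \<in> set units2 \<Longrightarrow> apply2 A (apply2 B e) = e"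
  shows "mat2 A ** mat2 B = mat 1"
proof -
  have "(mat2 A ** mat2 B) *v axis i 1 = axis i 1" for i
  proof -
    obtain e where e: "e \<in> set units2" "axis i 1 = rep2 e" using rep2_units2 by blast
    then show ?thesis using assms by (simp add: matrix_vector_mul_assoc[symmetric] mat2_rep2)
  qed
  then have "(mat2 A ** mat2 B) *v z = z" for z
    by (subst (1 2) vec_expand_axis[of z]) (simp only: matrix_vector_mult_sum_int matrix_vector_mult_smult_int)
  then show ?thesis by (simp add: matrix_eq)
qed

lemma special_coordinates_candidates2:
  fixes \<Lambda> :: "(int^2) set"
  assumes fin: "finite \<Lambda>" and prim: "\<forall>a\<in>\<Lambda>. primitive_vec a" and nb: "vertex_neighbours \<Lambda>"
    and v0: "fan_vertex \<Lambda> (\<chi> i. -1)" and t0: "tight \<Lambda> (\<chi> i. -1) = range (\<lambda>i. axis i 1)"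
    and s: "\<And>i. 0 \<le> (\<Sum>a\<in>\<Lambda>. a $ i)"
  shows "\<exists>L\<in>set candidates2. \<Lambda> = rep2 ` set L \<and>
    neighbour_check dot2 comb2 L 3 (-1, -1) (map (\<lambda>e. (e, e)) units2)"
proof -
  define E where "E = range (\<lambda>i :: 2. axis i (1 :: int))"
  obtain Z B where \<Lambda>: "\<Lambda> = E \<union> (Z \<union> B)" "E \<inter> (Z \<union> B) = {}" "Z \<inter> B = {}"
    and Z: "card Z \<le> CARD(2)" "\<And>a. a \<in> Z \<Longrightarrow> (\<Sum>i\<in>UNIV. a $ i) = 0" "\<And>a i. a \<in> Z \<Longrightarrow> a $ i \<ge> -1"
    and B: "(\<Sum>a\<in>B. - (\<Sum>i\<in>UNIV. a $ i)) \<le> int CARD(2)" "\<And>a. a \<in> B \<Longrightarrow> (\<Sum>i\<in>UNIV. a $ i) < 0"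
      "\<And>a. a \<in> B \<Longrightarrow> (\<Sum>i\<in>UNIV. a $ i) \<ge> - int CARD(2)"
      "\<And>a i. a \<in> B \<Longrightarrow> a $ i \<ge> -1 \<or> a $ i \<ge> (\<Sum>i\<in>UNIV. a $ i)"
    by (rule special_coordinates_levels[OF fin prim nb v0 t0 s, folded E_def]) blast
  note Z = Z[unfolded sum_2] and B = B[unfolded sum_2]
  have dv: "\<not> (\<forall>i. k dvd a $ i)" if "k > 1" "a \<in> \<Lambda>" for k a
    using primitive_vec_not_dvd that prim by blast
  have nz: "a \<noteq> 0" if "a \<in> \<Lambda>" for a using dv[of 2, OF _ that] by auto
  let ?Z = "rep2 -` Z" and ?B = "rep2 -` B"
  have imZ: "rep2 ` ?Z = Z" "rep2 ` ?B = B" using surj_rep2 by (simp_all add: surj_image_vimage_eq)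
  have injs: "inj_on rep2 S" for S using inj_rep2 by (rule inj_on_subset) simp
  have "(\<Sum>p\<in>?Z. 1 :: nat) \<le> 2" using Z(1) card_image[OF injs, of ?Z] unfolding imZ by simp
  moreover have "?Z \<subseteq> snd ` set level0_2"
  proof
    fix p assume "p \<in> ?Z"
    then have p: "rep2 p \<in> Z" "rep2 p \<in> \<Lambda>" using \<Lambda> by auto
    obtain x y where xy: "p = (x, y)" by (cases p)
    have "x \<ge> -1" "y \<ge> -1" "x + y = 0" "\<not> (x = 0 \<and> y = 0)"
      using Z(3)[OF p(1), of 1] Z(3)[OF p(1), of 2] Z(2)[OF p(1)] nz[OF p(2)]
      by (auto simp: xy vec_eq_iff forall_2)
    then have "(x, y) = (-1, 1) \<or> (x, y) = (1, -1)" by auto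
    then show "p \<in> snd ` set level0_2" unfolding xy by (auto simp: level0_2_def)
  qed
  moreover have "w = 1" if "(w, x) \<in> set level0_2" for w x
    using that by (auto simp: level0_2_def)
  ultimately obtain z where z: "z \<in> set (weighted_subs 2 level0_2)" "set z = ?Z"
    using weighted_subs_complete[of level0_2 "\<lambda>_. 1" ?Z 2] by blast
  define h where "h p = nat (- (fst p + snd p))" for p :: "int \<times> int"
  have "(\<Sum>p\<in>?B. h p) \<le> 2"
  proof -
    have "int (h p) = - (rep2 p $ 1 + rep2 p $ 2)" if "p \<in> ?B" for p
      using B(2)[of "rep2 p"] that by (simp add: h_def)
    then have "int (\<Sum>p\<in>?B. h p) = (\<Sum>p\<in>?B. - (rep2 p $ 1 + rep2 p $ 2))"
      unfolding of_nat_sum by (intro sum.cong refl)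
    also have "\<dots> = (\<Sum>a\<in>rep2 ` ?B. - (a $ 1 + a $ 2))" by (simp only: sum.reindex[OF injs] o_def)
    finally show ?thesis using B(1) unfolding imZ by (simp del: of_nat_sum)
  qed
  moreover have "?B \<subseteq> snd ` set below_2"
  proof
    fix p assume "p \<in> ?B"
    then have p: "rep2 p \<in> B" "rep2 p \<in> \<Lambda>" using \<Lambda> by auto
    obtain x y where xy: "p = (x, y)" by (cases p)
    have "x + y < 0" "x + y \<ge> -2" "x \<ge> -1 \<or> x \<ge> x + y" "y \<ge> -1 \<or> y \<ge> x + y" "\<not> (2 dvd x \<and> 2 dvd y)"
      using B(4)[OF p(1), of 1] B(4)[OF p(1), of 2] B(2,3)[OF p(1)] dv[OF _ p(2), of 2]
      by (auto simp: xy forall_2)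
    \<comment> \<open>The last two of these vectors are divisible by 2 and hence excluded by
      primitivity.\<close>
    moreover from this have "(x, y) \<in> {(-1, 0), (0, -1), (-1, -1), (-2, 0), (0, -2)}" by auto
    ultimately show "p \<in> snd ` set below_2" unfolding xy by (auto simp: below_2_def)
  qed
  moreover have "w = h x" if "(w, x) \<in> set below_2" for w x
    using that by (auto simp: below_2_def h_def)
  ultimately obtain b where b: "b \<in> set (weighted_subs 2 below_2)" "set b = ?B"
    using weighted_subs_complete[of below_2 h ?B 2] by blast
  define L where "L = units2 @ z @ b"
  have setL: "\<Lambda> = rep2 ` set L"
    unfolding L_def set_append image_Un z(2) b(2) imZ rep2_units2 using \<Lambda>(1) unfolding E_def .
  have "L \<in> set candidates2"
    using z(1) b(1) unfolding candidates2_def L_def by force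
  moreover have "neighbour_check dot2 comb2 L 3 (-1, -1) (map (\<lambda>e. (e, e)) units2)"
  proof -
    have w: "rep2 (-1, -1) = (\<chi> i. -1)" by (simp add: vec_eq_iff forall_2)
    have f: "fst ` set (map (\<lambda>e. (e, e)) units2) = set units2" by force
    have t: "tight (rep2 ` set L) (rep2 (-1, -1)) = rep2 ` fst ` set (map (\<lambda>e. (e, e)) units2)"
      unfolding f w setL[symmetric] t0 rep2_units2 by (rule refl)
    have d: "dot2 b d = (if b = a then 1 else 0)"
      if "(a, d) \<in> set (map (\<lambda>e. (e, e)) units2)" "(b, e) \<in> set (map (\<lambda>e. (e, e)) units2)" for a d b e
    proof -
      have "list_all (\<lambda>a. list_all (\<lambda>b. dot2 b a = (if b = a then 1 else 0)) units2) units2" by code_simp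
      moreover have "a \<in> set units2" "d = a" "b \<in> set units2" using that by auto
      ultimately show ?thesis unfolding list_all_iff by blast
    qed
    have nb': "vertex_neighbours (rep2 ` set L)" unfolding setL[symmetric] by (rule nb)
    have v0': "fan_vertex (rep2 ` set L) (rep2 (-1, -1))" unfolding setL[symmetric] w by (rule v0)
    show ?thesis
      by (rule neighbour_check_sound[where rep = rep2 and dt = dot2 and cb = comb2 and L = L and v = "(-1, -1)" and k = 3
            and S = "map (\<lambda>e. (e, e)) units2", OF inj_rep2 dot2_rep2 rep2_comb2 nb' v0' t]) (rule d)
  qed
  ultimately show ?thesis using setL by blast
qed

text \<open>The map goes from the model to the given fan, the direction in which
  \<open>certificate_image\<close> transports certificates.\<close>

theorem toric_Fano2_classification:
  fixes \<Lambda> :: "(int^2) set"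
  assumes F: "toric_Fano \<Lambda>"
  obtains A k where "invertible A" "k < 5" "(*v) A ` rep2 ` set (models2 ! k) = \<Lambda>"
proof -
  obtain T :: "(int^2) set" and c :: "int^2 \<Rightarrow> int" where T: "card T = CARD(2)" "\<And>t. bij_betw t (UNIV :: 2 set) T \<Longrightarrow>
    \<exists>A. invertible A \<and> finite ((*v) A ` \<Lambda>) \<and> (\<forall>a\<in>(*v) A ` \<Lambda>. primitive_vec a) \<and>
      vertex_neighbours ((*v) A ` \<Lambda>) \<and> fan_vertex ((*v) A ` \<Lambda>) (\<chi> i. -1) \<and>
      tight ((*v) A ` \<Lambda>) (\<chi> i. -1) = range (\<lambda>i. axis i 1) \<and>
      (\<forall>i. (\<Sum>a\<in>(*v) A ` \<Lambda>. a $ i) = c (t i))" "\<And>a. a \<in> T \<Longrightarrow> c a \<ge> 0"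
    using special_vertex[OF F] by metis
  have "finite T" using T(1) card.infinite by fastforce
  then obtain t :: "2 \<Rightarrow> int^2" where t: "bij_betw t UNIV T"
    using finite_same_card_bij[of "UNIV :: 2 set" T] T(1) by auto
  obtain A where A: "invertible A" "finite ((*v) A ` \<Lambda>)" "\<forall>a\<in>(*v) A ` \<Lambda>. primitive_vec a"
      "vertex_neighbours ((*v) A ` \<Lambda>)" "fan_vertex ((*v) A ` \<Lambda>) (\<chi> i. -1)"
      "tight ((*v) A ` \<Lambda>) (\<chi> i. -1) = range (\<lambda>i. axis i 1)"
      "\<And>i. (\<Sum>a\<in>(*v) A ` \<Lambda>. a $ i) = c (t i)"
    using T(2)[OF t] by blast
  have "0 \<le> (\<Sum>a\<in>(*v) A ` \<Lambda>. a $ i)" for i using T(3) t bij_betwE unfolding A(7) by blast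
  then obtain L where L: "L \<in> set candidates2" "(*v) A ` \<Lambda> = rep2 ` set L"
      "neighbour_check dot2 comb2 L 3 (-1, -1) (map (\<lambda>e. (e, e)) units2)"
    using special_coordinates_candidates2[OF A(2-6)] by blast
  then have "L \<in> set (map (\<lambda>(L, _). units2 @ L) survivors2)"
    unfolding filter_candidates2[symmetric] by simp
  then obtain K M N k where K: "(K, M, N, k) \<in> set survivors2" "L = units2 @ K" by auto
  have "case (K, M, N, k) of (L, A, B, k) \<Rightarrow> k < 5 \<and> set (map (apply2 A) (units2 @ L)) = set (models2 ! k) \<and>
     list_all (\<lambda>e. apply2 A (apply2 B e) = e \<and> apply2 B (apply2 A e) = e) units2"
    using survivors2_models2 K(1) unfolding list_all_iff by blast
  then have k: "k < 5" "apply2 M ` set L = set (models2 ! k)"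
      "\<And>e. e \<in> set units2 \<Longrightarrow> apply2 M (apply2 N e) = e" "\<And>e. e \<in> set units2 \<Longrightarrow> apply2 N (apply2 M e) = e"
    unfolding K(2) by (auto simp: list_all_iff)
  have MN: "mat2 M ** mat2 N = mat 1" "mat2 N ** mat2 M = mat 1"
    using mat2_inverse[OF k(3)] mat2_inverse[OF k(4)] by blast+
  obtain A' where A': "A ** A' = mat 1" "A' ** A = mat 1" using A(1) by (auto simp: invertible_def)
  have "invertible A'" "invertible (mat2 N)" using MN A' unfolding invertible_def by blast+
  then have inv: "invertible (A' ** mat2 N)" by (rule invertible_mult)
  have "(*v) (mat2 M) ` rep2 ` set L = rep2 ` set (models2 ! k)"
    unfolding k(2)[symmetric] by (simp add: image_image mat2_rep2)
  then have "(*v) (A' ** mat2 N) ` rep2 ` set (models2 ! k) = (*v) A' ` (*v) (mat2 N) ` (*v) (mat2 M) ` (*v) A ` \<Lambda>"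
    by (simp add: L(2) image_image matrix_vector_mul_assoc[symmetric])
  also have "\<dots> = (\<lambda>x. x) ` \<Lambda>"
    unfolding image_image by (intro image_cong refl) (simp add: matrix_vector_mul_assoc matrix_mul_assoc[of "mat2 N"] MN A')
  finally have "(*v) (A' ** mat2 N) ` rep2 ` set (models2 ! k) = \<Lambda>" by simp
  with inv k(1) show ?thesis using that by blast
qed

section \<open>Certificates for the models of surfaces\<close>

definition polyhedron2 :: "(int \<times> int) list \<Rightarrow> real \<Rightarrow> real \<Rightarrow> bool" where
  "polyhedron2 L x y \<longleftrightarrow> list_all (\<lambda>(a, b). 0 \<le> of_int a * x + of_int b * y + 1) L"

lemma polytope_rep2: "v \<in> anticanonical_polytope (rep2 ` set L) \<longleftrightarrow> polyhedron2 L (v $ 1) (v $ 2)"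
proof -
  have "vec_of_int (rep2 p) \<bullet> v = of_int (fst p) * v $ 1 + of_int (snd p) * v $ 2" for p
    by (simp add: inner_vec_def sum_2 vec_of_int_def)
  then show ?thesis by (auto simp: anticanonical_polytope_def polyhedron2_def list_all_iff)
qed

text \<open>The two variables occupy the second and third slots, like the integrand of a threefold
  after the first integration, so that \<open>integrate\<close> applies unchanged.\<close>

fun moment_polynomials2 :: "int \<times> int \<times> int \<Rightarrow> int \<Rightarrow> polynomial list" where
  "moment_polynomials2 (a, b, d) D = (let a' = 4320 * a; b' = 4320 * b; d' = 4320 * d; e' = 4320 * (d - D) in
    [[(a', 0, 1, 0), (b', 0, 0, 1), (d', 0, 0, 0)],
     [(a', 0, 2, 0), (b', 0, 1, 1), (e', 0, 1, 0)],
     [(a', 0, 1, 1), (b', 0, 0, 2), (e', 0, 0, 1)]])"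

fun affine_bounds2 :: "int \<times> int \<times> int \<Rightarrow> int \<Rightarrow> real \<Rightarrow> real \<Rightarrow> bool" where
  "affine_bounds2 (a, b, d) D x y \<longleftrightarrow> 0 \<le> of_int a * x + of_int b * y + of_int (d + 2 * D) \<and>
     3 * (of_int a * x + of_int b * y + of_int d) \<le> of_int (4 * D - d - 1)"

text \<open>The Fano property is assumed for the given fan and not established for its model, so
  boundedness of the polytope of the model is supplied by the explicit box \<open>bd\<close>. All
  five polygons are integrated in two cells, cut at x = 0.\<close>

lemma certificate2:
  assumes nz: "\<not> List.member L (0, 0)" and D: "D > 0"
    and I: "list_all (\<lambda>p. case (cell2_integral cell p, cell2_integral cell' p) of (Some i, Some j) \<Rightarrow> i + j = 0 | _ \<Rightarrow> False)
       (moment_polynomials2 c D)"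
    and bd: "\<And>x y. polyhedron2 L x y \<Longrightarrow> \<bar>x\<bar> \<le> 2 \<and> \<bar>y\<bar> \<le> 2"
    and c1: "\<And>x y. polyhedron2 L x y \<and> x \<le> 0 \<longleftrightarrow> in_cell2 cell x y" "valid_cell2 cell"
    and c2: "\<And>x y. polyhedron2 L x y \<and> x \<ge> 0 \<longleftrightarrow> in_cell2 cell' x y" "valid_cell2 cell'"
    and bounds: "\<And>x y. polyhedron2 L x y \<Longrightarrow> affine_bounds2 c D x y"
  shows "polystability_certificate (rep2 ` set L)"
proof -
  let ?\<Lambda> = "rep2 ` set L"
  have "rep2 (0, 0) = 0" by (simp add: vec_eq_iff forall_2)
  then have "0 \<notin> ?\<Lambda>" using nz inj_image_mem_iff[OF inj_rep2, of "(0, 0)" "set L"] by simp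
  moreover have "bounded (anticanonical_polytope ?\<Lambda>)"
  proof (rule boundedI)
    fix v assume "v \<in> anticanonical_polytope ?\<Lambda>"
    then have "\<bar>v $ 1\<bar> \<le> 2" "\<bar>v $ 2\<bar> \<le> 2" using bd polytope_rep2 by blast+
    then show "norm v \<le> 4" using norm_le_l1_cart[of v] by (simp add: sum_2)
  qed
  ultimately interpret lattice_polytope ?\<Lambda> by unfold_locales auto
  have "closed {v :: real^2. v $ 1 \<le> 0}" "closed {v :: real^2. v $ 1 \<ge> 0}"
    by (intro closed_Collect_le continuous_intros)+
  then have cc: "compact (P \<inter> {v. v $ 1 \<le> 0})" "compact (P \<inter> {v. v $ 1 \<ge> 0})"
    using compact_P by (auto intro: compact_Int_closed)
  have I: "(LINT v:P|lborel. peval p 0 (v $ 1) (v $ 2)) = 0" if "p \<in> set (moment_polynomials2 c D)" for p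
  proof -
    have "case (cell2_integral cell p, cell2_integral cell' p) of (Some i, Some j) \<Rightarrow> i + j = 0 | _ \<Rightarrow> False"
      using I that unfolding list_all_iff by blast
    then obtain i j where ij: "cell2_integral cell p = Some i" "cell2_integral cell' p = Some j" "i + j = 0"
      by (cases "cell2_integral cell p"; cases "cell2_integral cell' p") auto
    have "(LINT v:P|lborel. peval p 0 (v $ 1) (v $ 2)) =
       (LINT v:P \<inter> {v. v $ 1 \<le> 0}|lborel. peval p 0 (v $ 1) (v $ 2)) +
       (LINT v:P \<inter> {v. v $ 1 \<ge> 0}|lborel. peval p 0 (v $ 1) (v $ 2))"
      by (rule set_integral_split_hyperplane[OF compact_P]) (intro continuous_intros)
    also have "\<dots> = of_int i + of_int j"
      using cell2_integral[OF cc(1) _ c1(2) ij(1)] cell2_integral[OF cc(2) _ c2(2) ij(2)] c1(1) c2(1)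
      by (simp add: polytope_rep2)
    also have "\<dots> = 0" using ij(3) by (simp flip: of_int_add)
    finally show ?thesis .
  qed
  obtain a1 a2 d where c: "c = (a1, a2, d)" by (cases c)
  define V where "V x = (of_int a1 * x $ 1 + of_int a2 * x $ 2 + of_int d) / of_int D" for x :: "real^2"
  have Vaff: "affine_function V"
  proof -
    have "V = (\<lambda>x. (vector [of_int a1 / of_int D, of_int a2 / of_int D] :: real^2) \<bullet> x + of_int d / of_int D)"
      by (simp add: V_def fun_eq_iff inner_vec_def sum_2 add_divide_distrib)
    then show ?thesis unfolding affine_function_def by blast
  qed
  have DV: "of_int D * V x = of_int a1 * x $ 1 + of_int a2 * x $ 2 + of_int d" for x
    using D by (simp add: V_def)
  have zero: "interior_integral ?\<Lambda> g = 0"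
    if "(LINT v:P|lborel. peval p 0 (v $ 1) (v $ 2)) = 0" "\<And>v. peval p 0 (v $ 1) (v $ 2) = 4320 * of_int D * g v" for p g
  proof -
    have "4320 * of_int D * interior_integral ?\<Lambda> g = 0"
      unfolding interior_integral_cmult[symmetric] using that by (simp add: interior_integral_def)
    then show ?thesis using D by simp
  qed
  have ident: "4320 * of_int D * (V v * t - t) =
      4320 * ((of_int a1 * v $ 1 + of_int a2 * v $ 2 + of_int d) * t - of_int D * t)" for v t
    unfolding DV[symmetric] by (simp add: algebra_simps)
  have I0: "interior_integral ?\<Lambda> V = 0"
  proof (rule zero[OF I[of "[(4320 * a1, 0, 1, 0), (4320 * a2, 0, 0, 1), (4320 * d, 0, 0, 0)]"]])
    show "peval [(4320 * a1, 0, 1, 0), (4320 * a2, 0, 0, 1), (4320 * d, 0, 0, 0)] 0 (v $ 1) (v $ 2) = 4320 * of_int D * V v" for v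
      unfolding mult.assoc[of _ "of_int D"] DV by (simp add: algebra_simps)
  qed (simp add: c Let_def)
  have I1: "interior_integral ?\<Lambda> (\<lambda>x. V x * x $ 1 - x $ 1) = 0"
  proof (rule zero[OF I[of "[(4320 * a1, 0, 2, 0), (4320 * a2, 0, 1, 1), (4320 * (d - D), 0, 1, 0)]"]])
    show "peval [(4320 * a1, 0, 2, 0), (4320 * a2, 0, 1, 1), (4320 * (d - D), 0, 1, 0)] 0 (v $ 1) (v $ 2) =
        4320 * of_int D * (V v * v $ 1 - v $ 1)" for v
      unfolding ident by (simp add: algebra_simps power2_eq_square)
  qed (simp add: c Let_def)
  have I2: "interior_integral ?\<Lambda> (\<lambda>x. V x * x $ 2 - x $ 2) = 0"
  proof (rule zero[OF I[of "[(4320 * a1, 0, 1, 1), (4320 * a2, 0, 0, 2), (4320 * (d - D), 0, 0, 1)]"]])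
    show "peval [(4320 * a1, 0, 1, 1), (4320 * a2, 0, 0, 2), (4320 * (d - D), 0, 0, 1)] 0 (v $ 1) (v $ 2) =
        4320 * of_int D * (V v * v $ 2 - v $ 2)" for v
      unfolding ident by (simp add: algebra_simps power2_eq_square)
  qed (simp add: c Let_def)
  show ?thesis
  proof (rule affine_certificate[OF Vaff I0])
    have "\<forall>i. interior_integral ?\<Lambda> (\<lambda>x. V x * x $ i - x $ i) = 0"
      unfolding forall_2 using I1 I2 by blast
    then show "interior_integral ?\<Lambda> (\<lambda>x. V x * x $ i - x $ i) = 0" for i ..
    show "0 < 1 / real_of_int D" using D by simp
    fix x assume "x \<in> P"
    then have "affine_bounds2 c D (x $ 1) (x $ 2)" using bounds polytope_rep2 by blast
    then have "0 \<le> of_int D * V x + of_int (d + 2 * D) - of_int d" "3 * (of_int D * V x) \<le> of_int (4 * D - d - 1)"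
      unfolding DV c by auto
    then have 1: "0 \<le> of_int D * (2 + V x)" and 2: "of_int D * (3 * V x) \<le> of_int D * (4 - V 0 - 1 / of_int D)"
      using D DV[of 0] by (simp_all add: algebra_simps)
    show "0 \<le> real CARD(2) + V x" using 1 D by (simp add: zero_le_mult_iff)
    have "3 * V x \<le> 4 - V 0 - 1 / of_int D"
      using 2 D by (simp only: mult_le_cancel_left_pos of_int_0_less_iff)
    then show "V 0 + (real CARD(2) + 1) * V x \<le> real CARD(2) + 2 - 1 / of_int D" by simp
  qed
qed

lemmas cell2_simps = models2_def polyhedron2_def in_cell2_def valid_cell2_def

lemma certificate2_0: "polystability_certificate (rep2 ` set (models2 ! 0))"
  by (rule certificate2[where c = "(0, 0, 0)" and D = 1
      and cell = "(((- 1, 0, 0), (0, 0, 0)), ((- 1, 0, 0), (1, 0, - 1)))" and cell' = "(((0, 0, 0), (2, 0, 0)), ((- 1, 0, 0), (1, 0, - 1)))"], code_simp, simp, code_simp)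
    (auto simp: cell2_simps)

lemma certificate2_1: "polystability_certificate (rep2 ` set (models2 ! 1))"
  by (rule certificate2[where c = "(0, 0, 0)" and D = 1
      and cell = "(((- 1, 0, 0), (0, 0, 0)), ((- 1, 0, 0), (1, 0, 0)))" and cell' = "(((0, 0, 0), (1, 0, 0)), ((- 1, 0, 0), (1, 0, 0)))"], code_simp, simp, code_simp)
    (auto simp: cell2_simps)

text \<open>P^2 blown up in one or two points are the surfaces whose polygon does not have its
  barycentre at the origin, which makes V nonzero.\<close>

lemma certificate2_2: "polystability_certificate (rep2 ` set (models2 ! 2))"
  by (rule certificate2[where c = "(- 6, 0, - 1)" and D = 11
      and cell = "(((- 1, 0, 0), (0, 0, 0)), ((- 1, 0, 0), (1, 0, - 1)))" and cell' = "(((0, 0, 0), (1, 0, 0)), ((- 1, 0, 0), (1, 0, - 1)))"], code_simp, simp, code_simp)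
    (auto simp: cell2_simps)

lemma certificate2_3: "polystability_certificate (rep2 ` set (models2 ! 3))"
  by (rule certificate2[where c = "(- 168, - 168, - 32)" and D = 409
      and cell = "(((- 1, 0, 0), (0, 0, 0)), ((- 1, 0, 0), (1, 0, 0)))" and cell' = "(((0, 0, 0), (1, 0, 0)), ((- 1, 0, 0), (1, 0, - 1)))"], code_simp, simp, code_simp)
    (auto simp: cell2_simps)

lemma certificate2_4: "polystability_certificate (rep2 ` set (models2 ! 4))"
  by (rule certificate2[where c = "(0, 0, 0)" and D = 1
      and cell = "(((- 1, 0, 0), (0, 0, 0)), ((- 1, 0, 0), (1, 0, 1)))" and cell' = "(((0, 0, 0), (1, 0, 0)), ((- 1, 0, 1), (1, 0, 0)))"], code_simp, simp, code_simp)
    (auto simp: cell2_simps)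

theorem toric_del_Pezzo_polystable:
  fixes \<Lambda> :: "(int^2) set"
  assumes F: "toric_Fano \<Lambda>"
  shows "uniformly_rel_K_polystable \<Lambda>"
proof -
  obtain A k where A: "invertible A" "k < 5" "(*v) A ` rep2 ` set (models2 ! k) = \<Lambda>"
    by (rule toric_Fano2_classification[OF F])
  have "k \<in> {0, 1, 2, 3, 4}" using A(2) by auto
  then have "polystability_certificate (rep2 ` set (models2 ! k))"
    using certificate2_0 certificate2_1 certificate2_2 certificate2_3 certificate2_4 by auto
  from certificate_image[OF A(1) this] show ?thesis
    using certificate_imp_polystable[OF F] unfolding A(3) by blast
qed

section \<open>Isomorphism classes\<close>

text \<open>Injectivity is the inequivalence of the models, surjectivity the classification; that
  the models are toric Fano makes both meaningful.\<close>

lemma toric_Fano3_classes: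
  "bij_betw (\<lambda>k. toric_Fano_iso `` {rep3 ` set (models3 ! k)}) {..<18} ({\<Lambda> :: (int^3) set. toric_Fano \<Lambda>} // toric_Fano_iso)"
  unfolding bij_betw_def
proof
  show "inj_on (\<lambda>k. toric_Fano_iso `` {rep3 ` set (models3 ! k)}) {..<18}"
  proof (rule inj_onI)
    fix i j :: nat
    assume ij: "i \<in> {..<18}" "j \<in> {..<18}"
      and eq: "toric_Fano_iso `` {rep3 ` set (models3 ! i)} = toric_Fano_iso `` {rep3 ` set (models3 ! j)}"
    have "rep3 ` set (models3 ! j) \<in> {\<Lambda>. toric_Fano \<Lambda>}" using toric_Fano_models3 ij by simp
    from eq_equiv_class[OF eq equiv_toric_Fano_iso this, unfolded toric_Fano_iso_def mem_Collect_eq prod.case]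
    obtain A where A: "invertible A" "(*v) A ` rep3 ` set (models3 ! i) = rep3 ` set (models3 ! j)"
      by (elim conjE exE)
    show "i = j"
    proof (rule ccontr)
      assume "i \<noteq> j"
      then have "(*v) A ` rep3 ` set (models3 ! i) \<noteq> rep3 ` set (models3 ! j)"
        by (rule models3_inequivalent[OF ij[unfolded lessThan_iff] _ A(1)])
      then show False using A(2) by (rule notE)
    qed
  qed
  show "(\<lambda>k. toric_Fano_iso `` {rep3 ` set (models3 ! k)}) ` {..<18} = {\<Lambda> :: (int^3) set. toric_Fano \<Lambda>} // toric_Fano_iso"
  proof (intro equalityI subsetI)
    fix C assume "C \<in> (\<lambda>k. toric_Fano_iso `` {rep3 ` set (models3 ! k)}) ` {..<18}"
    then obtain k where "C = toric_Fano_iso `` {rep3 ` set (models3 ! k)}" "k < 18" by blast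
    then show "C \<in> {\<Lambda>. toric_Fano \<Lambda>} // toric_Fano_iso"
      using toric_Fano_models3 by (simp add: quotientI)
  next
    fix C assume "C \<in> {\<Lambda> :: (int^3) set. toric_Fano \<Lambda>} // toric_Fano_iso"
    then obtain \<Lambda> where \<Lambda>: "toric_Fano \<Lambda>" "C = toric_Fano_iso `` {\<Lambda>}" by (auto elim: quotientE)
    obtain A k where A: "invertible A" "k < 18" "(*v) A ` \<Lambda> = rep3 ` set (models3 ! k)"
      by (rule toric_Fano3_classification[OF \<Lambda>(1)])
    have "(\<Lambda>, rep3 ` set (models3 ! k)) \<in> toric_Fano_iso"
      using \<Lambda>(1) A(1,3) toric_Fano_models3[OF A(2)] unfolding toric_Fano_iso_def by blast
    then have "C = toric_Fano_iso `` {rep3 ` set (models3 ! k)}"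
      unfolding \<Lambda>(2) by (rule equiv_class_eq[OF equiv_toric_Fano_iso])
    then show "C \<in> (\<lambda>k. toric_Fano_iso `` {rep3 ` set (models3 ! k)}) ` {..<18}" using A(2) by blast
  qed
qed

text \<open>Every member of a class is the image of the representative under a lattice automorphism,
  so one certificate covers the class.\<close>

lemma certificate_class:
  fixes \<Lambda> :: "(int^'n::{finite,wellorder}) set"
  assumes "polystability_certificate \<Lambda>" "\<Lambda>' \<in> toric_Fano_iso `` {\<Lambda>}"
  shows "uniformly_rel_K_polystable \<Lambda>'"
proof -
  obtain A where "invertible A" "(\<lambda>a. A *v a) ` \<Lambda> = \<Lambda>'" "toric_Fano \<Lambda>'"
    using assms(2) unfolding toric_Fano_iso_def by blast
  then show ?thesis
    using certificate_imp_polystable certificate_image[OF _ assms(1)] by blast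
qed

theorem corollary1p0p6:
  shows "(\<forall>\<Lambda> :: (int ^ 2) set. toric_Fano \<Lambda> \<longrightarrow> uniformly_rel_K_polystable \<Lambda>) \<and>
         card ({\<Lambda> :: (int ^ 3) set. toric_Fano \<Lambda>} // toric_Fano_iso) = 18 \<and>
         card {C \<in> {\<Lambda> :: (int ^ 3) set. toric_Fano \<Lambda>} // toric_Fano_iso.
                 \<forall>\<Lambda>\<in>C. uniformly_rel_K_polystable \<Lambda>} \<ge> 13"
proof (intro conjI)
  show "\<forall>\<Lambda> :: (int ^ 2) set. toric_Fano \<Lambda> \<longrightarrow> uniformly_rel_K_polystable \<Lambda>"
    using toric_del_Pezzo_polystable by blast
  let ?Q = "{\<Lambda> :: (int ^ 3) set. toric_Fano \<Lambda>} // toric_Fano_iso"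
    and ?c = "\<lambda>k. toric_Fano_iso `` {rep3 ` set (models3 ! k)}"
  \<comment> \<open>\<open>?K\<close> collects the indices of the certified models; 5, 7, 12, 13 and
    14 remain.\<close>
  let ?G = "{C \<in> ?Q. \<forall>\<Lambda>\<in>C. uniformly_rel_K_polystable \<Lambda>}"
    and ?K = "{0, 1, 2, 3, 4, 6, 8, 9, 10, 11, 15, 16, 17} :: nat set"
  show Q: "card ?Q = 18" using bij_betw_same_card[OF toric_Fano3_classes] by simp
  have K: "?K \<subseteq> {..<18}" by simp
  have "polystability_certificate (rep3 ` set (models3 ! k))" if "k \<in> ?K" for k
    using that certificate3_0 certificate3_1 certificate3_2 certificate3_3 certificate3_4 certificate3_6 certificate3_8
      certificate3_9 certificate3_10 certificate3_11 certificate3_15 certificate3_16 certificate3_17 by blast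
  then have "\<forall>\<Lambda>\<in>?c k. uniformly_rel_K_polystable \<Lambda>" if "k \<in> ?K" for k
    using that certificate_class by blast
  moreover have "?c k \<in> ?Q" if "k \<in> ?K" for k
    by (rule bij_betwE[OF toric_Fano3_classes, rule_format, OF subsetD[OF K that]])
  ultimately have "?c ` ?K \<subseteq> ?G" by (intro image_subsetI CollectI conjI)
  moreover have "finite ?G" using Q card_ge_0_finite[of ?Q] by simp
  ultimately have "card (?c ` ?K) \<le> card ?G" by (intro card_mono)
  moreover have "card (?c ` ?K) = card ?K"
    by (rule card_image[OF inj_on_subset[OF bij_betw_imp_inj_on[OF toric_Fano3_classes] K]])
  ultimately show "13 \<le> card ?G" by simp
qed

end
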